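(* For any triangulation $\Gamma$ of the convex $n$-gon $P$, there is an open embedding $$\iota_\Gamma \colon (\mathbb{G}_m)^{2n-4} \hookrightarrow \check X$$ such that the restriction of the Landau--Ginzburg potential $W\colon \check X\to\mathbb{A}^1$ coincides with the potential function $W_\Gamma$, i.e. $\iota_\Gamma^* W = W_\Gamma$. Moreover, if $\Gamma$ and $\Gamma'$ are related by a Whitehead move in a quadrilateral with vertices $i<j<k<l$ (interchanging the diagonals $ik$ and $jl$), then by a suitable choice of coordinates on the tori $(\mathbb{G}_m)^{2n-4}$ (regarded as functions on open subsets of $\check X$ via $\iota_\Gamma$ and $\iota_{\Gamma'}$) the change of variables $$ y' = \frac1y\cdot\frac{y_1y_2y_3y_4}{y_1y_3+y_2y_4}, $$ where $y_1=y(i,j)$, $y_2=y(j,k)$, $y_3=y(k,l)$, $y_4=y(i,l)$, $y=y(i,k)$, $y'=y(j,l)$, is identified with the Plücker relation $$ p_{ik}p_{jl}=p_{ij}p_{kl}+p_{il}p_{jk}. $$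
   Context: Fix an integer $n>2$ and a constant $\lambda>0$. Let $\Lambda$ be the quotient field of the Novikov ring $\Lambda_0=\{\sum_{i\ge0} a_iT^{\lambda_i}\mid a_i\in\mathbb{C},\ \lambda_i\in\mathbb{R}_{\ge0},\ \lambda_i\to\infty\}$ and put $q=T^\lambda\in\Lambda$. Varieties below are over $\Lambda$. Triangulations. Let $P$ be a convex planar $n$-gon with vertices labelled $1,\dots,n$ in cyclic order. For $i<j$ write $\epsilon(i,j)$ for the side or diagonal joining vertices $i$ and $j$ (equivalently, the dual edge of the dual tree). For a triangulation $\Gamma$ of $P$ (by $n-3$ pairwise non-crossing diagonals), $\Gamma$ also denotes the set of all $\epsilon(i,j)$ that are sides of $P$ or diagonals of the triangulation, and $\mathrm{Prn}\,\Gamma=\Gamma\setminus\{\epsilon(1,n)\}$, a set with $2n-4$ elements. Two triangulations $\Gamma,\Gamma'$ are related by a Whitehead move in the quadrilateral with vertices $a<b<c<d$ if $\epsilon(a,b),\epsilon(b,c),\epsilon(c,d),\epsilon(a,d)$ lie in both, $\epsilon(a,c)\in\Gamma$, $\epsilon(b,d)\in\Gamma'$, and $\Gamma\setminus\{\epsilon(a,c)\}=\Gamma'\setminus\{\epsilon(b,d)\}$. Potential function. $W_\Gamma\colon(\mathbb{G}_m)^{2n-4}\to\mathbb{A}^1$ is the Laurent polynomial in the variables $(y_{ij})_{\epsilon(i,j)\in\mathrm{Prn}\,\Gamma}$ (with parameter $q$) expressing the Floer-theoretic potential function of the Lagrangian torus fibers of the integrable system $\Psi_\Gamma$ on $\mathrm{Gr}(2,n)$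 associated with $\Gamma$, where $y_{ij}=T^{u_{ij}}e^{x_{ij}}$. Explicitly, put $$y(i,i+1)=y_{i,i+1}^{1/2}\ (1\le i\le n-1),\quad y(1,n)=\frac{q}{(\prod_{k=1}^{n-1}y_{k,k+1})^{1/2}},\quad y(i,j)=\frac{y_{ij}}{(\prod_{k=i}^{j-1}y_{k,k+1})^{1/2}}\ \text{for diagonals } \epsilon(i,j).$$ Then $$W_\Gamma=\sum\left(\frac{y(i,j)y(j,k)}{y(i,k)}+\frac{y(i,j)y(i,k)}{y(j,k)}+\frac{y(i,k)y(j,k)}{y(i,j)}\right),$$ the sum being over all triangles of $\Gamma$, with vertices $i<j<k$ (this is a genuine Laurent polynomial in the $y_{ij}$). In terms of the $y_{ij}$, the change of variables for a Whitehead move in the quadrilateral $a<b<c<d$ reads $y_{ac}y_{bd}=\dfrac{y_{ab}y_{bc}y_{cd}y_{ad}}{y_{ab}y_{cd}+y_{ad}y_{bc}/\prod_{i=b}^{c-1}y_{i,i+1}}$ with the convention $y_{1n}=q$; all other coordinates are unchanged. Landau--Ginzburg model (Marsh--Rietsch). Let $p_{ij}$ ($1\le i<j\le n$) be the Plücker coordinates on $\mathrm{Gr}(2,n)$ (canonically identified with the dual Grassmannian $\mathrm{Gr}(n-2,(\mathbb{C}^n)^* )$, base changed to $\Lambda$); indices are read modulo $n$, and $p_{ij}$ with $i>j$ means $p_{ji}$ (so $p_{n,n+1}=p_{1n}$, $p_{n-1,n+1}=p_{1,n-1}$, $p_{n,n+2}=p_{2n}$). Let $D=\{p_{12}=0\}\cup\{p_{23}=0\}\cup\dots\cup\{p_{n-1,n}=0\}\cup\{p_{1n}=0\}$,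 $\check X=\mathrm{Gr}(2,n)\setminus D$, and $$W=\sum_{i=1}^n\frac{p_{i,i+2}}{p_{i,i+1}}\,q^{\delta_{i,n-1}}\colon\check X\to\mathbb{A}^1,$$ where $\delta_{i,n-1}$ is the Kronecker delta. *)

theory Defs
  imports "HOL-Analysis.Analysis" "HOL-Library.Function_Algebras"
    "HOL-Computational_Algebra.Fraction_Field" "HOL-Computational_Algebra.Formal_Power_Series"
begin

text \<open>
  The series \<open>\<Sum>x. f x T\<^sup>x\<close> lies in the Novikov ring iff \<open>f\<close> vanishes on negative exponents and has
  only finitely many nonzero coefficients below every bound.
\<close>

definition left_finite :: "(real \<Rightarrow> complex) \<Rightarrow> bool" where
  "left_finite f \<longleftrightarrow> (\<forall>x<0. f x = 0) \<and> (\<forall>M. finite {x. x \<le> M \<and> f x \<noteq> 0})"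

definition nov_conv :: "(real \<Rightarrow> complex) \<Rightarrow> (real \<Rightarrow> complex) \<Rightarrow> real \<Rightarrow> complex" where
  "nov_conv f g x = (\<Sum>a | f a \<noteq> 0 \<and> g (x - a) \<noteq> 0. f a * g (x - a))"

lemma left_finite_neg: "left_finite f \<Longrightarrow> x < 0 \<Longrightarrow> f x = 0"
  by (simp add: left_finite_def)

lemma left_finite_fin: "left_finite f \<Longrightarrow> finite {x. x \<le> M \<and> f x \<noteq> 0}"
  by (simp add: left_finite_def)

lemma left_finite_add: "left_finite f \<Longrightarrow> left_finite g \<Longrightarrow> left_finite (\<lambda>x. f x + g x)"
  unfolding left_finite_def
proof (intro conjI allI impI; elim conjE)
  fix M assume "\<forall>M. finite {x. x \<le> M \<and> f x \<noteq> 0}" "\<forall>M. finite {x. x \<le> M \<and> g x \<noteq> 0}"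
  then have "finite ({x. x \<le> M \<and> f x \<noteq> 0} \<union> {x. x \<le> M \<and> g x \<noteq> 0})" by blast
  then show "finite {x. x \<le> M \<and> f x + g x \<noteq> 0}" by (rule rev_finite_subset) auto
qed auto

lemma conv_eq:
  assumes "left_finite f" "left_finite g" "x \<le> M"
  shows "nov_conv f g x = (\<Sum>a | a \<le> M \<and> f a \<noteq> 0. f a * g (x - a))"
  unfolding nov_conv_def
proof (rule sum.mono_neutral_left)
  show "finite {a. a \<le> M \<and> f a \<noteq> 0}" using assms(1) by (rule left_finite_fin)
  show "{a. f a \<noteq> 0 \<and> g (x - a) \<noteq> 0} \<subseteq> {a. a \<le> M \<and> f a \<noteq> 0}"
    using left_finite_neg[OF assms(2)] assms(3) by force
qed auto

lemma conv_commute: "nov_conv f g x = nov_conv g f x"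
  unfolding nov_conv_def
  by (rule sum.reindex_bij_witness[where i="\<lambda>a. x - a" and j="\<lambda>a. x - a"]) auto

lemma conv_nz:
  assumes "nov_conv f g x \<noteq> 0" obtains a where "f a \<noteq> 0" "g (x - a) \<noteq> 0"
proof -
  have "{a. f a \<noteq> 0 \<and> g (x - a) \<noteq> 0} \<noteq> {}"
  proof
    assume "{a. f a \<noteq> 0 \<and> g (x - a) \<noteq> 0} = {}"
    then have "nov_conv f g x = 0" by (simp only: nov_conv_def sum.empty)
    with assms show False by blast
  qed
  then show ?thesis using that by blast
qed

lemma left_finite_conv:
  assumes f: "left_finite f" and g: "left_finite g"
  shows "left_finite (nov_conv f g)"
  unfolding left_finite_def
proof (intro conjI allI impI)
  fix x :: real assume x: "x < 0"
  show "nov_conv f g x = 0"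
  proof (rule ccontr)
    assume "nov_conv f g x \<noteq> 0"
    then obtain a where a: "f a \<noteq> 0" "g (x - a) \<noteq> 0" by (rule conv_nz)
    have "\<not> a < 0" "\<not> x - a < 0" using a left_finite_neg[OF f] left_finite_neg[OF g] by blast+
    with x show False by linarith
  qed
next
  fix M
  have "finite ((\<lambda>(a,b). a + b) ` ({a. a \<le> M \<and> f a \<noteq> 0} \<times> {b. b \<le> M \<and> g b \<noteq> 0}))"
    using left_finite_fin[OF f] left_finite_fin[OF g] by blast
  then show "finite {x. x \<le> M \<and> nov_conv f g x \<noteq> 0}"
  proof (rule rev_finite_subset, safe)
    fix x assume x: "x \<le> M" "nov_conv f g x \<noteq> 0"
    from x(2) obtain a where a: "f a \<noteq> 0" "g (x - a) \<noteq> 0" by (rule conv_nz)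
    have "\<not> a < 0" "\<not> x - a < 0" using a left_finite_neg[OF f] left_finite_neg[OF g] by blast+
    then show "x \<in> (\<lambda>(a,b). a + b) ` ({a. a \<le> M \<and> f a \<noteq> 0} \<times> {b. b \<le> M \<and> g b \<noteq> 0})"
      using a x by (intro image_eqI[of _ _ "(a, x - a)"]) auto
  qed
qed

lemma conv_assoc:
  assumes f: "left_finite f" and g: "left_finite g" and h: "left_finite h"
  shows "nov_conv (nov_conv f g) h x = nov_conv f (nov_conv g h) x"
proof -
  define A where "A = {a. a \<le> x \<and> f a \<noteq> 0}"
  define B where "B = {b. b \<le> x \<and> g b \<noteq> 0}"
  define C where "C = {c. c \<le> x \<and> nov_conv f g c \<noteq> 0} \<union> (\<lambda>(a,b). a + b) ` (A \<times> B)"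
  have finA: "finite A" unfolding A_def by (rule left_finite_fin[OF f])
  have finB: "finite B" unfolding B_def by (rule left_finite_fin[OF g])
  have finC: "finite C"
    unfolding C_def using finA finB left_finite_fin[OF left_finite_conv[OF f g], of x] by blast
  have "nov_conv (nov_conv f g) h x = (\<Sum>c\<in>C. nov_conv f g c * h (x - c))"
    unfolding conv_eq[OF left_finite_conv[OF f g] h order.refl]
  proof (rule sum.mono_neutral_left)
    show "\<forall>c\<in>C - {a. a \<le> x \<and> nov_conv f g a \<noteq> 0}. nov_conv f g c * h (x - c) = 0"
    proof
      fix c assume "c \<in> C - {a. a \<le> x \<and> nov_conv f g a \<noteq> 0}"
      then have "x - c < 0 \<or> nov_conv f g c = 0" by auto
      then show "nov_conv f g c * h (x - c) = 0" using left_finite_neg[OF h, of "x - c"] by auto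
    qed
    show "{a. a \<le> x \<and> nov_conv f g a \<noteq> 0} \<subseteq> C" unfolding C_def by blast
  qed (rule finC)
  also have "\<dots> = (\<Sum>c\<in>C. (\<Sum>a\<in>A. f a * g (c - a)) * h (x - c))"
  proof (rule sum.cong[OF refl])
    fix c assume "c \<in> C"
    show "nov_conv f g c * h (x - c) = (\<Sum>a\<in>A. f a * g (c - a)) * h (x - c)"
    proof (cases "c \<le> x")
      case True
      then show ?thesis by (simp add: conv_eq[OF f g] A_def)
    next
      case False
      then show ?thesis using left_finite_neg[OF h] by simp
    qed
  qed
  also have "\<dots> = (\<Sum>a\<in>A. \<Sum>c\<in>C. f a * g (c - a) * h (x - c))"
    by (subst sum.swap) (simp add: sum_distrib_right)
  also have "\<dots> = (\<Sum>a\<in>A. \<Sum>b\<in>B. f a * g b * h (x - a - b))"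
  proof (rule sum.cong[OF refl])
    fix a assume a: "a \<in> A"
    then have "f a \<noteq> 0" by (simp add: A_def)
    then have a0: "a \<ge> 0" using left_finite_neg[OF f, of a] by (meson not_le)
    have "(\<Sum>c\<in>C. f a * g (c - a) * h (x - c)) = (\<Sum>c\<in>(\<lambda>b. a + b) ` B. f a * g (c - a) * h (x - c))"
    proof (rule sum.mono_neutral_right[OF finC])
      show "(+) a ` B \<subseteq> C" using a by (auto simp: C_def)
      show "\<forall>c\<in>C - (+) a ` B. f a * g (c - a) * h (x - c) = 0"
      proof
        fix c assume c: "c \<in> C - (+) a ` B"
        then have "c - a \<notin> B" by (metis DiffE add.commute diff_add_cancel image_eqI)
        then have "c - a > x \<or> g (c - a) = 0" by (auto simp: B_def)
        then show "f a * g (c - a) * h (x - c) = 0"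
          using a0 left_finite_neg[OF h, of "x - c"] by auto
      qed
    qed
    also have "\<dots> = (\<Sum>b\<in>B. f a * g b * h (x - a - b))"
      by (subst sum.reindex) (auto simp: algebra_simps intro!: inj_onI)
    finally show "(\<Sum>c\<in>C. f a * g (c - a) * h (x - c)) = (\<Sum>b\<in>B. f a * g b * h (x - a - b))" .
  qed
  also have "\<dots> = (\<Sum>a\<in>A. f a * nov_conv g h (x - a))"
  proof (rule sum.cong[OF refl])
    fix a assume a: "a \<in> A"
    then have "f a \<noteq> 0" by (simp add: A_def)
    then have a0: "a \<ge> 0" using left_finite_neg[OF f, of a] by (meson not_le)
    then have "nov_conv g h (x - a) = (\<Sum>b\<in>B. g b * h (x - a - b))"
      using conv_eq[OF g h, of "x - a" x] by (simp add: B_def)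
    then show "(\<Sum>b\<in>B. f a * g b * h (x - a - b)) = f a * nov_conv g h (x - a)"
      by (simp add: sum_distrib_left mult.assoc)
  qed
  also have "\<dots> = nov_conv f (nov_conv g h) x"
    using conv_eq[OF f left_finite_conv[OF g h] order.refl, of x] by (simp add: A_def)
  finally show ?thesis .
qed

lemma conv_add:
  assumes f: "left_finite f" and g: "left_finite g" and h: "left_finite h"
  shows "nov_conv (\<lambda>x. f x + g x) h x = nov_conv f h x + nov_conv g h x"
proof -
  note c = conv_commute[of _ h x]
  show ?thesis unfolding c
    by (simp add: conv_eq[OF h f order.refl] conv_eq[OF h g order.refl]
        conv_eq[OF h left_finite_add[OF f g] order.refl] algebra_simps sum.distrib)
qed

typedef novikov0 = "{f. left_finite f}"
  morphisms nov_coeff Abs_novikov0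
  by (rule exI[of _ "\<lambda>_. 0"]) (auto simp: left_finite_def)

setup_lifting type_definition_novikov0

lemma left_finite_coeff: "left_finite (nov_coeff f)"
  using nov_coeff[of f] by simp

lemma novikov0_eqI: "(\<And>x. nov_coeff f x = nov_coeff g x) \<Longrightarrow> f = g"
  by (metis nov_coeff_inverse ext)

lemma left_finite_if:
  assumes "0 \<le> a" shows "left_finite (\<lambda>x. if x = a then c else 0)"
  unfolding left_finite_def
proof (intro conjI allI impI)
  fix M :: real
  show "finite {x. x \<le> M \<and> (if x = a then c else 0) \<noteq> 0}"
    by (rule finite_subset[of _ "{a}"]) (auto split: if_splits)
qed (use assms in simp)

instantiation novikov0 :: comm_ring_1
begin

lift_definition zero_novikov0 :: novikov0 is "\<lambda>_. 0" by (simp add: left_finite_def)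
lift_definition one_novikov0 :: novikov0 is "\<lambda>x. if x = 0 then 1 else 0"
  by (rule left_finite_if) simp
lift_definition plus_novikov0 :: "novikov0 \<Rightarrow> novikov0 \<Rightarrow> novikov0" is "\<lambda>f g x. f x + g x"
  by (rule left_finite_add)
lift_definition uminus_novikov0 :: "novikov0 \<Rightarrow> novikov0" is "\<lambda>f x. - f x" by (simp add: left_finite_def)
definition minus_novikov0 :: "novikov0 \<Rightarrow> novikov0 \<Rightarrow> novikov0" where
  "minus_novikov0 f g = f + (- g)"
lift_definition times_novikov0 :: "novikov0 \<Rightarrow> novikov0 \<Rightarrow> novikov0" is nov_conv
  by (rule left_finite_conv)

lemma nov_coeff_mult: "nov_coeff (f * g) = nov_conv (nov_coeff f) (nov_coeff g)"
  by (rule times_novikov0.rep_eq)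

instance
proof
  fix a b c :: novikov0
  show "a + b + c = a + (b + c)" by (rule novikov0_eqI) (simp add: plus_novikov0.rep_eq zero_novikov0.rep_eq uminus_novikov0.rep_eq)
  show "a + b = b + a" by (rule novikov0_eqI) (simp add: plus_novikov0.rep_eq zero_novikov0.rep_eq uminus_novikov0.rep_eq)
  show "0 + a = a" by (rule novikov0_eqI) (simp add: plus_novikov0.rep_eq zero_novikov0.rep_eq uminus_novikov0.rep_eq)
  show "- a + a = 0" by (rule novikov0_eqI) (simp add: plus_novikov0.rep_eq zero_novikov0.rep_eq uminus_novikov0.rep_eq)
  show "a - b = a + - b" by (simp add: minus_novikov0_def)
  show "a * b = b * a" by (rule novikov0_eqI) (simp only: nov_coeff_mult conv_commute[of "nov_coeff a"])
  show "a * b * c = a * (b * c)"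
    by (rule novikov0_eqI) (simp add: nov_coeff_mult conv_assoc left_finite_coeff)
  show "(a + b) * c = a * c + b * c"
    by (rule novikov0_eqI)
      (simp add: nov_coeff_mult plus_novikov0.rep_eq conv_add[OF left_finite_coeff left_finite_coeff left_finite_coeff])
  show "(0::novikov0) \<noteq> 1" 
    using zero_novikov0.rep_eq one_novikov0.rep_eq zero_neq_one by metis
  show "1 * a = a"
  proof (rule novikov0_eqI)
    fix x
    have "nov_coeff (1 * a) x = (\<Sum>s\<in>{s. nov_coeff 1 s \<noteq> 0 \<and> nov_coeff a (x - s) \<noteq> 0}. nov_coeff 1 s * nov_coeff a (x - s))"
      by (simp add: nov_coeff_mult nov_conv_def)
    also have "\<dots> = (\<Sum>s\<in>{0}. nov_coeff 1 s * nov_coeff a (x - s))"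
      by (rule sum.mono_neutral_left) (auto simp: one_novikov0.rep_eq)
    finally show "nov_coeff (1 * a) x = nov_coeff a x" by (simp add: one_novikov0.rep_eq)
  qed
qed

end

lemma nov_leading:
  assumes h: "h \<noteq> 0"
  shows "\<exists>v. nov_coeff h v \<noteq> 0 \<and> (\<forall>x<v. nov_coeff h x = 0)"
proof -
  have "\<not> (\<forall>x. nov_coeff h x = nov_coeff 0 x)" using h novikov0_eqI[of h 0] by blast
  then obtain M where M: "nov_coeff h M \<noteq> 0" by (auto simp: zero_novikov0.rep_eq)
  let ?S = "{x. x \<le> M \<and> nov_coeff h x \<noteq> 0}"
  have S: "finite ?S" by (rule left_finite_fin[OF left_finite_coeff])
  have S': "?S \<noteq> {}" using M by blast
  have "Min ?S \<in> ?S" using Min_in[OF S S'] .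
  moreover have "nov_coeff h x = 0" if x: "x < Min ?S" for x
  proof (rule ccontr)
    assume nz: "nov_coeff h x \<noteq> 0"
    have "Min ?S \<le> M" using \<open>Min ?S \<in> ?S\<close> by blast
    with x have "x \<le> M" by linarith
    with nz have "x \<in> ?S" by blast
    from Min_le[OF S this] x show False by linarith
  qed
  ultimately show ?thesis by blast
qed

instance novikov0 :: idom
proof
  fix f g :: novikov0
  assume "f \<noteq> 0" "g \<noteq> 0"
  from nov_leading[OF this(1)] nov_leading[OF this(2)] obtain v w where
    v: "nov_coeff f v \<noteq> 0" "\<And>x. x < v \<Longrightarrow> nov_coeff f x = 0" and
    w: "nov_coeff g w \<noteq> 0" "\<And>x. x < w \<Longrightarrow> nov_coeff g x = 0" by blast
  have "{a. nov_coeff f a \<noteq> 0 \<and> nov_coeff g (v + w - a) \<noteq> 0} = {v}"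
  proof -
    have "a = v" if a: "nov_coeff f a \<noteq> 0" "nov_coeff g (v + w - a) \<noteq> 0" for a
    proof -
      have "\<not> a < v" "\<not> v + w - a < w" using v(2) w(2) a by blast+
      then show ?thesis by linarith
    qed
    then show ?thesis using v(1) w(1) by auto
  qed
  then have "nov_coeff (f * g) (v + w) = nov_coeff f v * nov_coeff g w"
    by (simp add: nov_coeff_mult nov_conv_def)
  then have "nov_coeff (f * g) (v + w) \<noteq> 0" using v(1) w(1) by simp
  then show "f * g \<noteq> 0" by (auto simp: zero_novikov0.rep_eq)
qed

lift_definition nov_monom :: "complex \<Rightarrow> real \<Rightarrow> novikov0" is
  "\<lambda>c a x. if x = a \<and> 0 \<le> a then c else 0"
proof -
  fix c :: complex and a :: real
  show "left_finite (\<lambda>x. if x = a \<and> 0 \<le> a then c else 0)"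
  proof (cases "0 \<le> a")
    case True
    then show ?thesis using left_finite_if[OF True, of c] by simp
  next
    case False
    then have "(\<lambda>x. if x = a \<and> 0 \<le> a then c else 0) = (\<lambda>_. 0)" by auto
    then show ?thesis by (simp add: left_finite_def)
  qed
qed

lemma nov_coeff_monom_mult:
  assumes a: "0 \<le> a"
  shows "nov_coeff (nov_monom c a * f) x = c * nov_coeff f (x - a)"
proof -
  have "nov_coeff (nov_monom c a * f) x =
      (\<Sum>s\<in>{s. nov_coeff (nov_monom c a) s \<noteq> 0 \<and> nov_coeff f (x - s) \<noteq> 0}.
        nov_coeff (nov_monom c a) s * nov_coeff f (x - s))"
    by (simp only: nov_coeff_mult nov_conv_def)
  also have "\<dots> = (\<Sum>s\<in>{a}. nov_coeff (nov_monom c a) s * nov_coeff f (x - s))"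
  proof (rule sum.mono_neutral_left)
    show "{s. nov_coeff (nov_monom c a) s \<noteq> 0 \<and> nov_coeff f (x - s) \<noteq> 0} \<subseteq> {a}"
      by (auto simp: nov_monom.rep_eq split: if_splits)
    show "\<forall>i\<in>{a} - {s. nov_coeff (nov_monom c a) s \<noteq> 0 \<and> nov_coeff f (x - s) \<noteq> 0}.
        nov_coeff (nov_monom c a) i * nov_coeff f (x - i) = 0"
      by (intro ballI, elim DiffE) (simp only: mem_Collect_eq de_Morgan_conj not_not, elim disjE; simp)
  qed simp
  finally show ?thesis using a by (simp add: nov_monom.rep_eq)
qed

lemma nov_monom_mult:
  assumes "0 \<le> a" "0 \<le> b"
  shows "nov_monom c a * nov_monom d b = nov_monom (c * d) (a + b)"
proof (rule novikov0_eqI)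
  fix x
  have "x - a = b \<longleftrightarrow> x = a + b" by linarith
  then show "nov_coeff (nov_monom c a * nov_monom d b) x = nov_coeff (nov_monom (c * d) (a + b)) x"
    using assms by (simp add: nov_coeff_monom_mult nov_monom.rep_eq)
qed

lemma nov_monom_1: "nov_monom 1 0 = 1"
  by (rule novikov0_eqI) (simp add: nov_monom.rep_eq one_novikov0.rep_eq)

lemma nov_coeff_add: "nov_coeff (f + g) x = nov_coeff f x + nov_coeff g x"
  by (simp add: plus_novikov0.rep_eq)

lemma nov_coeff_diff: "nov_coeff (f - g) x = nov_coeff f x - nov_coeff g x"
  unfolding minus_novikov0_def plus_novikov0.rep_eq uminus_novikov0.rep_eq by simp

lemma nov_coeff_0: "nov_coeff 0 x = 0"
  by (simp add: zero_novikov0.rep_eq)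

lemma nov_coeff_neg: "x < 0 \<Longrightarrow> nov_coeff f x = 0"
  by (rule left_finite_neg[OF left_finite_coeff])

lemma nov_coeff_sum: "nov_coeff (sum F A) x = (\<Sum>i\<in>A. nov_coeff (F i) x)"
  by (induction A rule: infinite_finite_induct) (simp_all add: nov_coeff_0 nov_coeff_add)

text \<open>The elements of valuation at least \<open>c\<close>.\<close>

definition nov_ideal :: "real \<Rightarrow> novikov0 set" where
  "nov_ideal c = {f. \<forall>x<c. nov_coeff f x = 0}"

lemma nov_idealD: "f \<in> nov_ideal c \<Longrightarrow> x < c \<Longrightarrow> nov_coeff f x = 0"
  by (simp add: nov_ideal_def)

lemma nov_ideal_add: "f \<in> nov_ideal c \<Longrightarrow> g \<in> nov_ideal c \<Longrightarrow> f + g \<in> nov_ideal c"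
  by (simp add: nov_ideal_def nov_coeff_add)

lemma nov_ideal_sum: "(\<And>i. i \<in> A \<Longrightarrow> F i \<in> nov_ideal c) \<Longrightarrow> sum F A \<in> nov_ideal c"
  by (simp add: nov_ideal_def nov_coeff_sum)

lemma nov_ideal_0: "f \<in> nov_ideal 0"
  by (simp add: nov_ideal_def nov_coeff_neg)

lemma nov_ideal_mono: "f \<in> nov_ideal d \<Longrightarrow> c \<le> d \<Longrightarrow> f \<in> nov_ideal c"
  by (simp add: nov_ideal_def)

lemma nov_ideal_mult:
  assumes "f \<in> nov_ideal c" "g \<in> nov_ideal d" shows "f * g \<in> nov_ideal (c + d)"
  unfolding nov_ideal_def
proof (intro CollectI allI impI, rule ccontr)
  fix x assume x: "x < c + d" "nov_coeff (f * g) x \<noteq> 0"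
  from x(2) have "nov_conv (nov_coeff f) (nov_coeff g) x \<noteq> 0" unfolding nov_coeff_mult .
  then obtain a where "nov_coeff f a \<noteq> 0" "nov_coeff g (x - a) \<noteq> 0" by (rule conv_nz)
  then have "\<not> a < c" "\<not> x - a < d" using assms nov_idealD by blast+
  with x(1) show False by linarith
qed

lemma nov_ideal_mult_right: "g \<in> nov_ideal d \<Longrightarrow> f * g \<in> nov_ideal d"
  using nov_ideal_mult[OF nov_ideal_0, of g d f] by simp

lemma nov_ideal_power: "g \<in> nov_ideal v \<Longrightarrow> g ^ k \<in> nov_ideal (real k * v)"
proof (induction k)
  case (Suc k)
  have "g * g ^ k \<in> nov_ideal (v + real k * v)" using Suc nov_ideal_mult by blast
  then show ?case by (simp add: algebra_simps)
qed (simp add: nov_ideal_0)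

lemma half_binomial_conv:
  "(\<Sum>i\<le>k. (((1/2)::complex) gchoose i) * ((1/2) gchoose (k - i))) = 1 gchoose k"
proof -
  have "fps_nth (fps_binomial ((1/2) + (1/2) :: complex)) k
      = fps_nth (fps_binomial (1/2) * fps_binomial (1/2)) k"
    by (simp only: fps_binomial_add_mult)
  then show ?thesis by (simp add: fps_mult_nth atMost_atLeast0)
qed

lemma sqrt_one_plus:
  assumes v: "v > 0" and g: "g \<in> nov_ideal v"
  shows "\<exists>h. h * h = 1 + g"
proof -
  define c :: "nat \<Rightarrow> complex" where "c k = (1/2) gchoose k" for k
  define C :: "complex \<Rightarrow> novikov0" where "C a = nov_monom a 0" for a
  have Cmult: "nov_coeff (C a * f) x = a * nov_coeff f x" for a f x
    by (simp add: C_def nov_coeff_monom_mult)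
  have CC: "C a * C b = C (a * b)" for a b by (simp add: C_def nov_monom_mult)
  have Csum: "C (sum F A) = (\<Sum>i\<in>A. C (F i))" for F :: "nat \<Rightarrow> complex" and A
  proof (rule novikov0_eqI)
    fix x
    show "nov_coeff (C (sum F A)) x = nov_coeff (\<Sum>i\<in>A. C (F i)) x"
      by (cases "x = 0") (simp_all add: C_def nov_coeff_sum nov_monom.rep_eq)
  qed
  define hf where "hf x = (\<Sum>k\<le>nat \<lfloor>x / v\<rfloor>. c k * nov_coeff (g ^ k) x)" for x
  have hneg: "hf x = 0" if "x < 0" for x
    using that by (simp add: hf_def nov_coeff_neg)
  have "left_finite hf"
    unfolding left_finite_def
  proof (intro conjI allI impI)
    fix M
    have "finite (\<Union>k\<le>nat \<lfloor>M / v\<rfloor>. {x. x \<le> M \<and> nov_coeff (g ^ k) x \<noteq> 0})"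
      by (intro finite_UN_I finite_atMost left_finite_fin[OF left_finite_coeff])
    then show "finite {x. x \<le> M \<and> hf x \<noteq> 0}"
    proof (rule rev_finite_subset, intro subsetI, elim CollectE conjE)
      fix x assume x: "x \<le> M" "hf x \<noteq> 0"
      from x(2) obtain k where k: "k \<le> nat \<lfloor>x / v\<rfloor>" "c k * nov_coeff (g ^ k) x \<noteq> 0"
        unfolding hf_def by (meson atMost_iff sum.not_neutral_contains_not_neutral)
      have "x / v \<le> M / v" using x(1) v by (simp add: divide_right_mono)
      then have "nat \<lfloor>x / v\<rfloor> \<le> nat \<lfloor>M / v\<rfloor>" by (intro nat_mono floor_mono)
      with k have "k \<le> nat \<lfloor>M / v\<rfloor>" "nov_coeff (g ^ k) x \<noteq> 0" by auto
      with x(1) show "x \<in> (\<Union>k\<le>nat \<lfloor>M / v\<rfloor>. {x. x \<le> M \<and> nov_coeff (g ^ k) x \<noteq> 0})" by blast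
    qed
  qed (rule hneg)
  then obtain h where h: "nov_coeff h = hf"
    using Abs_novikov0_inverse by blast
  define S where "S N = (\<Sum>k<N. C (c k) * g ^ k)" for N
  have d1: "h - S N \<in> nov_ideal (real N * v)" for N
    unfolding nov_ideal_def
  proof (intro CollectI allI impI)
    fix x assume x: "x < real N * v"
    have Sx: "nov_coeff (S N) x = (\<Sum>k<N. c k * nov_coeff (g ^ k) x)"
      by (simp add: S_def nov_coeff_sum Cmult)
    show "nov_coeff (h - S N) x = 0"
    proof (cases "x < 0")
      case True
      then show ?thesis by (simp add: nov_coeff_neg)
    next
      case False
      then have x0: "0 \<le> x / v" using v by simp
      have xN: "x / v < real N" using x v by (simp add: pos_divide_less_eq)
      have "hf x = (\<Sum>k<N. c k * nov_coeff (g ^ k) x)"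
        unfolding hf_def
      proof (rule sum.mono_neutral_left)
        show "{..nat \<lfloor>x / v\<rfloor>} \<subseteq> {..<N}" using xN x0 by (auto; linarith)
        show "\<forall>k\<in>{..<N} - {..nat \<lfloor>x / v\<rfloor>}. c k * nov_coeff (g ^ k) x = 0"
        proof
          fix k assume "k \<in> {..<N} - {..nat \<lfloor>x / v\<rfloor>}"
          then have "nat \<lfloor>x / v\<rfloor> < k" by simp
          then have "x / v < real k" using x0 by linarith
          then have "x < real k * v" using v by (simp add: pos_divide_less_eq)
          then show "c k * nov_coeff (g ^ k) x = 0"
            using nov_idealD[OF nov_ideal_power[OF g]] by simp
        qed
      qed simp
      then show ?thesis by (simp add: nov_coeff_diff h Sx)
    qed
  qed
  have d2: "S N * S N - (1 + g) \<in> nov_ideal (real N * v)" if N: "N \<ge> 2" for N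
  proof -
    define F where "F i j = C (c i * c j) * g ^ (i + j)" for i j
    let ?R = "{..<N} \<times> {..<N} - {(i,j). i + j < N}"
    have sub: "{(i,j). i + j < N} \<subseteq> {..<N} \<times> {..<N}" by auto
    have "S N * S N = (\<Sum>i<N. \<Sum>j<N. F i j)"
      unfolding S_def sum_product F_def
      by (intro sum.cong refl) (simp add: CC[symmetric] power_add mult.assoc mult.left_commute)
    also have "\<dots> = (\<Sum>(i,j)\<in>{..<N} \<times> {..<N}. F i j)" by (simp add: sum.cartesian_product)
    also have "\<dots> = (\<Sum>(i,j)\<in>?R. F i j) + (\<Sum>(i,j)\<in>{(i,j). i + j < N}. F i j)"
      by (rule sum.subset_diff[OF sub]) simp
    also have "(\<Sum>(i,j)\<in>{(i,j). i + j < N}. F i j) = (\<Sum>k<N. \<Sum>i\<le>k. F i (k - i))"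
      by (rule sum.triangle_reindex)
    also have "\<dots> = (\<Sum>k<N. C (1 gchoose k) * g ^ k)"
    proof (rule sum.cong[OF refl])
      fix k
      have "(\<Sum>i\<le>k. F i (k - i)) = (\<Sum>i\<le>k. C (c i * c (k - i)) * g ^ k)"
        by (rule sum.cong) (simp_all add: F_def)
      also have "\<dots> = C (\<Sum>i\<le>k. c i * c (k - i)) * g ^ k"
        by (simp add: Csum sum_distrib_right)
      finally show "(\<Sum>i\<le>k. F i (k - i)) = C (1 gchoose k) * g ^ k"
        by (simp add: c_def half_binomial_conv)
    qed
    also have "\<dots> = (\<Sum>k<2. C (1 gchoose k) * g ^ k)"
    proof (rule sum.mono_neutral_right)
      show "\<forall>k\<in>{..<N} - {..<2}. C (1 gchoose k) * g ^ k = 0"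
      proof
        fix k assume "k \<in> {..<N} - {..<2::nat}"
        then have "(1 choose k) = 0" by simp
        then have "((1::complex) gchoose k) = 0"
          using binomial_gbinomial[of 1 k, where ?'a = complex] by (simp only: of_nat_0 of_nat_1)
        moreover have "C 0 = 0"
          by (rule novikov0_eqI) (simp add: C_def nov_monom.rep_eq zero_novikov0.rep_eq)
        ultimately show "C (1 gchoose k) * g ^ k = 0" by simp
      qed
    qed (use N in auto)
    also have "\<dots> = 1 + g"
      by (simp add: numeral_2_eq_2 C_def nov_monom_1)
    finally have "S N * S N - (1 + g) = (\<Sum>(i,j)\<in>?R. F i j)" by simp
    also have "\<dots> \<in> nov_ideal (real N * v)"
    proof (rule nov_ideal_sum)
      fix p assume "p \<in> ?R"
      then obtain i j where p: "p = (i,j)" "N \<le> i + j" by auto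
      have "g ^ (i + j) \<in> nov_ideal (real N * v)"
        using nov_ideal_power[OF g, of "i + j"]
        by (rule nov_ideal_mono) (use p v in \<open>simp only: mult_right_mono of_nat_le_iff less_imp_le\<close>)
      then show "(case p of (i,j) \<Rightarrow> F i j) \<in> nov_ideal (real N * v)"
        by (simp add: p F_def nov_ideal_mult_right)
    qed
    finally show ?thesis .
  qed
  have "h * h = 1 + g"
  proof (rule novikov0_eqI)
    fix x
    obtain N0 :: nat where N0: "x / v < real N0" using reals_Archimedean2 by blast
    define N where "N = max N0 2"
    have "x / v < real N" using N0 by (simp add: N_def)
    then have x: "x < real N * v" using v by (simp add: pos_divide_less_eq)
    have "h * h - (1 + g) = (h + S N) * (h - S N) + (S N * S N - (1 + g))"
      by (simp add: algebra_simps)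
    also have "\<dots> \<in> nov_ideal (real N * v)"
      by (intro nov_ideal_add nov_ideal_mult_right d1 d2) (simp add: N_def)
    finally have "nov_coeff (h * h - (1 + g)) x = 0" using x by (rule nov_idealD)
    then show "nov_coeff (h * h) x = nov_coeff (1 + g) x" by (simp add: nov_coeff_diff)
  qed
  then show ?thesis ..
qed

lemma nov_sqrt_exists: "\<exists>s :: novikov0. s * s = f"
proof (cases "f = 0")
  case True
  then show ?thesis by (intro exI[of _ 0]) simp
next
  case False
  from nov_leading[OF this] obtain v where
    v': "nov_coeff f v \<noteq> 0" "\<And>x. x < v \<Longrightarrow> nov_coeff f x = 0" by blast
  have "0 \<le> v" using v'(1) nov_coeff_neg[of v f] by (meson not_le)
  note v = this v'
  define a where "a = nov_coeff f v"
  define gf where "gf x = (if 0 < x then nov_coeff f (x + v) / a else 0)" for x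
  have "left_finite gf"
    unfolding left_finite_def
  proof (intro conjI allI impI)
    fix M
    have "finite ((\<lambda>y. y - v) ` {y. y \<le> M + v \<and> nov_coeff f y \<noteq> 0})"
      by (intro finite_imageI left_finite_fin[OF left_finite_coeff])
    then show "finite {x. x \<le> M \<and> gf x \<noteq> 0}"
    proof (rule rev_finite_subset, intro subsetI, elim CollectE conjE)
      fix x assume x: "x \<le> M" "gf x \<noteq> 0"
      then have "nov_coeff f (x + v) \<noteq> 0" by (auto simp: gf_def split: if_splits)
      with x(1) show "x \<in> (\<lambda>y. y - v) ` {y. y \<le> M + v \<and> nov_coeff f y \<noteq> 0}"
        by (intro image_eqI[of _ _ "x + v"]) auto
    qed
  qed (simp add: gf_def)
  then obtain g where g: "nov_coeff g = gf" using Abs_novikov0_inverse by blast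
  define w where "w = Min (insert 1 {x. x \<le> 1 \<and> gf x \<noteq> 0})"
  have fin: "finite {x. x \<le> 1 \<and> gf x \<noteq> 0}" using \<open>left_finite gf\<close> by (rule left_finite_fin)
  have "w \<in> insert 1 {x. x \<le> 1 \<and> gf x \<noteq> 0}"
    unfolding w_def using fin by (intro Min_in) simp_all
  then have w: "w > 0" by (auto simp: gf_def split: if_splits)
  have wle: "w \<le> x" if "x \<in> insert 1 {x. x \<le> 1 \<and> gf x \<noteq> 0}" for x
    unfolding w_def using fin that by (intro Min_le) simp_all
  have "g \<in> nov_ideal w"
    unfolding nov_ideal_def
  proof (intro CollectI allI impI, rule ccontr)
    fix x assume x: "x < w" "nov_coeff g x \<noteq> 0"
    have "w \<le> 1" using wle by blast
    then have "x \<in> insert 1 {x. x \<le> 1 \<and> gf x \<noteq> 0}" using x by (simp add: g)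
    from wle[OF this] x(1) show False by linarith
  qed
  from sqrt_one_plus[OF w this] obtain h where h: "h * h = 1 + g" ..
  have f: "nov_monom a v * (1 + g) = f"
  proof (rule novikov0_eqI)
    fix x
    have "nov_coeff (nov_monom a v * (1 + g)) x = a * nov_coeff (1 + g) (x - v)"
      using v(1) by (rule nov_coeff_monom_mult)
    also have "\<dots> = nov_coeff f x"
    proof -
      consider "x < v" | "x = v" | "x > v" by linarith
      then show ?thesis
      proof cases
        case 1
        then show ?thesis using v(3) by (simp add: nov_coeff_neg)
      next
        case 2
        then show ?thesis by (simp add: nov_coeff_add g gf_def one_novikov0.rep_eq a_def)
      next
        case 3
        then show ?thesis using v(2)
          by (simp add: nov_coeff_add g gf_def one_novikov0.rep_eq a_def)
      qed
    qed
    finally show "nov_coeff (nov_monom a v * (1 + g)) x = nov_coeff f x" .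
  qed
  have "(nov_monom (csqrt a) (v/2) * h) * (nov_monom (csqrt a) (v/2) * h)
      = (nov_monom (csqrt a) (v/2) * nov_monom (csqrt a) (v/2)) * (h * h)"
    by (simp only: mult.assoc mult.left_commute)
  also have "nov_monom (csqrt a) (v/2) * nov_monom (csqrt a) (v/2) = nov_monom a v"
  proof -
    have "csqrt a * csqrt a = a" using power2_csqrt[of a] by (simp only: power2_eq_square)
    moreover have "0 \<le> v / 2" using v(1) by simp
    ultimately show ?thesis using nov_monom_mult[of "v/2" "v/2" "csqrt a" "csqrt a"] by simp
  qed
  also have "nov_monom a v * (h * h) = f" by (simp only: h f)
  finally show ?thesis by blast
qed

text \<open>The quotient field of the Novikov ring.\<close>

type_synonym novikov = "novikov0 fract"

lemma novikov_sqrt_exists: "\<exists>s :: novikov. s ^ 2 = x"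
proof (cases x)
  case (Fract a b)
  obtain s where s: "s * s = a * b" using nov_sqrt_exists by blast
  have "Fract s b * Fract s b = x"
    using Fract s by (simp add: eq_fract)
  then have "Fract s b ^ 2 = x" by (simp only: power2_eq_square)
  then show ?thesis ..
qed

text \<open>
  The Novikov field is algebraically closed, so a variety over it is handled through its set of
  rational points.  A (quasi-projective) variety is encoded as a set of points together with the
  set of pairs \<open>(P, Q)\<close> whose quotients \<open>P / Q\<close> are the basic rational functions: pairs of
  polynomials for an affine variety, pairs of homogeneous polynomials of equal degree for a
  projective one.
\<close>

type_synonym ('p, 'k) variety = "'p set \<times> (('p \<Rightarrow> 'k) \<times> ('p \<Rightarrow> 'k)) set"

abbreviation points :: "('p, 'k) variety \<Rightarrow> 'p set" where
  "points X \<equiv> fst X"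

inductive polynomial_in :: "('i \<Rightarrow> 'p \<Rightarrow> 'k::comm_ring_1) \<Rightarrow> 'i set \<Rightarrow> ('p \<Rightarrow> 'k) \<Rightarrow> bool"
  for x :: "'i \<Rightarrow> 'p \<Rightarrow> 'k" and I :: "'i set" where
  const: "polynomial_in x I (\<lambda>_. a)"
| var: "i \<in> I \<Longrightarrow> polynomial_in x I (x i)"
| add: "polynomial_in x I P \<Longrightarrow> polynomial_in x I Q \<Longrightarrow> polynomial_in x I (\<lambda>p. P p + Q p)"
| mult: "polynomial_in x I P \<Longrightarrow> polynomial_in x I Q \<Longrightarrow> polynomial_in x I (\<lambda>p. P p * Q p)"

inductive homogeneous_in :: "('i \<Rightarrow> 'p \<Rightarrow> 'k::comm_ring_1) \<Rightarrow> 'i set \<Rightarrow> nat \<Rightarrow> ('p \<Rightarrow> 'k) \<Rightarrow> bool"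
  for x :: "'i \<Rightarrow> 'p \<Rightarrow> 'k" and I :: "'i set" where
  const: "homogeneous_in x I 0 (\<lambda>_. a)"
| var: "i \<in> I \<Longrightarrow> homogeneous_in x I 1 (x i)"
| add: "homogeneous_in x I d P \<Longrightarrow> homogeneous_in x I d Q \<Longrightarrow> homogeneous_in x I d (\<lambda>p. P p + Q p)"
| mult: "homogeneous_in x I d P \<Longrightarrow> homogeneous_in x I e Q \<Longrightarrow>
    homogeneous_in x I (d + e) (\<lambda>p. P p * Q p)"

definition zariski :: "('p, 'k::field) variety \<Rightarrow> 'p topology" where
  "zariski X = topology_generated_by {{x \<in> points X. Q x \<noteq> 0} |P Q. (P, Q) \<in> snd X}"

definition regular_on :: "('p, 'k::field) variety \<Rightarrow> 'p set \<Rightarrow> ('p \<Rightarrow> 'k) \<Rightarrow> bool" where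
  "regular_on X U f \<longleftrightarrow>
    (\<forall>x\<in>U. \<exists>V. openin (zariski X) V \<and> x \<in> V \<and> V \<subseteq> U \<and>
      (\<exists>(P, Q)\<in>snd X. \<forall>v\<in>V. Q v \<noteq> 0 \<and> f v = P v / Q v))"

definition morphism :: "('p, 'k::field) variety \<Rightarrow> ('r, 'k) variety \<Rightarrow> ('p \<Rightarrow> 'r) \<Rightarrow> bool" where
  "morphism X Y \<phi> \<longleftrightarrow> continuous_map (zariski X) (zariski Y) \<phi> \<and>
    (\<forall>U f. openin (zariski Y) U \<and> regular_on Y U f \<longrightarrow>
      regular_on X {x \<in> points X. \<phi> x \<in> U} (\<lambda>x. f (\<phi> x)))"

definition isomorphism :: "('p, 'k::field) variety \<Rightarrow> ('r, 'k) variety \<Rightarrow> ('p \<Rightarrow> 'r) \<Rightarrow> bool" where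
  "isomorphism X Y \<phi> \<longleftrightarrow> morphism X Y \<phi> \<and>
    (\<exists>\<psi>. morphism Y X \<psi> \<and> (\<forall>x\<in>points X. \<psi> (\<phi> x) = x) \<and> (\<forall>y\<in>points Y. \<phi> (\<psi> y) = y))"

text \<open>For open \<open>U\<close> this is the open subvariety with underlying set \<open>U\<close>.\<close>

definition subvariety :: "('p, 'k::field) variety \<Rightarrow> 'p set \<Rightarrow> ('p, 'k) variety" where
  "subvariety X U = (points X \<inter> U, snd X)"

definition open_embedding :: "('p, 'k::field) variety \<Rightarrow> ('r, 'k) variety \<Rightarrow> ('p \<Rightarrow> 'r) \<Rightarrow> bool" where
  "open_embedding X Y \<phi> \<longleftrightarrow>
    openin (zariski Y) (\<phi> ` points X) \<and> isomorphism X (subvariety Y (\<phi> ` points X)) \<phi>"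

text \<open>The torus \<open>(G\<^sub>m)\<^sup>I\<close> with coordinates indexed by \<open>I\<close>.\<close>

definition torus :: "'i set \<Rightarrow> ('i \<Rightarrow> 'k::field, 'k) variety" where
  "torus I = (I \<rightarrow>\<^sub>E - {0}, {(P, Q). polynomial_in (\<lambda>i y. y i) I P \<and> polynomial_in (\<lambda>i y. y i) I Q})"


global_interpretation fun_space: vector_space "\<lambda>(c::'k::field) (v::'i \<Rightarrow> 'k). (\<lambda>i. c * v i)"
  by unfold_locales (simp_all add: fun_eq_iff algebra_simps)

text \<open>\<open>k\<^sup>n\<close> is the space of functions supported on \<open>{1..n}\<close>.\<close>

definition Gr2 :: "nat \<Rightarrow> (nat \<Rightarrow> 'k::field) set set" where
  "Gr2 n = {V. V \<subseteq> {v. \<forall>i. i \<notin> {1..n} \<longrightarrow> v i = 0} \<and> fun_space.subspace V \<and> fun_space.dim V = 2}"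

text \<open>
  Pluecker coordinates with respect to an arbitrarily chosen basis of \<open>V\<close>; another basis changes
  them by a common nonzero factor.  Everything below is homogeneous of degree 0 in them, or the
  vanishing of a homogeneous polynomial, so the choice is immaterial.
\<close>

definition plucker :: "(nat \<Rightarrow> 'k::field) set \<Rightarrow> nat \<Rightarrow> nat \<Rightarrow> 'k" where
  "plucker V = (SOME p. \<exists>u v. u \<noteq> v \<and> fun_space.independent {u, v} \<and> fun_space.span {u, v} = V \<and>
    p = (\<lambda>i j. u i * v j - u j * v i))"

definition edges :: "nat \<Rightarrow> (nat \<times> nat) set" where
  "edges n = {(i, j). 1 \<le> i \<and> i < j \<and> j \<le> n}"

definition grassmannian :: "nat \<Rightarrow> ((nat \<Rightarrow> 'k::field) set, 'k) variety" where
  "grassmannian n = (Gr2 n, {(P, Q). \<exists>d.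
      homogeneous_in (\<lambda>(i, j) V. plucker V i j) (edges n) d P \<and>
      homogeneous_in (\<lambda>(i, j) V. plucker V i j) (edges n) d Q})"

text \<open>Indices modulo \<open>n\<close>, represented in \<open>{1..n}\<close>, and \<open>p\<^sub>i\<^sub>j = p\<^sub>j\<^sub>i\<close> (no sign).\<close>

definition vertex :: "nat \<Rightarrow> nat \<Rightarrow> nat" where
  "vertex n i = (i - 1) mod n + 1"

definition plucker_mod :: "nat \<Rightarrow> (nat \<Rightarrow> 'k::field) set \<Rightarrow> nat \<Rightarrow> nat \<Rightarrow> 'k" where
  "plucker_mod n V i j =
    plucker V (min (vertex n i) (vertex n j)) (max (vertex n i) (vertex n j))"

definition mirror :: "nat \<Rightarrow> ((nat \<Rightarrow> 'k::field) set, 'k) variety" where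
  "mirror n = subvariety (grassmannian n)
    (Gr2 n - (\<Union>i\<in>{1..n}. {V. plucker_mod n V i (i + 1) = 0}))"

definition LG_potential :: "nat \<Rightarrow> 'k::field \<Rightarrow> (nat \<Rightarrow> 'k) set \<Rightarrow> 'k" where
  "LG_potential n q V = (\<Sum>i=1..n. plucker_mod n V i (i + 2) / plucker_mod n V i (i + 1) *
     q ^ (if i = n - 1 then 1 else 0))"


text \<open>The side or diagonal joining the vertices \<open>i < j\<close> is the pair \<open>(i, j)\<close>.\<close>

definition sides :: "nat \<Rightarrow> (nat \<times> nat) set" where
  "sides n = {(i, i + 1) |i. 1 \<le> i \<and> i < n} \<union> {(1, n)}"

definition crossing :: "nat \<times> nat \<Rightarrow> nat \<times> nat \<Rightarrow> bool" where
  "crossing e f \<longleftrightarrow> (case (e, f) of ((a, c), (b, d)) \<Rightarrow> a < b \<and> b < c \<and> c < d \<or> b < a \<and> a < d \<and> d < c)"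

definition polygon_triangulation :: "nat \<Rightarrow> (nat \<times> nat) set \<Rightarrow> bool" where
  "polygon_triangulation n \<Gamma> \<longleftrightarrow> sides n \<subseteq> \<Gamma> \<and> \<Gamma> \<subseteq> edges n \<and> card (\<Gamma> - sides n) = n - 3 \<and>
    (\<forall>e\<in>\<Gamma>. \<forall>f\<in>\<Gamma>. \<not> crossing e f)"

definition Prn :: "nat \<Rightarrow> (nat \<times> nat) set \<Rightarrow> (nat \<times> nat) set" where
  "Prn n \<Gamma> = \<Gamma> - {(1, n)}"

definition whitehead_move ::
    "(nat \<times> nat) set \<Rightarrow> (nat \<times> nat) set \<Rightarrow> nat \<Rightarrow> nat \<Rightarrow> nat \<Rightarrow> nat \<Rightarrow> bool" where
  "whitehead_move \<Gamma> \<Gamma>' a b c d \<longleftrightarrow> a < b \<and> b < c \<and> c < d \<and>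
    {(a, b), (b, c), (c, d), (a, d)} \<subseteq> \<Gamma> \<inter> \<Gamma>' \<and> (a, c) \<in> \<Gamma> \<and> (b, d) \<in> \<Gamma>' \<and>
    \<Gamma> - {(a, c)} = \<Gamma>' - {(b, d)}"

definition novikov_T :: "real \<Rightarrow> novikov" where
  "novikov_T l = Fract (nov_monom 1 l) 1"

definition novikov_sqrt :: "novikov \<Rightarrow> novikov" where
  "novikov_sqrt x = (SOME s. s ^ 2 = x)"

lemma novikov_sqrt_squared: "novikov_sqrt x ^ 2 = x"
  unfolding novikov_sqrt_def by (rule someI_ex) (rule novikov_sqrt_exists)

text \<open>
  The functions \<open>y(i,j)\<close>.  One square root of each \<open>y\<^bsub>k,k+1\<^esub>\<close> is chosen, and the square root of a
  product of these is the product of the chosen roots.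
\<close>

definition yfun :: "nat \<Rightarrow> novikov \<Rightarrow> (nat \<times> nat \<Rightarrow> novikov) \<Rightarrow> nat \<Rightarrow> nat \<Rightarrow> novikov" where
  "yfun n q y i j =
    (if (i, j) = (1, n) then q / (\<Prod>k=1..n-1. novikov_sqrt (y (k, k + 1)))
     else if j = i + 1 then novikov_sqrt (y (i, i + 1))
     else y (i, j) / (\<Prod>k=i..j-1. novikov_sqrt (y (k, k + 1))))"

definition triangles :: "(nat \<times> nat) set \<Rightarrow> (nat \<times> nat \<times> nat) set" where
  "triangles \<Gamma> = {(i, j, k). i < j \<and> j < k \<and> (i, j) \<in> \<Gamma> \<and> (j, k) \<in> \<Gamma> \<and> (i, k) \<in> \<Gamma>}"

definition torus_potential ::
    "nat \<Rightarrow> novikov \<Rightarrow> (nat \<times> nat) set \<Rightarrow> (nat \<times> nat \<Rightarrow> novikov) \<Rightarrow> novikov" where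
  "torus_potential n q \<Gamma> y = (\<Sum>(i, j, k)\<in>triangles \<Gamma>.
      yfun n q y i j * yfun n q y j k / yfun n q y i k +
      yfun n q y i j * yfun n q y i k / yfun n q y j k +
      yfun n q y i k * yfun n q y j k / yfun n q y i j)"

text \<open>
  Points \<open>y\<close>, \<open>y'\<close> of the two tori are related by the change of variables; since \<open>y'(b,d)\<close> is nonzero
  on the torus, the equation forces the denominator to be nonzero.
\<close>

definition change_of_variables :: "nat \<Rightarrow> novikov \<Rightarrow> (nat \<times> nat) set \<Rightarrow> nat \<Rightarrow> nat \<Rightarrow> nat \<Rightarrow> nat \<Rightarrow>
    (nat \<times> nat \<Rightarrow> novikov) \<Rightarrow> (nat \<times> nat \<Rightarrow> novikov) \<Rightarrow> bool" where
  "change_of_variables n q \<Gamma> a b c d y y' \<longleftrightarrow>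
    (\<forall>e\<in>Prn n \<Gamma> - {(a, c)}. y' e = y e) \<and>
    (let y1 = yfun n q y a b; y2 = yfun n q y b c; y3 = yfun n q y c d; y4 = yfun n q y a d in
      yfun n q y' b d = 1 / yfun n q y a c * (y1 * y2 * y3 * y4 / (y1 * y3 + y2 * y4)))"

text \<open>
  The same transition in coordinates normalised by \<open>p\<^sub>1\<^sub>n = 1\<close>: the coordinates of the common sides
  and diagonals agree and the two exchanged diagonals satisfy the Pluecker relation.
\<close>

definition plucker_relation :: "nat \<Rightarrow> (nat \<times> nat) set \<Rightarrow> nat \<Rightarrow> nat \<Rightarrow> nat \<Rightarrow> nat \<Rightarrow>
    (nat \<times> nat \<Rightarrow> 'k::field) \<Rightarrow> (nat \<times> nat \<Rightarrow> 'k) \<Rightarrow> bool" where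
  "plucker_relation n \<Gamma> a b c d z z' \<longleftrightarrow>
    (\<forall>e\<in>Prn n \<Gamma> - {(a, c)}. z' e = z e) \<and>
    (let p = z((1, n) := 1); p' = z'((1, n) := 1) in
      p (a, c) * p' (b, d) = p (a, b) * p (c, d) + p (a, d) * p (b, c))"

lemma yfun_eq:
  assumes i: "1 \<le> i" "i < j" "j \<le> n" and n: "2 < n" and y: "\<And>k. 1 \<le> k \<Longrightarrow> k < n \<Longrightarrow> y (k, k + 1) \<noteq> 0"
  shows "yfun n q y i j = (y((1, n) := q)) (i, j) / (\<Prod>k\<in>{i..<j}. novikov_sqrt (y (k, k + 1)))"
proof -
  have iv: "{i..j - 1} = {i..<j}" using i by auto
  consider "(i, j) = (1, n)" | "(i, j) \<noteq> (1, n)" "j = i + 1" | "(i, j) \<noteq> (1, n)" "j \<noteq> i + 1" by blast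
  then show ?thesis
  proof cases
    case 1
    then show ?thesis using iv by (simp add: yfun_def)
  next
    case 2
    have sq: "novikov_sqrt (y (i, i + 1)) * novikov_sqrt (y (i, i + 1)) = y (i, i + 1)"
      using novikov_sqrt_squared[of "y (i, i + 1)"] by (simp only: power2_eq_square)
    have "y (i, i + 1) \<noteq> 0" using y[of i] i 2 by simp
    then have nz: "novikov_sqrt (y (i, i + 1)) \<noteq> 0" using sq by auto
    have "{i..<j} = {i}" using 2 by auto
    then have "(\<Prod>k\<in>{i..<j}. novikov_sqrt (y (k, k + 1))) = novikov_sqrt (y (i, i + 1))" by simp
    moreover have "(y((1, n) := q)) (i, j) = y (i, i + 1)" using 2 by auto
    moreover have "yfun n q y i j = novikov_sqrt (y (i, i + 1))"
      unfolding yfun_def using 2 by auto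
    moreover have "novikov_sqrt (y (i, i + 1)) = y (i, i + 1) / novikov_sqrt (y (i, i + 1))"
      using nz sq by (simp add: eq_divide_eq)
    ultimately show ?thesis by simp
  next
    case 3
    then show ?thesis using iv by (auto simp: yfun_def)
  qed
qed

text \<open>\<open>torus_potential\<close> is a Laurent polynomial in the \<open>y\<^sub>i\<^sub>j\<close>, independent of the chosen square roots.\<close>

lemma torus_potential_laurent:
  assumes n: "2 < n" and \<Gamma>: "\<Gamma> \<subseteq> edges n" and y: "\<And>k. 1 \<le> k \<Longrightarrow> k < n \<Longrightarrow> y (k, k + 1) \<noteq> 0"
    and Y_def: "Y = y((1, n) := q)"
  shows "torus_potential n q \<Gamma> y = (\<Sum>(i, j, k)\<in>triangles \<Gamma>.
      Y (i, j) * Y (j, k) / Y (i, k) +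
      Y (i, j) * Y (i, k) / (Y (j, k) * (\<Prod>l\<in>{i..<j}. y (l, l + 1))) +
      Y (i, k) * Y (j, k) / (Y (i, j) * (\<Prod>l\<in>{j..<k}. y (l, l + 1))))"
  unfolding torus_potential_def
proof (rule sum.cong[OF refl], clarsimp)
  fix i j k assume "(i, j, k) \<in> triangles \<Gamma>"
  then have ijk: "1 \<le> i" "i < j" "j < k" "k \<le> n"
    using \<Gamma> by (auto simp: triangles_def edges_def)
  define s where "s l = novikov_sqrt (y (l, l + 1))" for l
  define A where "A = prod s {i..<j}"
  define B where "B = prod s {j..<k}"
  have sq: "s l * s l = y (l, l + 1)" for l
    unfolding s_def using novikov_sqrt_squared[of "y (l, l + 1)"] by (simp only: power2_eq_square)
  have nz: "s l \<noteq> 0" if "1 \<le> l" "l < n" for l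
    using sq[of l] y[OF that] by auto
  have A0: "A \<noteq> 0" and B0: "B \<noteq> 0"
    unfolding A_def B_def using nz ijk by (auto simp: prod_zero_iff)
  have A2: "(\<Prod>l\<in>{i..<j}. y (l, l + 1)) = A * A" and B2: "(\<Prod>l\<in>{j..<k}. y (l, l + 1)) = B * B"
    unfolding A_def B_def sq[symmetric] by (rule prod.distrib)+
  have AB: "prod s {i..<k} = A * B"
    unfolding A_def B_def using ijk by (intro prod.atLeastLessThan_concat[symmetric]) simp_all
  have y1: "yfun n q y i j = Y (i, j) / A"
    unfolding Y_def A_def s_def using ijk n y by (intro yfun_eq) simp_all
  have y2: "yfun n q y j k = Y (j, k) / B"
    unfolding Y_def B_def s_def using ijk n y by (intro yfun_eq) simp_all
  have y3: "yfun n q y i k = Y (i, k) / (A * B)"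
    unfolding Y_def AB[symmetric] s_def using ijk n y by (intro yfun_eq) simp_all
  have "Y (i, j) / A * (Y (j, k) / B) / (Y (i, k) / (A * B)) = Y (i, j) * Y (j, k) / Y (i, k)"
    "Y (i, j) / A * (Y (i, k) / (A * B)) / (Y (j, k) / B) = Y (i, j) * Y (i, k) / (Y (j, k) * (A * A))"
    "Y (i, k) / (A * B) * (Y (j, k) / B) / (Y (i, j) / A) = Y (i, k) * Y (j, k) / (Y (i, j) * (B * B))"
    using A0 B0 by simp_all
  then show "yfun n q y i j * yfun n q y j k / yfun n q y i k +
      yfun n q y i j * yfun n q y i k / yfun n q y j k +
      yfun n q y i k * yfun n q y j k / yfun n q y i j =
      Y (i, j) * Y (j, k) / Y (i, k) +
      Y (i, j) * Y (i, k) / (Y (j, k) * (\<Prod>l\<in>{i..<j}. y (l, Suc l))) +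
      Y (i, k) * Y (j, k) / (Y (i, j) * (\<Prod>l\<in>{j..<k}. y (l, Suc l)))"
    using A2 B2 by (simp add: y1 y2 y3)
qed

end

theory Submission
  imports Defs
begin

text \<open>
  Normalise the Pluecker coordinates of a plane \<open>V\<close> by \<open>p(1,n) = 1\<close>, and write \<open>z(i,j)\<close> for
  \<open>p(i,j)\<close> so normalised.  A plane with \<open>p(1,n) \<noteq> 0\<close> has a unique basis whose coefficient vectors
  \<open>x\<^sub>1, \<dots>, x\<^sub>n\<close> in the two-dimensional space satisfy \<open>x\<^sub>1 = (1,0)\<close> and \<open>x\<^sub>n = (0,1)\<close>, and
  then \<open>z(i,j) = det(x\<^sub>i, x\<^sub>j)\<close>.  Given a triangulation \<open>\<Gamma>\<close>, the numbers \<open>z(i,j)\<close> for the edges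
  \<open>(i,j)\<close> of \<open>\<Gamma>\<close> determine everything: if a triangle has base \<open>(i,k)\<close> and apex \<open>j\<close>, then
  \<open>z(i,k) x\<^sub>j = z(j,k) x\<^sub>i + z(i,j) x\<^sub>k\<close>, so starting from the base \<open>(1,n)\<close> one finds all \<open>x\<^sub>j\<close>,
  dividing only by edge coordinates.  Hence the planes on which no \<open>p(i,j)\<close> with \<open>(i,j) \<in> \<Gamma>\<close>
  vanishes form an open subset of the mirror that is isomorphic to a torus with coordinates
  \<open>z(i,j)\<close> (\<open>vectors_with_minors\<close>, \<open>vectors_unique\<close>, \<open>vectors_regular\<close>, \<open>Gr_to_torus_morphism\<close>,
  \<open>torus_to_Gr_morphism\<close>).

  The Landau-Ginzburg potential is written in these coordinates by the three-term relation
  \<open>p(i-1,i+1) / (p(i-1,i) p(i,i+1)) = (sum over the triangles at i with opposite side (j,k) of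
  p(j,k) / (p(i,j) p(i,k)))\<close>.  With \<open>c\<^sub>i = z(i,i+1)\<close> for \<open>i < n\<close> and \<open>c\<^sub>n = q\<close>, the potential \<open>W\<close> is
  the sum of \<open>c\<^sub>i p(j,k) / (p(i,j) p(i,k))\<close> over all corners of all triangles
  (\<open>sum_triangles_telescope\<close>, \<open>LG_potential_triangles\<close>).  The corresponding term of the torus
  potential at the corner \<open>i\<close> is \<open>y(i,j) y(i,k) / y(j,k)\<close>.  The two agree as soon as \<open>y(i,j)\<close> is
  \<open>(c\<^sub>i c\<^sub>j)\<^bsup>1/2\<^esup> / z(i,j)\<close>, which for the coordinates of the torus means \<open>y\<^sub>i\<^sub>j = c\<^sub>j / z(i,j)\<close>.  This is an invertible monomial
  substitution with inverse \<open>z_of_y\<close>, and the embedding \<open>\<iota>\<close> is its composition with the chart in the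
  coordinates \<open>z\<close>.

  Finally, substituting \<open>y(i,j) = (c\<^sub>i c\<^sub>j)\<^bsup>1/2\<^esup> / z(i,j)\<close> into the change of variables of a Whitehead
  move cancels all factors \<open>c\<^sub>i\<close> and leaves the Pluecker relation (\<open>whitehead_algebra\<close>), and since the
  edge coordinates determine the plane, two points of the tori have the same image exactly
  when that relation holds (\<open>charts_meet_iff\<close>).
\<close>

section \<open>Triangulations of a polygon\<close>

text \<open>
  The polygon with vertices \<open>i, \<dots>, k\<close> is either the degenerate one with a single edge, or has a
  triangle on its base \<open>(i,k)\<close> with an apex \<open>j\<close> that splits it into two smaller polygons.  All later
  arguments are inductions along this decomposition.
\<close>

inductive interval_triangulation :: "nat \<Rightarrow> nat \<Rightarrow> (nat \<times> nat) set \<Rightarrow> bool" where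
  side: "interval_triangulation i (Suc i) {(i, Suc i)}"
| glue: "interval_triangulation i j E \<Longrightarrow> interval_triangulation j k F \<Longrightarrow>
    interval_triangulation i k (insert (i, k) (E \<union> F))"

lemma interval_triangulation_endpoints:
  assumes "interval_triangulation i k E"
  shows interval_triangulation_less: "i < k"
    and interval_triangulation_base: "(i, k) \<in> E"
    and interval_triangulation_finite: "finite E"
  using assms by (induction) auto

lemma interval_triangulation_edge:
  assumes "interval_triangulation i k E" "(a, b) \<in> E"
  shows "i \<le> a \<and> a < b \<and> b \<le> k"
  using assms
proof (induction arbitrary: a b)
  case (glue i j E k F)
  then show ?case
    using interval_triangulation_less[of i j E] interval_triangulation_less[of j k F] by fastforce
qed auto

lemma interval_triangulation_side:
  assumes "interval_triangulation i k E" "i \<le> m" "m < k"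
  shows "(m, Suc m) \<in> E"
  using assms
proof (induction)
  case (glue i j E k F)
  then show ?case by (cases "m < j") auto
qed (simp add: le_Suc_eq)

text \<open>
  A set of noncrossing edges on the vertices \<open>i, \<dots>, k\<close> has at most \<open>2 (k - i) - 1\<close> elements.  Let \<open>j\<close>
  be the last vertex before \<open>k\<close> joined to \<open>i\<close>.  Apart from the base, every edge lies on one side of \<open>j\<close>,
  so by induction there are at most \<open>1 + (2 (j - i) - 1) + (2 (k - j) - 1)\<close> edges.  Equality forces the
  base to be present and both halves to be extremal, that is, triangulated.
\<close>

lemma noncrossing_edges_card:
  assumes "i < k" and "\<And>a b. (a, b) \<in> E \<Longrightarrow> i \<le> a \<and> a < b \<and> b \<le> k"
    and "\<And>m. i \<le> m \<Longrightarrow> m < k \<Longrightarrow> (m, Suc m) \<in> E"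
    and "\<And>e f. e \<in> E \<Longrightarrow> f \<in> E \<Longrightarrow> \<not> crossing e f"
  shows "card E \<le> 2 * (k - i) - 1 \<and> (card E = 2 * (k - i) - 1 \<longrightarrow> interval_triangulation i k E)"
  using assms
proof (induction "k - i" arbitrary: i k E rule: less_induct)
  case (less i k E)
  note inside = less.prems(2) and sides = less.prems(3) and nocross = less.prems(4)
  show ?case
  proof (cases "k = Suc i")
    case True
    have "E = {(i, Suc i)}"
    proof (intro equalityI subsetI)
      fix e assume "e \<in> E"
      then show "e \<in> {(i, Suc i)}" using inside[of "fst e" "snd e"] True by (cases e) auto
    qed (use sides[of i] True in simp)
    then show ?thesis using True by (simp add: interval_triangulation.side)
  next
    case False
    define B where "B = {b. b < k \<and> (i, b) \<in> E}"
    have "finite B" unfolding B_def by simp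
    have SB: "Suc i \<in> B" using sides[of i] less.prems(1) False by (auto simp: B_def)
    define j where "j = Max B"
    have jB: "j \<in> B" unfolding j_def using \<open>finite B\<close> SB by (intro Max_in) auto
    have jmax: "b \<le> j" if "b \<in> B" for b
      unfolding j_def using \<open>finite B\<close> that by (rule Max_ge)
    have ij: "i < j" "j < k" "(i, j) \<in> E" using jB inside by (auto simp: B_def)
    define F where "F = {(a, b) \<in> E. b \<le> j}"
    define G where "G = {(a, b) \<in> E. j \<le> a}"
    have E: "E \<subseteq> insert (i, k) (F \<union> G)"
    proof (rule subsetI, rule ccontr)
      fix e assume "e \<in> E" "e \<notin> insert (i, k) (F \<union> G)"
      then obtain a b where ab: "(a, b) \<in> E" "(a, b) \<notin> F" "(a, b) \<notin> G" "(a, b) \<noteq> (i, k)"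
        by (cases e) auto
      have "a < j" "j < b" using ab by (auto simp: F_def G_def)
      moreover have "\<not> i < a" using nocross[OF ij(3) ab(1)] calculation by (auto simp: crossing_def)
      ultimately show False using inside[OF ab(1)] jmax[of b] ab by (fastforce simp: B_def)
    qed
    have fin: "finite E"
      by (rule finite_subset[of _ "{..k} \<times> {..k}"]) (use inside in fastforce)+
    have "finite F" "finite G" using fin by (auto simp: F_def G_def intro: finite_subset)
    have IF: "card F \<le> 2 * (j - i) - 1 \<and> (card F = 2 * (j - i) - 1 \<longrightarrow> interval_triangulation i j F)"
    proof (rule less.hyps)
      show "(a, b) \<in> F \<Longrightarrow> i \<le> a \<and> a < b \<and> b \<le> j" for a b
        using inside by (auto simp: F_def)
      show "i \<le> m \<Longrightarrow> m < j \<Longrightarrow> (m, Suc m) \<in> F" for m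
        using sides ij by (auto simp: F_def)
      show "e \<in> F \<Longrightarrow> f \<in> F \<Longrightarrow> \<not> crossing e f" for e f
        using nocross by (auto simp: F_def)
    qed (use ij in auto)
    have IG: "card G \<le> 2 * (k - j) - 1 \<and> (card G = 2 * (k - j) - 1 \<longrightarrow> interval_triangulation j k G)"
    proof (rule less.hyps)
      show "(a, b) \<in> G \<Longrightarrow> j \<le> a \<and> a < b \<and> b \<le> k" for a b
        using inside by (auto simp: G_def)
      show "j \<le> m \<Longrightarrow> m < k \<Longrightarrow> (m, Suc m) \<in> G" for m
        using sides ij by (auto simp: G_def)
      show "e \<in> G \<Longrightarrow> f \<in> G \<Longrightarrow> \<not> crossing e f" for e f
        using nocross by (auto simp: G_def)
    qed (use ij in auto)
    have FG: "F \<union> G \<subseteq> E" by (auto simp: F_def G_def)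
    have cFG: "card (F \<union> G) \<le> card F + card G" by (rule card_Un_le)
    have cE: "card E \<le> card (F \<union> G) + (if (i, k) \<in> E then 1 else 0)"
    proof (cases "(i, k) \<in> E")
      case True
      have "card E \<le> card (insert (i, k) (F \<union> G))"
        using E \<open>finite F\<close> \<open>finite G\<close> by (intro card_mono) auto
      also have "\<dots> \<le> Suc (card (F \<union> G))" by (rule card_insert_le_m1) auto
      finally show ?thesis using True by simp
    next
      case False
      then have "E \<subseteq> F \<union> G" using E by auto
      then have "card E \<le> card (F \<union> G)" using \<open>finite F\<close> \<open>finite G\<close> by (intro card_mono) auto
      then show ?thesis by simp
    qed
    have "card E \<le> 2 * (k - i) - 1" using cE cFG IF IG ij by (auto split: if_splits)
    moreover have "interval_triangulation i k E" if card: "card E = 2 * (k - i) - 1"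
    proof -
      have ik: "(i, k) \<in> E" using card cE cFG IF IG ij by (auto split: if_splits)
      have "card F = 2 * (j - i) - 1" "card G = 2 * (k - j) - 1"
        using card cE[simplified ik] cFG IF[THEN conjunct1] IG[THEN conjunct1] ij(1,2)
        by (simp_all; linarith)+
      then have "interval_triangulation i k (insert (i, k) (F \<union> G))"
        using IF IG interval_triangulation.glue by blast
      moreover have "insert (i, k) (F \<union> G) = E" using E FG ik by blast
      ultimately show ?thesis by simp
    qed
    ultimately show ?thesis by blast
  qed
qed

text \<open>
  The \<open>n\<close> sides and \<open>n - 3\<close> diagonals attain the bound \<open>2 (n - 1) - 1\<close>.
\<close>

lemma polygon_triangulation_interval:
  assumes n: "2 < n" and \<Gamma>: "polygon_triangulation n \<Gamma>"
  shows "interval_triangulation 1 n \<Gamma>"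
proof -
  have sub: "sides n \<subseteq> \<Gamma>" "\<Gamma> \<subseteq> edges n" and card: "card (\<Gamma> - sides n) = n - 3"
    and nc: "\<And>e f. e \<in> \<Gamma> \<Longrightarrow> f \<in> \<Gamma> \<Longrightarrow> \<not> crossing e f"
    using \<Gamma> by (auto simp: polygon_triangulation_def)
  have "finite \<Gamma>"
    by (rule finite_subset[OF sub(2)], rule finite_subset[of _ "{..n} \<times> {..n}"]) (auto simp: edges_def)
  have s: "sides n = insert (1, n) ((\<lambda>i. (i, i + 1)) ` {1..<n})" by (auto simp: sides_def)
  have "card (sides n) = n"
    unfolding s by (subst card_insert_disjoint) (use n in \<open>auto simp: card_image inj_on_def\<close>)
  moreover have "card \<Gamma> = card (\<Gamma> - sides n) + card (sides n)"
    using \<open>finite \<Gamma>\<close> sub(1) by (metis card_Diff_subset card_mono finite_subset le_add_diff_inverse2)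
  ultimately have "card \<Gamma> = 2 * (n - 1) - 1" using card n by simp
  moreover have "card \<Gamma> = 2 * (n - 1) - 1 \<longrightarrow> interval_triangulation 1 n \<Gamma>"
  proof (rule noncrossing_edges_card[THEN conjunct2])
    show "(a, b) \<in> \<Gamma> \<Longrightarrow> 1 \<le> a \<and> a < b \<and> b \<le> n" for a b using sub(2) by (auto simp: edges_def)
    show "1 \<le> m \<Longrightarrow> m < n \<Longrightarrow> (m, Suc m) \<in> \<Gamma>" for m using sub(1) by (auto simp: sides_def)
  qed (use n nc in auto)
  ultimately show ?thesis by blast
qed

text \<open>
  Two edges on different sides of the apex \<open>j\<close> can only be joined by the base, so no new triangle
  appears besides the one on the base.
\<close>

lemma triangles_glue:
  assumes E: "interval_triangulation i j E" and F: "interval_triangulation j k F"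
  shows "triangles (insert (i, k) (E \<union> F)) = insert (i, j, k) (triangles E \<union> triangles F)"
    and "(i, j, k) \<notin> triangles E \<union> triangles F" and "triangles E \<inter> triangles F = {}"
proof -
  note e = interval_triangulation_edge[OF E] and f = interval_triangulation_edge[OF F]
  have ij: "i < j" "j < k" "(i, j) \<in> E" "(j, k) \<in> F"
    using interval_triangulation_endpoints[OF E] interval_triangulation_endpoints[OF F] by auto
  show "triangles (insert (i, k) (E \<union> F)) = insert (i, j, k) (triangles E \<union> triangles F)"
  proof (intro equalityI subsetI)
    fix t assume "t \<in> triangles (insert (i, k) (E \<union> F))"
    then obtain a b c where t: "t = (a, b, c)" "a < b" "b < c"
      "(a, b) = (i, k) \<or> (a, b) \<in> E \<or> (a, b) \<in> F"
      "(b, c) = (i, k) \<or> (b, c) \<in> E \<or> (b, c) \<in> F"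
      "(a, c) = (i, k) \<or> (a, c) \<in> E \<or> (a, c) \<in> F"
      by (auto simp: triangles_def)
    have "(a, b) \<noteq> (i, k)" "(b, c) \<noteq> (i, k)"
      using t ij e[of b c] f[of b c] e[of a b] f[of a b] by auto
    then consider "(a, b) \<in> E" "(b, c) \<in> E" | "(a, b) \<in> E" "(b, c) \<in> F"
      | "(a, b) \<in> F" "(b, c) \<in> E" | "(a, b) \<in> F" "(b, c) \<in> F"
      using t by blast
    then show "t \<in> insert (i, j, k) (triangles E \<union> triangles F)"
    proof cases
      case 1
      then have "(a, c) \<in> E" using t(6) e[of a b] e[of b c] f[of a c] ij by auto
      then show ?thesis using 1 t by (simp add: triangles_def)
    next
      case 2
      then have "b = j" "(a, c) \<notin> E" "(a, c) \<notin> F" using t e[of a b] f[of b c] e[of a c] f[of a c] by auto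
      then show ?thesis using t by auto
    next
      case 3
      then show ?thesis using e[of b c] f[of a b] by auto
    next
      case 4
      then have "(a, c) \<in> F" using t(6) f[of a b] f[of b c] e[of a c] ij by auto
      then show ?thesis using 4 t by (simp add: triangles_def)
    qed
  next
    fix t assume "t \<in> insert (i, j, k) (triangles E \<union> triangles F)"
    then show "t \<in> triangles (insert (i, k) (E \<union> F))"
      using ij by (auto simp: triangles_def)
  qed
  show "(i, j, k) \<notin> triangles E \<union> triangles F"
    using ij e[of i k] f[of i k] by (auto simp: triangles_def)
  show "triangles E \<inter> triangles F = {}"
  proof (intro equals0I)
    fix t assume "t \<in> triangles E \<inter> triangles F"
    then obtain a b where "(a, b) \<in> E" "(a, b) \<in> F" by (auto simp: triangles_def)
    then show False using e[of a b] f[of a b] by simp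
  qed
qed

lemma finite_triangles:
  assumes "finite E" shows "finite (triangles E)"
proof (rule finite_subset)
  show "triangles E \<subseteq> (\<lambda>((i, j), (k, l)). (i, j, l)) ` (E \<times> E)"
    by (force simp: triangles_def)
qed (use assms in simp)

section \<open>Plane vectors with prescribed minors along a triangulation\<close>

text \<open>A pair \<open>u\<close>, \<open>v\<close> is read as the family of plane vectors \<open>(u i, v i)\<close>.\<close>

definition minor :: "('i \<Rightarrow> 'k::comm_ring_1) \<Rightarrow> ('i \<Rightarrow> 'k) \<Rightarrow> 'i \<Rightarrow> 'i \<Rightarrow> 'k" where
  "minor u v i j = u i * v j - u j * v i"

lemma minor_self [simp]: "minor u v i i = 0"
  by (simp add: minor_def)

lemma plucker_identity:
  "minor u v a c * minor u v b d = minor u v a b * minor u v c d + minor u v a d * minor u v b c"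
  by (simp add: minor_def algebra_simps)

text \<open>Cramer's rule: the vector at \<open>j\<close> expressed by those at \<open>i\<close> and \<open>k\<close>.\<close>

lemma apex_from_base:
  "minor u v i k * u j = minor u v j k * u i + minor u v i j * u k"
  "minor u v i k * v j = minor u v j k * v i + minor u v i j * v k"
  by (simp_all add: minor_def algebra_simps)

text \<open>
  Once the vectors at the ends of the base are fixed, \<open>apex_from_base\<close> dictates the vector at the
  apex.  It has the required minors with both ends, so each half can be filled in separately.
\<close>

lemma vectors_with_minors:
  fixes Z :: "nat \<times> nat \<Rightarrow> 'k::field"
  assumes "interval_triangulation i k E" and "\<And>e. e \<in> E \<Longrightarrow> Z e \<noteq> 0"
    and "a * d - c * b = Z (i, k)"
  shows "\<exists>u v. u i = a \<and> v i = b \<and> u k = c \<and> v k = d \<and> (\<forall>(l, m)\<in>E. minor u v l m = Z (l, m))"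
  using assms
proof (induction arbitrary: a b c d)
  case (side i)
  show ?case
    by (rule exI[of _ "\<lambda>m. if m = i then a else c"], rule exI[of _ "\<lambda>m. if m = i then b else d"])
      (use side in \<open>simp add: minor_def\<close>)
next
  case (glue i j E k F)
  note E = glue.hyps(1) and F = glue.hyps(2)
  have ijk: "i < j" "j < k" "(i, j) \<in> E" "(j, k) \<in> F"
    using interval_triangulation_endpoints[OF E] interval_triangulation_endpoints[OF F] by auto
  define f where "f = (Z (j, k) * a + Z (i, j) * c) / Z (i, k)"
  define g where "g = (Z (j, k) * b + Z (i, j) * d) / Z (i, k)"
  have Z: "Z (i, k) \<noteq> 0" using glue.prems(1) by simp
  have "a * g - f * b = Z (i, j) * (a * d - c * b) / Z (i, k)"
    unfolding f_def g_def using Z by (simp add: field_simps)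
  then have "a * g - f * b = Z (i, j)" using Z glue.prems(2) by simp
  from glue.IH(1)[OF _ this] glue.prems(1) obtain u1 v1 where 1:
    "u1 i = a" "v1 i = b" "u1 j = f" "v1 j = g" "\<forall>(l, m)\<in>E. minor u1 v1 l m = Z (l, m)" by blast
  have "f * d - c * g = Z (j, k) * (a * d - c * b) / Z (i, k)"
    unfolding f_def g_def using Z by (simp add: field_simps)
  then have "f * d - c * g = Z (j, k)" using Z glue.prems(2) by simp
  from glue.IH(2)[OF _ this] glue.prems(1) obtain u2 v2 where 2:
    "u2 j = f" "v2 j = g" "u2 k = c" "v2 k = d" "\<forall>(l, m)\<in>F. minor u2 v2 l m = Z (l, m)" by blast
  define u where "u m = (if m \<le> j then u1 m else u2 m)" for m
  define v where "v m = (if m \<le> j then v1 m else v2 m)" for m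
  have ends: "u i = a \<and> v i = b \<and> u k = c \<and> v k = d" using 1 2 ijk by (simp add: u_def v_def)
  have "minor u v l m = Z (l, m)" if "(l, m) \<in> E" for l m
    using interval_triangulation_edge[OF E that] 1(5) that by (auto simp: u_def v_def minor_def)
  moreover have "minor u v l m = Z (l, m)" if "(l, m) \<in> F" for l m
  proof -
    have "minor u v l m = minor u2 v2 l m"
      using interval_triangulation_edge[OF F that] 1 2 by (auto simp: u_def v_def minor_def)
    then show ?thesis using 2(5) that by auto
  qed
  moreover have "minor u v i k = Z (i, k)" using ends glue.prems(2) by (simp add: minor_def)
  ultimately have "\<forall>(l, m)\<in>insert (i, k) (E \<union> F). minor u v l m = Z (l, m)" by blast
  then show ?case using ends by blast
qed

text \<open>The choice of the apex vector in the construction above was forced.\<close>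

lemma vectors_unique:
  fixes u :: "nat \<Rightarrow> 'k::field"
  assumes "interval_triangulation i k E"
    and "\<And>l m. (l, m) \<in> E \<Longrightarrow> minor u v l m \<noteq> 0"
    and "\<And>l m. (l, m) \<in> E \<Longrightarrow> minor u' v' l m = minor u v l m"
    and "u' i = u i" "v' i = v i" "u' k = u k" "v' k = v k" and "i \<le> m" "m \<le> k"
  shows "u' m = u m \<and> v' m = v m"
  using assms
proof (induction)
  case (side i)
  then show ?case by (cases "m = i") (auto simp: le_Suc_eq)
next
  case (glue i j E k F)
  note E = glue.hyps(1) and F = glue.hyps(2)
  have ijk: "(i, j) \<in> E" "(j, k) \<in> F"
    using interval_triangulation_endpoints[OF E] interval_triangulation_endpoints[OF F] by auto
  have D: "minor u v i k \<noteq> 0" using glue.prems by simp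
  have "minor u v i k * u' j = minor u v i k * u j"
    using apex_from_base(1)[of u' v' i k j] apex_from_base(1)[of u v i k j] glue.prems ijk by simp
  moreover have "minor u v i k * v' j = minor u v i k * v j"
    using apex_from_base(2)[of u' v' i k j] apex_from_base(2)[of u v i k j] glue.prems ijk by simp
  ultimately have j: "u' j = u j" "v' j = v j" using D by auto
  show ?case
  proof (cases "m \<le> j")
    case True
    show ?thesis by (rule glue.IH(1)) (use glue.prems j True in simp_all)
  next
    case False
    show ?thesis by (rule glue.IH(2)) (use glue.prems j False in simp_all)
  qed
qed

text \<open>
  At a fixed vertex \<open>b\<close>, the terms \<open>D a d / (D a b * D b d)\<close> of consecutive triangles add up by the
  Pluecker relation to the same expression for the outermost pair of neighbours, and the outermost
  neighbours of an inner vertex \<open>m\<close> are \<open>m - 1\<close> and \<open>m + 1\<close>.  The first two terms on the right hand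
  side are the partial sums at the two ends of the base, where triangles outside the interval
  are still missing.
\<close>

lemma sum_triangles_telescope:
  fixes c :: "nat \<Rightarrow> 'k::field"
  assumes "interval_triangulation i k E" and "\<And>a b. (a, b) \<in> E \<Longrightarrow> minor u v a b \<noteq> 0"
  defines "D \<equiv> minor u v"
  shows "(\<Sum>(a, b, d)\<in>triangles E. c b * D a d / (D a b * D b d) + c a * D b d / (D a b * D a d) +
      c d * D a b / (D a d * D b d)) =
    c i * D (Suc i) k / (D i (Suc i) * D i k) + c k * D i (k - 1) / (D (k - 1) k * D i k) +
    (\<Sum>m\<in>{i<..<k}. c m * D (m - 1) (Suc m) / (D (m - 1) m * D m (Suc m)))"
  using assms(1,2)
proof (induction)
  case (side i)
  have "triangles {(i, Suc i)} = {}" by (auto simp: triangles_def)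
  moreover have "{i<..<Suc i} = {}" by auto
  ultimately show ?case by (simp add: D_def)
next
  case (glue i j E k F)
  note E = glue.hyps(1) and F = glue.hyps(2)
  have ij: "i < j" "j < k" "(i, j) \<in> E" "(j, k) \<in> F"
    using interval_triangulation_endpoints[OF E] interval_triangulation_endpoints[OF F] by auto
  have nz: "D a b \<noteq> 0" if "(a, b) \<in> insert (i, k) (E \<union> F)" for a b
    using glue.prems that by (simp add: D_def)
  define t where "t = (\<lambda>(a, b, d). c b * D a d / (D a b * D b d) + c a * D b d / (D a b * D a d) +
      c d * D a b / (D a d * D b d))"
  define s where "s m = c m * D (m - 1) (Suc m) / (D (m - 1) m * D m (Suc m))" for m
  have side: "D m (Suc m) \<noteq> 0" if "i \<le> m" "m < k" for m
    using nz interval_triangulation_side[OF E, of m] interval_triangulation_side[OF F, of m] that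
    by (cases "m < j") auto
  have n1: "D i j \<noteq> 0" "D j k \<noteq> 0" "D i k \<noteq> 0" using nz ij by auto
  have n2: "D i (Suc i) \<noteq> 0" "D j (Suc j) \<noteq> 0" "D (j - 1) j \<noteq> 0" "D (k - 1) k \<noteq> 0"
    using side[of i] side[of j] side[of "j - 1"] side[of "k - 1"] ij by auto
  note P = plucker_identity[of u v, folded D_def]
  have anti: "D a b = - D b a" for a b by (simp add: D_def minor_def)
  have "sum t (triangles (insert (i, k) (E \<union> F))) = t (i, j, k) + (sum t (triangles E) + sum t (triangles F))"
    using triangles_glue[OF E F] finite_triangles interval_triangulation_finite[OF E]
      interval_triangulation_finite[OF F]
    by (simp add: sum.union_disjoint add.assoc)
  also have "sum t (triangles E) = c i * D (Suc i) j / (D i (Suc i) * D i j) +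
      c j * D i (j - 1) / (D (j - 1) j * D i j) + sum s {i<..<j}"
    unfolding t_def s_def by (rule glue.IH(1)) (use glue.prems in auto)
  also have "sum t (triangles F) = c j * D (Suc j) k / (D j (Suc j) * D j k) +
      c k * D j (k - 1) / (D (k - 1) k * D j k) + sum s {j<..<k}"
    unfolding t_def s_def by (rule glue.IH(2)) (use glue.prems in auto)
  also have "t (i, j, k) + (c i * D (Suc i) j / (D i (Suc i) * D i j) +
      c j * D i (j - 1) / (D (j - 1) j * D i j) + sum s {i<..<j} +
      (c j * D (Suc j) k / (D j (Suc j) * D j k) +
      c k * D j (k - 1) / (D (k - 1) k * D j k) + sum s {j<..<k})) =
      c i * (D (Suc i) j / (D i (Suc i) * D i j) + D j k / (D i j * D i k)) +
      c k * (D j (k - 1) / (D (k - 1) k * D j k) + D i j / (D i k * D j k)) +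
      (sum s {i<..<j} + c j * (D i (j - 1) / (D (j - 1) j * D i j) + D i k / (D i j * D j k)
         + D (Suc j) k / (D j (Suc j) * D j k)) + sum s {j<..<k})"
    unfolding t_def prod.case by (simp add: distrib_left ac_simps)
  (* the terms at the left end of the base *)
  also have "D (Suc i) j / (D i (Suc i) * D i j) + D j k / (D i j * D i k) =
      D (Suc i) k / (D i (Suc i) * D i k)"
    using n1 n2 P[of i j "Suc i" k] anti[of j "Suc i"] by (simp add: divide_simps; algebra)
  (* the terms at the right end of the base *)
  also have "D j (k - 1) / (D (k - 1) k * D j k) + D i j / (D i k * D j k) =
      D i (k - 1) / (D (k - 1) k * D i k)"
    using n1 n2 P[of i "k - 1" j k] anti[of j "k - 1"] by (simp add: divide_simps; algebra)
  (* the terms at the apex: left half and new triangle first, then the right half *)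
  also have "D i (j - 1) / (D (j - 1) j * D i j) + D i k / (D i j * D j k) =
      D (j - 1) k / (D (j - 1) j * D j k)"
    using n1 n2 P[of i j "j - 1" k] anti[of j "j - 1"] by (simp add: divide_simps; algebra)
  also have "D (j - 1) k / (D (j - 1) j * D j k) + D (Suc j) k / (D j (Suc j) * D j k) =
      D (j - 1) (Suc j) / (D (j - 1) j * D j (Suc j))"
    using n1 n2 P[of "j - 1" "j" "Suc j" k] anti[of j "Suc j"] by (simp add: divide_simps; algebra)
  also have "c j * (D (j - 1) (Suc j) / (D (j - 1) j * D j (Suc j))) = s j"
    by (simp add: s_def)
  also have "sum s {i<..<j} + s j + sum s {j<..<k} = sum s {i<..<k}"
  proof -
    have "{i<..<k} = insert j ({i<..<j} \<union> {j<..<k})" using ij by auto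
    moreover have "sum s ({i<..<j} \<union> {j<..<k}) = sum s {i<..<j} + sum s {j<..<k}"
      by (rule sum.union_disjoint) auto
    ultimately show ?thesis by (simp add: ac_simps)
  qed
  finally show ?case unfolding t_def s_def by (simp only: times_divide_eq_right)
qed

section \<open>Pluecker coordinates of planes\<close>

lemma in_span_pair:
  "x \<in> fun_space.span {u, v} \<longleftrightarrow> (\<exists>a b. x = (\<lambda>m. a * u m + b * v m))"
  by (force simp: fun_space.span_insert fun_space.span_singleton fun_eq_iff algebra_simps)

lemma minor_combination:
  "minor (\<lambda>m. a * u m + b * v m) (\<lambda>m. c * u m + d * v m) i j = (a * d - b * c) * minor u v i j"
  by (simp add: minor_def algebra_simps)

lemma minor_nonzero_independent:
  fixes u v :: "'i \<Rightarrow> 'k::field"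
  assumes "minor u v i j \<noteq> 0"
  shows "u \<noteq> v" and "fun_space.independent {u, v}"
proof -
  show uv: "u \<noteq> v" using assms by (auto simp: minor_def)
  have "v \<noteq> 0" using assms by (auto simp: minor_def)
  moreover have "u \<notin> fun_space.span {v}"
    using assms by (auto simp: fun_space.span_singleton minor_def)
  ultimately show "fun_space.independent {u, v}"
    using uv by (simp add: fun_space.independent_insert fun_space.dependent_single)
qed

text \<open>
  The basis chosen in the definition of \<open>plucker\<close> and the basis \<open>u\<close>, \<open>v\<close> express each other, so their
  minors are multiples of each other.  The factor is nonzero because one minor is.
\<close>

lemma plucker_span:
  fixes u v :: "nat \<Rightarrow> 'k::field"
  assumes "minor u v a b \<noteq> 0"
  shows "\<exists>l. l \<noteq> 0 \<and> (\<forall>i j. plucker (fun_space.span {u, v}) i j = l * minor u v i j)"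
proof -
  define p where "p = plucker (fun_space.span {u, v})"
  have "\<exists>p u' v'. u' \<noteq> v' \<and> fun_space.independent {u', v'} \<and>
      fun_space.span {u', v'} = fun_space.span {u, v} \<and> p = (\<lambda>i j. u' i * v' j - u' j * v' i)"
    by (rule exI[of _ "\<lambda>i j. u i * v j - u j * v i"], rule exI[of _ u], rule exI[of _ v])
      (intro conjI minor_nonzero_independent[OF assms] refl)
  from someI_ex[OF this, folded plucker_def] obtain u' v' where
    s: "fun_space.span {u', v'} = fun_space.span {u, v}" and p: "p = minor u' v'"
    unfolding p_def minor_def fun_eq_iff by (elim exE conjE)
  have "u' \<in> fun_space.span {u, v}" "v' \<in> fun_space.span {u, v}"
    unfolding s[symmetric] by (simp_all add: fun_space.span_base)
  from this[unfolded in_span_pair] obtain c d e f where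
    uv': "u' = (\<lambda>m. c * u m + d * v m)" "v' = (\<lambda>m. e * u m + f * v m)"
    by (elim exE)
  have "u \<in> fun_space.span {u', v'}" "v \<in> fun_space.span {u', v'}"
    unfolding s by (simp_all add: fun_space.span_base)
  from this[unfolded in_span_pair] obtain c' d' e' f' where
    uv: "u = (\<lambda>m. c' * u' m + d' * v' m)" "v = (\<lambda>m. e' * u' m + f' * v' m)"
    by (elim exE)
  have 1: "p i j = (c * f - d * e) * minor u v i j" for i j
    unfolding p uv' minor_combination ..
  have "minor u v a b = (c' * f' - d' * e') * minor u' v' a b"
    using minor_combination[of c' u' d' v' e' f' a b] unfolding uv[symmetric] .
  then have "p a b \<noteq> 0" using assms by (auto simp: p)
  then have "c * f - d * e \<noteq> 0" using 1[of a b] by auto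
  then show ?thesis using 1 unfolding p_def by blast
qed

lemma span_in_Gr2:
  fixes u v :: "nat \<Rightarrow> 'k::field"
  assumes "minor u v a b \<noteq> 0" and "\<And>m. m \<notin> {1..n} \<Longrightarrow> u m = 0 \<and> v m = 0"
  shows "fun_space.span {u, v} \<in> Gr2 n"
proof -
  have "fun_space.dim (fun_space.span {u, v}) = card {u, v}"
    by (rule fun_space.dim_span_eq_card_independent[OF minor_nonzero_independent(2)[OF assms(1)]])
  moreover have "fun_space.span {u, v} \<subseteq> {v. \<forall>i. i \<notin> {1..n} \<longrightarrow> v i = 0}"
  proof
    fix x assume "x \<in> fun_space.span {u, v}"
    then obtain c d where "x = (\<lambda>m. c * u m + d * v m)" unfolding in_span_pair by blast
    then show "x \<in> {v. \<forall>i. i \<notin> {1..n} \<longrightarrow> v i = 0}" using assms(2) by auto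
  qed
  ultimately show ?thesis
    using minor_nonzero_independent(1)[OF assms(1)] by (simp add: Gr2_def fun_space.subspace_span)
qed

lemma Gr2_basis:
  fixes V :: "(nat \<Rightarrow> 'k::field) set"
  assumes "V \<in> Gr2 n"
  shows "\<exists>u v. fun_space.span {u, v} = V \<and> plucker V = minor u v \<and>
    (\<forall>m. m \<notin> {1..n} \<longrightarrow> u m = 0 \<and> v m = 0)"
proof -
  have V: "V \<subseteq> {v. \<forall>i. i \<notin> {1..n} \<longrightarrow> v i = 0}" "fun_space.subspace V" "fun_space.dim V = 2"
    using assms by (auto simp: Gr2_def)
  obtain B where B: "B \<subseteq> V" "fun_space.independent B" "V \<subseteq> fun_space.span B" "card B = 2"
    using fun_space.basis_exists[of V] V(3) by metis
  have "fun_space.span B = V" using B(1,3) V(2) fun_space.span_minimal by blast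
  moreover obtain u v where "B = {u, v}" "u \<noteq> v" using B(4) by (auto simp: card_2_iff)
  ultimately have "\<exists>p u v. u \<noteq> v \<and> fun_space.independent {u, v} \<and> fun_space.span {u, v} = V \<and>
    p = (\<lambda>i j. u i * v j - u j * v i)" using B(2) by blast
  from someI_ex[OF this, folded plucker_def]
  obtain u v where uv: "fun_space.span {u, v} = V" "plucker V = minor u v"
    by (auto simp: minor_def fun_eq_iff)
  have "u \<in> V" "v \<in> V" unfolding uv(1)[symmetric] by (auto intro: fun_space.span_base)
  then have "\<forall>m. m \<notin> {1..n} \<longrightarrow> u m = 0 \<and> v m = 0" using V(1) by blast
  then show ?thesis using uv by blast
qed

text \<open>
  Normalising by \<open>p(1,n) = 1\<close> removes the dependence on the basis.
\<close>

definition nplucker :: "nat \<Rightarrow> (nat \<Rightarrow> 'k::field) set \<Rightarrow> nat \<Rightarrow> nat \<Rightarrow> 'k" where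
  "nplucker n V i j = plucker V i j / plucker V 1 n"

lemma nplucker_span:
  fixes u v :: "nat \<Rightarrow> 'k::field"
  assumes "minor u v 1 n = 1"
  shows "plucker (fun_space.span {u, v}) 1 n \<noteq> 0" "nplucker n (fun_space.span {u, v}) i j = minor u v i j"
proof -
  have "minor u v 1 n \<noteq> 0" using assms by simp
  from plucker_span[OF this] obtain l where
    l: "l \<noteq> 0" "\<And>i j. plucker (fun_space.span {u, v}) i j = l * minor u v i j" by blast
  show "plucker (fun_space.span {u, v}) 1 n \<noteq> 0" "nplucker n (fun_space.span {u, v}) i j = minor u v i j"
    using l assms by (auto simp: nplucker_def)
qed

text \<open>
  The basis of \<open>V\<close> dual to the coordinates \<open>1\<close> and \<open>n\<close> consists of normalised Pluecker coordinates,
  by Cramer's rule.  In particular these coordinates are minors and determine \<open>V\<close>.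
\<close>

lemma nplucker_frame:
  fixes V :: "(nat \<Rightarrow> 'k::field) set"
  assumes V: "V \<in> Gr2 n" and p: "plucker V 1 n \<noteq> 0"
  defines "u \<equiv> \<lambda>m. nplucker n V m n" and "v \<equiv> \<lambda>m. nplucker n V 1 m"
  shows "nplucker n V i j = minor u v i j"
    and "V = fun_space.span {u, v}"
    and "u 1 = 1" "u n = 0" "v 1 = 0" "v n = 1"
    and "m \<notin> {1..n} \<Longrightarrow> u m = 0 \<and> v m = 0"
proof -
  from Gr2_basis[OF V] obtain x y where basis: "fun_space.span {x, y} = V \<and> plucker V = minor x y \<and>
    (\<forall>m. m \<notin> {1..n} \<longrightarrow> x m = 0 \<and> y m = 0)" by (elim exE)
  note xy = basis[THEN conjunct1] basis[THEN conjunct2, THEN conjunct1]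
    basis[THEN conjunct2, THEN conjunct2, rule_format]
  define D where "D = minor x y 1 n"
  have D: "D \<noteq> 0" using p xy(2) by (simp add: D_def)
  have D_eq: "x 1 * y n - x n * y 1 = D" by (simp add: D_def minor_def)
  have u: "u = (\<lambda>m. (y n / D) * x m + (- x n / D) * y m)"
  proof
    fix m show "u m = (y n / D) * x m + (- x n / D) * y m"
      unfolding u_def nplucker_def xy(2) D_def[symmetric] unfolding minor_def
      by (simp add: diff_divide_distrib)
  qed
  have v: "v = (\<lambda>m. (- y 1 / D) * x m + (x 1 / D) * y m)"
  proof
    fix m show "v m = (- y 1 / D) * x m + (x 1 / D) * y m"
      unfolding v_def nplucker_def xy(2) D_def[symmetric] unfolding minor_def
      by (simp add: diff_divide_distrib)
  qed
  show "u 1 = 1" "u n = 0" "v 1 = 0" "v n = 1"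
    unfolding u_def v_def nplucker_def xy(2) using D by (simp_all add: D_def)
  show "m \<notin> {1..n} \<Longrightarrow> u m = 0 \<and> v m = 0" using xy(3)[of m] by (simp add: u v)
  have "(y n / D) * (x 1 / D) - (- x n / D) * (- y 1 / D) = (x 1 * y n - x n * y 1) / (D * D)"
    by (simp add: diff_divide_distrib mult.commute)
  then have "minor u v i j = D / (D * D) * minor x y i j"
    unfolding u v minor_combination D_eq by simp
  then show "nplucker n V i j = minor u v i j" using D by (simp add: nplucker_def xy(2) D_def)
  have "u \<in> fun_space.span {x, y}" "v \<in> fun_space.span {x, y}"
    unfolding in_span_pair using u v by blast+
  then have "fun_space.span {u, v} \<subseteq> fun_space.span {x, y}"
    by (intro fun_space.span_minimal) (auto simp: fun_space.subspace_span)
  moreover have "x = (\<lambda>m. x 1 * u m + x n * v m)"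
  proof
    fix m
    have "x 1 * u m + x n * v m = (x 1 * y n - x n * y 1) * x m / D"
      by (simp add: u v diff_divide_distrib algebra_simps)
    then show "x m = x 1 * u m + x n * v m" using D D_eq by simp
  qed
  moreover have "y = (\<lambda>m. y 1 * u m + y n * v m)"
  proof
    fix m
    have "y 1 * u m + y n * v m = (x 1 * y n - x n * y 1) * y m / D"
      by (simp add: u v diff_divide_distrib algebra_simps)
    then show "y m = y 1 * u m + y n * v m" using D D_eq by simp
  qed
  ultimately have "x \<in> fun_space.span {u, v}" "y \<in> fun_space.span {u, v}"
    unfolding in_span_pair by blast+
  then have "fun_space.span {x, y} \<subseteq> fun_space.span {u, v}"
    by (intro fun_space.span_minimal) (auto simp: fun_space.subspace_span)
  with \<open>fun_space.span {u, v} \<subseteq> fun_space.span {x, y}\<close>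
  show "V = fun_space.span {u, v}" unfolding xy(1) by blast
qed

section \<open>Morphisms between tori and parts of the Grassmannian\<close>

lemma topspace_zariski:
  assumes "(P, Q) \<in> snd X" and "\<And>x. x \<in> points X \<Longrightarrow> Q x \<noteq> 0"
  shows "topspace (zariski X) = points X"
  using assms unfolding zariski_def topology_generated_by_topspace by blast

lemma openin_basic:
  assumes "(P, Q) \<in> snd X" shows "openin (zariski X) {x \<in> points X. Q x \<noteq> 0}"
  unfolding zariski_def by (rule topology_generated_by_Basis) (use assms in blast)

text \<open>
  It is enough to pull back the basic rational functions \<open>P / Q\<close>, and this may be done globally: the
  quotient \<open>P' / Q'\<close> has to represent the pullback wherever it is defined, and \<open>Q'\<close> has to vanish at
  exactly the points where \<open>Q\<close> vanishes after \<open>\<phi>\<close>, which gives continuity as well.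
\<close>

lemma morphism_by_pullback:
  assumes maps: "\<And>x. x \<in> points X \<Longrightarrow> \<phi> x \<in> points Y"
    and X: "topspace (zariski X) = points X" and Y: "topspace (zariski Y) = points Y"
    and pull: "\<And>P Q. (P, Q) \<in> snd Y \<Longrightarrow> \<exists>P' Q'. (P', Q') \<in> snd X \<and> (\<forall>x\<in>points X.
      (Q' x = 0 \<longleftrightarrow> Q (\<phi> x) = 0) \<and> (Q (\<phi> x) \<noteq> 0 \<longrightarrow> P (\<phi> x) / Q (\<phi> x) = P' x / Q' x))"
  shows "morphism X Y \<phi>"
proof -
  have cont: "continuous_map (zariski X) (zariski Y) \<phi>"
    unfolding zariski_def[of Y]
  proof (rule continuous_on_generated_topo)
    fix U assume "U \<in> {{x \<in> points Y. Q x \<noteq> 0} |P Q. (P, Q) \<in> snd Y}"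
    then obtain P Q where U: "U = {x \<in> points Y. Q x \<noteq> 0}" "(P, Q) \<in> snd Y" by blast
    from pull[OF U(2)] obtain P' Q' where 1: "(P', Q') \<in> snd X"
      "\<forall>x\<in>points X. Q' x = 0 \<longleftrightarrow> Q (\<phi> x) = 0" by blast
    have "\<phi> -` U \<inter> topspace (zariski X) = {x \<in> points X. Q' x \<noteq> 0}"
      using 1(2) maps by (auto simp: X U(1))
    then show "openin (zariski X) (\<phi> -` U \<inter> topspace (zariski X))"
      using openin_basic[OF 1(1)] by simp
  next
    show "\<phi> ` topspace (zariski X) \<subseteq> \<Union> {{x \<in> points Y. Q x \<noteq> 0} |P Q. (P, Q) \<in> snd Y}"
      unfolding topology_generated_by_topspace[symmetric] zariski_def[symmetric] X Y
      using maps by blast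
  qed
  have "regular_on X {x \<in> points X. \<phi> x \<in> U} (\<lambda>x. f (\<phi> x))" if f: "regular_on Y U f" for U f
    unfolding regular_on_def
  proof
    fix x assume x: "x \<in> {x \<in> points X. \<phi> x \<in> U}"
    with f obtain V P Q where V: "openin (zariski Y) V" "\<phi> x \<in> V" "V \<subseteq> U"
      and PQ: "(P, Q) \<in> snd Y" "\<And>v. v \<in> V \<Longrightarrow> Q v \<noteq> 0 \<and> f v = P v / Q v"
      unfolding regular_on_def by fast
    from pull[OF PQ(1)] obtain P' Q' where PQ': "(P', Q') \<in> snd X"
      "\<And>x. x \<in> points X \<Longrightarrow> (Q' x = 0 \<longleftrightarrow> Q (\<phi> x) = 0)"
      "\<And>x. x \<in> points X \<Longrightarrow> Q (\<phi> x) \<noteq> 0 \<Longrightarrow> P (\<phi> x) / Q (\<phi> x) = P' x / Q' x" by blast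
    define W where "W = {x \<in> points X. \<phi> x \<in> V}"
    have "openin (zariski X) W"
      using openin_continuous_map_preimage[OF cont V(1)] by (simp add: W_def X)
    moreover have "x \<in> W" "W \<subseteq> {x \<in> points X. \<phi> x \<in> U}" using x V by (auto simp: W_def)
    moreover have "\<forall>w\<in>W. Q' w \<noteq> 0 \<and> f (\<phi> w) = P' w / Q' w"
      using PQ(2) PQ'(2,3) by (simp add: W_def)
    ultimately show "\<exists>W. openin (zariski X) W \<and> x \<in> W \<and> W \<subseteq> {x \<in> points X. \<phi> x \<in> U} \<and>
        (\<exists>(P, Q)\<in>snd X. \<forall>v\<in>W. Q v \<noteq> 0 \<and> f (\<phi> v) = P v / Q v)"
      using PQ'(1) by blast
  qed
  then show ?thesis unfolding morphism_def using cont by blast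
qed

lemma morphism_comp:
  assumes \<phi>: "morphism X Y \<phi>" and \<psi>: "morphism Y Z \<psi>"
    and maps: "\<And>x. x \<in> points X \<Longrightarrow> \<phi> x \<in> points Y"
    and Y: "topspace (zariski Y) = points Y"
  shows "morphism X Z (\<lambda>x. \<psi> (\<phi> x))"
  unfolding morphism_def
proof (intro conjI allI impI; (elim conjE)?)
  show "continuous_map (zariski X) (zariski Z) (\<lambda>x. \<psi> (\<phi> x))"
    using \<phi> \<psi> continuous_map_compose[of "zariski X" "zariski Y" \<phi> "zariski Z" \<psi>]
    by (simp add: morphism_def o_def)
next
  fix U f assume U: "openin (zariski Z) U" "regular_on Z U f"
  have "openin (zariski Y) {y \<in> points Y. \<psi> y \<in> U}"
    using openin_continuous_map_preimage[of "zariski Y" "zariski Z" \<psi> U] \<psi> U(1)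
    by (simp add: morphism_def Y)
  moreover have "regular_on Y {y \<in> points Y. \<psi> y \<in> U} (\<lambda>y. f (\<psi> y))"
    using \<psi> U by (simp add: morphism_def)
  ultimately have "regular_on X {x \<in> points X. \<phi> x \<in> {y \<in> points Y. \<psi> y \<in> U}} (\<lambda>x. f (\<psi> (\<phi> x)))"
    using \<phi> unfolding morphism_def by blast
  moreover have "{x \<in> points X. \<phi> x \<in> {y \<in> points Y. \<psi> y \<in> U}} = {x \<in> points X. \<psi> (\<phi> x) \<in> U}"
    using maps by blast
  ultimately show "regular_on X {x \<in> points X. \<psi> (\<phi> x) \<in> U} (\<lambda>x. f (\<psi> (\<phi> x)))" by simp
qed

text \<open>
  Fractions with one global, nowhere vanishing denominator.  Over an algebraically closed field these
  are the Laurent polynomials, but in this form closure under division by nowhere vanishing functions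
  is immediate.
\<close>

definition regular_on_torus :: "'i set \<Rightarrow> (('i \<Rightarrow> 'k::field) \<Rightarrow> 'k) \<Rightarrow> bool" where
  "regular_on_torus I f \<longleftrightarrow> (\<exists>P Q. polynomial_in (\<lambda>i y. y i) I P \<and> polynomial_in (\<lambda>i y. y i) I Q \<and>
    (\<forall>y\<in>points (torus I). Q y \<noteq> 0 \<and> f y = P y / Q y))"

lemma regular_on_torus_const: "regular_on_torus I (\<lambda>_. a)"
  unfolding regular_on_torus_def
  by (intro exI[of _ "\<lambda>_. a"] exI[of _ "\<lambda>_. 1"]) (simp add: polynomial_in.const)

lemma regular_on_torus_var: "i \<in> I \<Longrightarrow> regular_on_torus I (\<lambda>y. y i)"
  unfolding regular_on_torus_def
  by (intro exI[of _ "\<lambda>y. y i"] exI[of _ "\<lambda>_. 1"])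
    (simp add: polynomial_in.const polynomial_in.var[of i I "\<lambda>i y. y i"])

lemma regular_on_torus_mult:
  assumes "regular_on_torus I f" "regular_on_torus I g"
  shows "regular_on_torus I (\<lambda>y. f y * g y)"
proof -
  from assms obtain P Q R S where "polynomial_in (\<lambda>i y. y i) I P" "polynomial_in (\<lambda>i y. y i) I Q"
    "polynomial_in (\<lambda>i y. y i) I R" "polynomial_in (\<lambda>i y. y i) I S"
    "\<forall>y\<in>points (torus I). Q y \<noteq> 0 \<and> f y = P y / Q y" "\<forall>y\<in>points (torus I). S y \<noteq> 0 \<and> g y = R y / S y"
    unfolding regular_on_torus_def by blast
  then show ?thesis
    unfolding regular_on_torus_def
    by (intro exI[of _ "\<lambda>y. P y * R y"] exI[of _ "\<lambda>y. Q y * S y"]) (auto intro: polynomial_in.mult)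
qed

lemma regular_on_torus_add:
  assumes "regular_on_torus I f" "regular_on_torus I g"
  shows "regular_on_torus I (\<lambda>y. f y + g y)"
proof -
  from assms obtain P Q R S where "polynomial_in (\<lambda>i y. y i) I P" "polynomial_in (\<lambda>i y. y i) I Q"
    "polynomial_in (\<lambda>i y. y i) I R" "polynomial_in (\<lambda>i y. y i) I S"
    "\<forall>y\<in>points (torus I). Q y \<noteq> 0 \<and> f y = P y / Q y" "\<forall>y\<in>points (torus I). S y \<noteq> 0 \<and> g y = R y / S y"
    unfolding regular_on_torus_def by blast
  then show ?thesis
    unfolding regular_on_torus_def
    by (intro exI[of _ "\<lambda>y. P y * S y + R y * Q y"] exI[of _ "\<lambda>y. Q y * S y"])
      (auto intro!: polynomial_in.mult polynomial_in.add simp: field_simps)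
qed

lemma regular_on_torus_divide:
  assumes "regular_on_torus I f" "regular_on_torus I g" "\<And>y. y \<in> points (torus I) \<Longrightarrow> g y \<noteq> 0"
  shows "regular_on_torus I (\<lambda>y. f y / g y)"
proof -
  from assms(1,2) obtain P Q R S where "polynomial_in (\<lambda>i y. y i) I P" "polynomial_in (\<lambda>i y. y i) I Q"
    "polynomial_in (\<lambda>i y. y i) I R" "polynomial_in (\<lambda>i y. y i) I S"
    "\<forall>y\<in>points (torus I). Q y \<noteq> 0 \<and> f y = P y / Q y" "\<forall>y\<in>points (torus I). S y \<noteq> 0 \<and> g y = R y / S y"
    unfolding regular_on_torus_def by blast
  then show ?thesis
    unfolding regular_on_torus_def using assms(3)
    by (intro exI[of _ "\<lambda>y. P y * S y"] exI[of _ "\<lambda>y. Q y * R y"])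
      (auto intro!: polynomial_in.mult)
qed

lemma regular_on_torus_diff:
  assumes "regular_on_torus I f" "regular_on_torus I g"
  shows "regular_on_torus I (\<lambda>y. f y - g y)"
  using regular_on_torus_add[OF assms(1) regular_on_torus_mult[OF regular_on_torus_const[of I "-1"] assms(2)]]
  by simp

lemma regular_on_torus_prod:
  assumes "\<And>i. i \<in> A \<Longrightarrow> regular_on_torus I (f i)"
  shows "regular_on_torus I (\<lambda>y. \<Prod>i\<in>A. f i y)"
  using assms
  by (induction A rule: infinite_finite_induct)
    (simp_all add: regular_on_torus_const regular_on_torus_mult)

lemma regular_on_torus_cong:
  assumes "\<And>y. y \<in> points (torus I) \<Longrightarrow> f y = g y"
  shows "regular_on_torus I f \<longleftrightarrow> regular_on_torus I g"
  unfolding regular_on_torus_def using assms by auto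

lemma polynomial_in_regular_on_torus:
  assumes "polynomial_in (\<lambda>i y. y i) J P" and "\<And>j. j \<in> J \<Longrightarrow> regular_on_torus I (\<lambda>y. \<phi> y j)"
  shows "regular_on_torus I (\<lambda>y. P (\<phi> y))"
  using assms
  by (induction)
    (auto intro: regular_on_torus_const regular_on_torus_add regular_on_torus_mult)

text \<open>
  The common factor \<open>l\<close>, which may vary in any way from point to point, absorbs the choice of basis
  made by \<open>plucker\<close>.
\<close>

lemma torus_pullback:
  assumes "regular_on_torus I f" "regular_on_torus I g"
    and "\<And>y. y \<in> points (torus I) \<Longrightarrow> l y \<noteq> 0 \<and> p y = l y * f y \<and> r y = l y * g y"
  shows "\<exists>P' Q'. (P', Q') \<in> snd (torus I) \<and> (\<forall>y\<in>points (torus I).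
      (Q' y = 0 \<longleftrightarrow> r y = 0) \<and> (r y \<noteq> 0 \<longrightarrow> p y / r y = P' y / Q' y))"
proof -
  from assms(1,2) obtain P Q R S where 1: "polynomial_in (\<lambda>i y. y i) I P" "polynomial_in (\<lambda>i y. y i) I Q"
    "polynomial_in (\<lambda>i y. y i) I R" "polynomial_in (\<lambda>i y. y i) I S"
    and 2: "\<And>y. y \<in> points (torus I) \<Longrightarrow> Q y \<noteq> 0 \<and> f y = P y / Q y"
      "\<And>y. y \<in> points (torus I) \<Longrightarrow> S y \<noteq> 0 \<and> g y = R y / S y"
    unfolding regular_on_torus_def by blast
  have "(\<lambda>y. P y * S y, \<lambda>y. Q y * R y) \<in> snd (torus I)"
    using 1 by (auto simp: torus_def intro!: polynomial_in.mult)
  moreover have "(Q y * R y = 0 \<longleftrightarrow> r y = 0) \<and> (r y \<noteq> 0 \<longrightarrow> p y / r y = P y * S y / (Q y * R y))"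
    if y: "y \<in> points (torus I)" for y
    using 2[OF y] assms(3)[OF y] by auto
  ultimately show ?thesis by blast
qed

lemma topspace_torus: "topspace (zariski (torus I)) = points (torus I)"
  by (rule topspace_zariski[of "\<lambda>_. 1" "\<lambda>_. 1"]) (simp_all add: torus_def polynomial_in.const)

lemma torus_morphism:
  fixes \<phi> :: "('i \<Rightarrow> 'k::field) \<Rightarrow> 'j \<Rightarrow> 'k"
  assumes "\<And>y. y \<in> points (torus I) \<Longrightarrow> \<phi> y \<in> points (torus J)"
    and "\<And>j. j \<in> J \<Longrightarrow> regular_on_torus I (\<lambda>y. \<phi> y j)"
  shows "morphism (torus I) (torus J) \<phi>"
proof (rule morphism_by_pullback)
  fix P Q :: "('j \<Rightarrow> 'k) \<Rightarrow> 'k" assume "(P, Q) \<in> snd (torus J)"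
  then have "polynomial_in (\<lambda>i y. y i) J P" "polynomial_in (\<lambda>i y. y i) J Q" by (auto simp: torus_def)
  then show "\<exists>P' Q'. (P', Q') \<in> snd (torus I) \<and> (\<forall>y\<in>points (torus I).
      (Q' y = 0 \<longleftrightarrow> Q (\<phi> y) = 0) \<and> (Q (\<phi> y) \<noteq> 0 \<longrightarrow> P (\<phi> y) / Q (\<phi> y) = P' y / Q' y))"
    using polynomial_in_regular_on_torus[of J P I \<phi>] polynomial_in_regular_on_torus[of J Q I \<phi>] assms(2)
    by (intro torus_pullback[where l = "\<lambda>_. 1"]) auto
qed (simp_all add: assms(1) topspace_torus)

text \<open>
  A part \<open>S\<close> of the Grassmannian, with the functions inherited from it, is the pair
  \<open>(S, snd (grassmannian n))\<close>.
\<close>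

lemma topspace_Gr_part:
  fixes S :: "(nat \<Rightarrow> 'k::field) set set"
  shows
  "topspace (zariski (S, snd (grassmannian n))) = points (S, snd (grassmannian n))"
  by (rule topspace_zariski[of "\<lambda>_. 1" "\<lambda>_. 1"])
    (auto simp: grassmannian_def intro!: exI[of _ 0] homogeneous_in.const)

lemma homogeneous_in_nplucker:
  fixes \<phi> :: "('i \<Rightarrow> 'k::field) \<Rightarrow> (nat \<Rightarrow> 'k) set"
  assumes "homogeneous_in (\<lambda>(i, j) V. plucker V i j) (edges n) d P"
    and "\<And>y. y \<in> points (torus I) \<Longrightarrow> plucker (\<phi> y) 1 n \<noteq> 0"
    and "\<And>i j. (i, j) \<in> edges n \<Longrightarrow> regular_on_torus I (\<lambda>y. nplucker n (\<phi> y) i j)"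
  shows "\<exists>f. regular_on_torus I f \<and> (\<forall>y\<in>points (torus I). P (\<phi> y) = plucker (\<phi> y) 1 n ^ d * f y)"
  using assms(1)
proof (induction)
  case (const a)
  show ?case by (rule exI[of _ "\<lambda>_. a"]) (simp add: regular_on_torus_const)
next
  case (var e)
  then show ?case using assms(2,3)
    by (cases e, intro exI[of _ "\<lambda>y. nplucker n (\<phi> y) (fst e) (snd e)"]) (simp add: nplucker_def)
next
  case (add d P Q)
  then obtain f g where "regular_on_torus I f" "regular_on_torus I g"
    "\<forall>y\<in>points (torus I). P (\<phi> y) = plucker (\<phi> y) 1 n ^ d * f y"
    "\<forall>y\<in>points (torus I). Q (\<phi> y) = plucker (\<phi> y) 1 n ^ d * g y" by blast
  then show ?case
    by (intro exI[of _ "\<lambda>y. f y + g y"]) (simp add: regular_on_torus_add algebra_simps)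
next
  case (mult d P e Q)
  then obtain f g where "regular_on_torus I f" "regular_on_torus I g"
    "\<forall>y\<in>points (torus I). P (\<phi> y) = plucker (\<phi> y) 1 n ^ d * f y"
    "\<forall>y\<in>points (torus I). Q (\<phi> y) = plucker (\<phi> y) 1 n ^ e * g y" by blast
  then show ?case
    by (intro exI[of _ "\<lambda>y. f y * g y"]) (simp add: regular_on_torus_mult power_add ac_simps)
qed

lemma torus_to_Gr_morphism:
  fixes \<phi> :: "('i \<Rightarrow> 'k::field) \<Rightarrow> (nat \<Rightarrow> 'k) set"
  assumes "\<And>y. y \<in> points (torus I) \<Longrightarrow> \<phi> y \<in> S"
    and "\<And>y. y \<in> points (torus I) \<Longrightarrow> plucker (\<phi> y) 1 n \<noteq> 0"
    and "\<And>i j. (i, j) \<in> edges n \<Longrightarrow> regular_on_torus I (\<lambda>y. nplucker n (\<phi> y) i j)"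
  shows "morphism (torus I) (S, snd (grassmannian n)) \<phi>"
proof (rule morphism_by_pullback)
  fix P Q :: "(nat \<Rightarrow> 'k) set \<Rightarrow> 'k" assume "(P, Q) \<in> snd (S, snd (grassmannian n))"
  then obtain d where PQ: "homogeneous_in (\<lambda>(i, j) V. plucker V i j) (edges n) d P"
    "homogeneous_in (\<lambda>(i, j) V. plucker V i j) (edges n) d Q" by (auto simp: grassmannian_def)
  from homogeneous_in_nplucker[OF PQ(1) assms(2,3)] obtain f where f: "regular_on_torus I f"
    "\<forall>y\<in>points (torus I). P (\<phi> y) = plucker (\<phi> y) 1 n ^ d * f y" by blast
  from homogeneous_in_nplucker[OF PQ(2) assms(2,3)] obtain g where g: "regular_on_torus I g"
    "\<forall>y\<in>points (torus I). Q (\<phi> y) = plucker (\<phi> y) 1 n ^ d * g y" by blast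
  show "\<exists>P' Q'. (P', Q') \<in> snd (torus I) \<and> (\<forall>y\<in>points (torus I).
      (Q' y = 0 \<longleftrightarrow> Q (\<phi> y) = 0) \<and> (Q (\<phi> y) \<noteq> 0 \<longrightarrow> P (\<phi> y) / Q (\<phi> y) = P' y / Q' y))"
    using f g assms(2) by (intro torus_pullback[where l = "\<lambda>y. plucker (\<phi> y) 1 n ^ d"]) auto
qed (simp_all add: assms(1) topspace_torus topspace_Gr_part[unfolded fst_conv])

lemma homogeneous_power:
  assumes "i \<in> I" shows "homogeneous_in x I d (\<lambda>p. x i p ^ d)"
proof (induction d)
  case 0
  show ?case using homogeneous_in.const[of x I 1] by simp
next
  case (Suc d)
  then show ?case using homogeneous_in.mult[OF homogeneous_in.var[OF assms] Suc] by simp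
qed

text \<open>Clearing the powers of \<open>p(1,n)\<close> homogenises a polynomial in the normalised coordinates.\<close>

lemma polynomial_in_nplucker:
  assumes "polynomial_in (\<lambda>i y. y i) J P" and "J \<subseteq> edges n" and "1 < n"
  shows "\<exists>d A. homogeneous_in (\<lambda>(i, j) V. plucker V i j) (edges n) d A \<and> (\<forall>V. plucker V 1 n \<noteq> 0 \<longrightarrow>
    plucker V 1 n ^ d * P (restrict (\<lambda>(i, j). nplucker n V i j) J) = A V)"
  using assms(1)
proof (induction)
  case (const a)
  show ?case by (intro exI[of _ 0] exI[of _ "\<lambda>_. a"]) (simp add: homogeneous_in.const)
next
  case (var e)
  then have "homogeneous_in (\<lambda>(i, j) V. plucker V i j) (edges n) 1 ((\<lambda>(i, j) V. plucker V i j) e)"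
    using assms(2) by (intro homogeneous_in.var) auto
  then show ?case using var
    by (intro exI[of _ 1] exI[of _ "(\<lambda>(i, j) V. plucker V i j) e"]) (auto simp: nplucker_def split: prod.splits)
next
  case (add P Q)
  let ?c = "\<lambda>V. restrict (\<lambda>(i, j). nplucker n V i j) J"
  from add.IH obtain d A e B where
    A: "homogeneous_in (\<lambda>(i, j) V. plucker V i j) (edges n) d A"
      "\<forall>V. plucker V 1 n \<noteq> 0 \<longrightarrow> plucker V 1 n ^ d * P (?c V) = A V" and
    B: "homogeneous_in (\<lambda>(i, j) V. plucker V i j) (edges n) e B"
      "\<forall>V. plucker V 1 n \<noteq> 0 \<longrightarrow> plucker V 1 n ^ e * Q (?c V) = B V" by blast
  have 1: "(1, n) \<in> edges n" using assms(3) by (simp add: edges_def)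
  have pow: "homogeneous_in (\<lambda>(i, j) V. plucker V i j) (edges n) m (\<lambda>V. plucker V 1 n ^ m)" for m
    using homogeneous_power[OF 1, of "\<lambda>(i, j) V. plucker V i j" m] by simp
  have "homogeneous_in (\<lambda>(i, j) V. plucker V i j) (edges n) (d + e)
      (\<lambda>V. plucker V 1 n ^ e * A V + plucker V 1 n ^ d * B V)"
    using homogeneous_in.mult[OF pow A(1), of e] homogeneous_in.mult[OF pow B(1), of d]
    by (intro homogeneous_in.add) (simp_all add: add.commute)
  moreover have "plucker V 1 n ^ (d + e) * (P (?c V) + Q (?c V)) =
      plucker V 1 n ^ e * A V + plucker V 1 n ^ d * B V" if "plucker V 1 n \<noteq> 0" for V
    using A(2)[rule_format, OF that, symmetric] B(2)[rule_format, OF that, symmetric]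
    by (simp add: power_add algebra_simps)
  ultimately show ?case by blast
next
  case (mult P Q)
  let ?c = "\<lambda>V. restrict (\<lambda>(i, j). nplucker n V i j) J"
  from mult.IH obtain d A e B where
    A: "homogeneous_in (\<lambda>(i, j) V. plucker V i j) (edges n) d A"
      "\<forall>V. plucker V 1 n \<noteq> 0 \<longrightarrow> plucker V 1 n ^ d * P (?c V) = A V" and
    B: "homogeneous_in (\<lambda>(i, j) V. plucker V i j) (edges n) e B"
      "\<forall>V. plucker V 1 n \<noteq> 0 \<longrightarrow> plucker V 1 n ^ e * Q (?c V) = B V" by blast
  have "plucker V 1 n ^ (d + e) * (P (?c V) * Q (?c V)) = A V * B V" if "plucker V 1 n \<noteq> 0" for V
    using A(2)[rule_format, OF that, symmetric] B(2)[rule_format, OF that, symmetric]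
    by (simp add: power_add algebra_simps)
  then show ?case using homogeneous_in.mult[OF A(1) B(1)] by blast
qed

lemma Gr_to_torus_morphism:
  fixes S :: "(nat \<Rightarrow> 'k::field) set set"
  assumes J: "J \<subseteq> edges n" and n: "1 < n"
    and S: "\<And>V. V \<in> S \<Longrightarrow> plucker V 1 n \<noteq> 0" "\<And>V i j. V \<in> S \<Longrightarrow> (i, j) \<in> J \<Longrightarrow> plucker V i j \<noteq> 0"
  shows "morphism (S, snd (grassmannian n)) (torus J)
    (\<lambda>V. restrict (\<lambda>(i, j). nplucker n V i j) J)"
proof (rule morphism_by_pullback)
  let ?c = "\<lambda>V. restrict (\<lambda>(i, j). nplucker n V i j) J"
  show "?c V \<in> points (torus J)" if "V \<in> points (S, snd (grassmannian n))" for V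
    using S that by (auto simp: torus_def nplucker_def)
  fix P Q :: "(nat \<times> nat \<Rightarrow> 'k) \<Rightarrow> 'k" assume "(P, Q) \<in> snd (torus J)"
  then have PQ: "polynomial_in (\<lambda>i y. y i) J P" "polynomial_in (\<lambda>i y. y i) J Q" by (auto simp: torus_def)
  from polynomial_in_nplucker[OF PQ(1) J n] polynomial_in_nplucker[OF PQ(2) J n]
  obtain d A e B where
    A: "homogeneous_in (\<lambda>(i, j) V. plucker V i j) (edges n) d A"
      "\<And>V. plucker V 1 n \<noteq> 0 \<Longrightarrow> plucker V 1 n ^ d * P (?c V) = A V" and
    B: "homogeneous_in (\<lambda>(i, j) V. plucker V i j) (edges n) e B"
      "\<And>V. plucker V 1 n \<noteq> 0 \<Longrightarrow> plucker V 1 n ^ e * Q (?c V) = B V" by blast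
  have 1: "(1, n) \<in> edges n" using n by (simp add: edges_def)
  have pow: "homogeneous_in (\<lambda>(i, j) V. plucker V i j) (edges n) m (\<lambda>V. plucker V 1 n ^ m)" for m
    using homogeneous_power[OF 1, of "\<lambda>(i, j) V. plucker V i j" m] by simp
  define P' where "P' V = plucker V 1 n ^ e * A V" for V
  define Q' where "Q' V = plucker V 1 n ^ d * B V" for V
  have "(P', Q') \<in> snd (S, snd (grassmannian n))"
    using homogeneous_in.mult[OF pow A(1), of e] homogeneous_in.mult[OF pow B(1), of d]
    by (auto simp: grassmannian_def P'_def[abs_def] Q'_def[abs_def] add.commute intro!: exI[of _ "d + e"])
  moreover have "(Q' V = 0 \<longleftrightarrow> Q (?c V) = 0) \<and> (Q (?c V) \<noteq> 0 \<longrightarrow> P (?c V) / Q (?c V) = P' V / Q' V)"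
    if "V \<in> S" for V
    using S(1)[OF that] unfolding P'_def Q'_def A(2)[OF S(1)[OF that], symmetric] B(2)[OF S(1)[OF that], symmetric]
    by simp
  ultimately show "\<exists>P' Q'. (P', Q') \<in> snd (S, snd (grassmannian n)) \<and> (\<forall>V\<in>points (S, snd (grassmannian n)).
      (Q' V = 0 \<longleftrightarrow> Q (?c V) = 0) \<and> (Q (?c V) \<noteq> 0 \<longrightarrow> P (?c V) / Q (?c V) = P' V / Q' V))"
    by auto
qed (simp_all add: topspace_torus topspace_Gr_part[unfolded fst_conv])

section \<open>The chart of a triangulation in edge coordinates\<close>

text \<open>
  In the recursion for the apex vectors the only denominators are minors along edges, so every vector
  depends regularly on the data.
\<close>

lemma vectors_regular:
  assumes "interval_triangulation i k E"
    and "\<And>l m. (l, m) \<in> E \<Longrightarrow> regular_on_torus I (\<lambda>z. minor (u z) (v z) l m)"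
    and "\<And>l m z. (l, m) \<in> E \<Longrightarrow> z \<in> points (torus I) \<Longrightarrow> minor (u z) (v z) l m \<noteq> 0"
    and "regular_on_torus I (\<lambda>z. u z i)" "regular_on_torus I (\<lambda>z. v z i)"
    and "regular_on_torus I (\<lambda>z. u z k)" "regular_on_torus I (\<lambda>z. v z k)"
    and "i \<le> m" "m \<le> k"
  shows "regular_on_torus I (\<lambda>z. u z m) \<and> regular_on_torus I (\<lambda>z. v z m)"
  using assms
proof (induction)
  case (side i)
  then show ?case by (cases "m = i") (auto simp: le_Suc_eq)
next
  case (glue i j E k F)
  note E = glue.hyps(1) and F = glue.hyps(2)
  have ijk: "(i, j) \<in> E" "(j, k) \<in> F"
    using interval_triangulation_endpoints[OF E] interval_triangulation_endpoints[OF F] by auto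
  have reg: "regular_on_torus I (\<lambda>z. minor (u z) (v z) l m)" if "(l, m) \<in> insert (i, k) (E \<union> F)" for l m
    using glue.prems(1) that by blast
  have D: "minor (u z) (v z) i k \<noteq> 0" if "z \<in> points (torus I)" for z
    using glue.prems(2)[of i k] that by simp
  have uj: "u z j = (minor (u z) (v z) j k * u z i + minor (u z) (v z) i j * u z k) / minor (u z) (v z) i k"
    and vj: "v z j = (minor (u z) (v z) j k * v z i + minor (u z) (v z) i j * v z k) / minor (u z) (v z) i k"
    if "z \<in> points (torus I)" for z
    using D[OF that] apex_from_base[of "u z" "v z" i k j] by (simp_all add: eq_divide_eq mult.commute)
  have "regular_on_torus I (\<lambda>z. (minor (u z) (v z) j k * u z i + minor (u z) (v z) i j * u z k) / minor (u z) (v z) i k)"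
    using reg ijk glue.prems(3-6) D
    by (intro regular_on_torus_divide regular_on_torus_add regular_on_torus_mult) auto
  then have j1: "regular_on_torus I (\<lambda>z. u z j)"
    by (subst regular_on_torus_cong[OF uj])
  have "regular_on_torus I (\<lambda>z. (minor (u z) (v z) j k * v z i + minor (u z) (v z) i j * v z k) / minor (u z) (v z) i k)"
    using reg ijk glue.prems(3-6) D
    by (intro regular_on_torus_divide regular_on_torus_add regular_on_torus_mult) auto
  then have j2: "regular_on_torus I (\<lambda>z. v z j)"
    by (subst regular_on_torus_cong[OF vj])
  show ?case
  proof (cases "m \<le> j")
    case True
    show ?thesis by (rule glue.IH(1)) (use glue.prems j1 j2 True in simp_all)
  next
    case False
    show ?thesis by (rule glue.IH(2)) (use glue.prems j1 j2 False in simp_all)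
  qed
qed

lemma Gr2_eqI_edges:
  fixes V :: "(nat \<Rightarrow> 'k::field) set"
  assumes T: "interval_triangulation 1 n \<Gamma>"
    and V: "V \<in> Gr2 n" "plucker V 1 n \<noteq> 0" and V': "V' \<in> Gr2 n" "plucker V' 1 n \<noteq> 0"
    and nz: "\<And>i j. (i, j) \<in> \<Gamma> \<Longrightarrow> nplucker n V i j \<noteq> 0"
    and eq: "\<And>i j. (i, j) \<in> \<Gamma> \<Longrightarrow> nplucker n V' i j = nplucker n V i j"
  shows "V' = V"
proof -
  note F = nplucker_frame[OF V] and F' = nplucker_frame[OF V']
  have "nplucker n V' m n = nplucker n V m n \<and> nplucker n V' 1 m = nplucker n V 1 m" for m
  proof (cases "m \<in> {1..n}")
    case True
    show ?thesis
    proof (rule vectors_unique[OF T])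
      show "minor (\<lambda>m. nplucker n V m n) (nplucker n V 1) l m \<noteq> 0" if "(l, m) \<in> \<Gamma>" for l m
        using nz[OF that] F(1)[of l m] by simp
      show "minor (\<lambda>m. nplucker n V' m n) (nplucker n V' 1) l m =
          minor (\<lambda>m. nplucker n V m n) (nplucker n V 1) l m" if "(l, m) \<in> \<Gamma>" for l m
        using eq[OF that] F(1)[of l m] F'(1)[of l m] by simp
    qed (use True F(3-6) F'(3-6) in simp_all)
  next
    case False
    then show ?thesis using F(7)[OF False] F'(7)[OF False] by simp
  qed
  then have "(\<lambda>m. nplucker n V' m n) = (\<lambda>m. nplucker n V m n)"
    "(\<lambda>m. nplucker n V' 1 m) = (\<lambda>m. nplucker n V 1 m)" by (simp_all add: fun_eq_iff)
  then show ?thesis using F(2) F'(2) by simp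
qed

text \<open>
  The image of the chart: the planes with nonvanishing Pluecker coordinates along the triangulation.
\<close>

definition cluster_cell :: "nat \<Rightarrow> (nat \<times> nat) set \<Rightarrow> (nat \<Rightarrow> 'k::field) set set" where
  "cluster_cell n \<Gamma> = {V \<in> Gr2 n. \<forall>(i, j)\<in>\<Gamma>. plucker V i j \<noteq> 0}"

definition edge_coords :: "nat \<Rightarrow> (nat \<times> nat) set \<Rightarrow> (nat \<Rightarrow> 'k::field) set \<Rightarrow> nat \<times> nat \<Rightarrow> 'k" where
  "edge_coords n \<Gamma> V = restrict (\<lambda>(i, j). nplucker n V i j) (Prn n \<Gamma>)"

definition cluster_chart :: "nat \<Rightarrow> (nat \<times> nat) set \<Rightarrow> (nat \<times> nat \<Rightarrow> 'k::field) \<Rightarrow> (nat \<Rightarrow> 'k) set" where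
  "cluster_chart n \<Gamma> z = (SOME V. V \<in> Gr2 n \<and> plucker V 1 n \<noteq> 0 \<and>
    (\<forall>(i, j)\<in>\<Gamma>. nplucker n V i j = (z((1, n) := 1)) (i, j)))"

lemma torus_Prn_nonzero:
  assumes "z \<in> points (torus (Prn n \<Gamma>))" "e \<in> \<Gamma>" "w \<noteq> 0"
  shows "(z((1, n) := w)) e \<noteq> 0"
  using assms by (auto simp: torus_def Prn_def)

lemma cluster_chart:
  fixes z :: "nat \<times> nat \<Rightarrow> 'k::field"
  assumes T: "interval_triangulation 1 n \<Gamma>" and z: "z \<in> points (torus (Prn n \<Gamma>))"
  shows "cluster_chart n \<Gamma> z \<in> Gr2 n" "plucker (cluster_chart n \<Gamma> z) 1 n \<noteq> 0"
    and "(i, j) \<in> \<Gamma> \<Longrightarrow> nplucker n (cluster_chart n \<Gamma> z) i j = (z((1, n) := 1)) (i, j)"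
proof -
  let ?Z = "z((1, n) := 1)"
  have "\<exists>u v. u 1 = 1 \<and> v 1 = 0 \<and> u n = 0 \<and> v n = 1 \<and> (\<forall>(l, m)\<in>\<Gamma>. minor u v l m = ?Z (l, m))"
    by (rule vectors_with_minors[OF T]) (use torus_Prn_nonzero[OF z] in simp_all)
  then obtain u v where uv: "\<forall>(l, m)\<in>\<Gamma>. minor u v l m = ?Z (l, m)" by blast
  define u' where "u' m = (if m \<in> {1..n} then u m else 0)" for m
  define v' where "v' m = (if m \<in> {1..n} then v m else 0)" for m
  have uv': "minor u' v' l m = ?Z (l, m)" if "(l, m) \<in> \<Gamma>" for l m
    using uv that interval_triangulation_edge[OF T that] by (auto simp: u'_def v'_def minor_def)
  have 1: "minor u' v' 1 n = 1" using uv'[OF interval_triangulation_base[OF T]] by simp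
  have "\<exists>V. V \<in> Gr2 n \<and> plucker V 1 n \<noteq> 0 \<and> (\<forall>(i, j)\<in>\<Gamma>. nplucker n V i j = ?Z (i, j))"
  proof (intro exI conjI)
    show "fun_space.span {u', v'} \<in> Gr2 n"
      by (rule span_in_Gr2[of _ _ 1 n]) (use 1 in \<open>auto simp: u'_def v'_def\<close>)
    show "plucker (fun_space.span {u', v'}) 1 n \<noteq> 0" by (rule nplucker_span(1)[OF 1])
    show "\<forall>(i, j)\<in>\<Gamma>. nplucker n (fun_space.span {u', v'}) i j = ?Z (i, j)"
      using uv' by (auto simp: nplucker_span(2)[OF 1] simp del: fun_upd_apply)
  qed
  from someI_ex[OF this, folded cluster_chart_def]
  show "cluster_chart n \<Gamma> z \<in> Gr2 n" "plucker (cluster_chart n \<Gamma> z) 1 n \<noteq> 0"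
    "(i, j) \<in> \<Gamma> \<Longrightarrow> nplucker n (cluster_chart n \<Gamma> z) i j = ?Z (i, j)" by auto
qed

text \<open>
  The normalised coordinates along edges are the variables themselves, so \<open>vectors_regular\<close> applies to
  the basis of \<open>nplucker_frame\<close>.  All other coordinates are minors of that basis.
\<close>

lemma cluster_chart_regular:
  fixes \<Gamma> :: "(nat \<times> nat) set"
  assumes T: "interval_triangulation 1 n \<Gamma>" and ij: "(i, j) \<in> edges n"
  shows "regular_on_torus (Prn n \<Gamma>) (\<lambda>z :: _ \<Rightarrow> 'k::field. nplucker n (cluster_chart n \<Gamma> z) i j)"
proof -
  let ?I = "Prn n \<Gamma>"
  define u where "u z = (\<lambda>m. nplucker n (cluster_chart n \<Gamma> z) m n)" for z :: "nat \<times> nat \<Rightarrow> 'k"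
  define v where "v z = (\<lambda>m. nplucker n (cluster_chart n \<Gamma> z) 1 m)" for z :: "nat \<times> nat \<Rightarrow> 'k"
  have F: "nplucker n (cluster_chart n \<Gamma> z) l m = minor (u z) (v z) l m"
    "u z 1 = 1" "u z n = 0" "v z 1 = 0" "v z n = 1"
    if "z \<in> points (torus ?I)" for z :: "nat \<times> nat \<Rightarrow> 'k" and l m
    unfolding u_def v_def by (rule nplucker_frame[OF cluster_chart(1,2)[OF T that]])+
  have Z: "minor (u z) (v z) l m = (z((1, n) := 1)) (l, m)"
    if "z \<in> points (torus ?I)" "(l, m) \<in> \<Gamma>" for z :: "nat \<times> nat \<Rightarrow> 'k" and l m
    using F(1)[OF that(1), of l m] cluster_chart(3)[OF T that] by simp
  have var: "regular_on_torus ?I (\<lambda>z :: _ \<Rightarrow> 'k. (z((1, n) := 1)) (l, m))" if "(l, m) \<in> \<Gamma>" for l m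
    using that by (cases "(l, m) = (1, n)")
      (auto simp: regular_on_torus_const Prn_def intro!: regular_on_torus_var)
  have uv: "regular_on_torus ?I (\<lambda>z. u z m) \<and> regular_on_torus ?I (\<lambda>z. v z m)" if "1 \<le> m" "m \<le> n" for m
  proof (rule vectors_regular[OF T _ _ _ _ _ _ that])
    show "regular_on_torus ?I (\<lambda>z. minor (u z) (v z) l m)" if "(l, m) \<in> \<Gamma>" for l m
      by (subst regular_on_torus_cong[OF Z]) (use that var in auto)
    show "minor (u z) (v z) l m \<noteq> 0" if "(l, m) \<in> \<Gamma>" "z \<in> points (torus ?I)" for l m z
      using Z[OF that(2,1)] torus_Prn_nonzero[OF that(2,1), of 1] by simp
  qed (subst regular_on_torus_cong[OF F(2)] regular_on_torus_cong[OF F(3)] regular_on_torus_cong[OF F(4)]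
      regular_on_torus_cong[OF F(5)]; simp add: regular_on_torus_const)+
  have "regular_on_torus ?I (\<lambda>z. u z i * v z j - u z j * v z i)"
    using uv[of i] uv[of j] ij by (intro regular_on_torus_diff regular_on_torus_mult) (auto simp: edges_def)
  then show ?thesis
    by (subst regular_on_torus_cong[OF F(1)]) (simp_all add: minor_def)
qed

lemma Prn_subset_edges:
  assumes "interval_triangulation 1 n \<Gamma>"
  shows "\<Gamma> \<subseteq> edges n" "Prn n \<Gamma> \<subseteq> edges n"
  using interval_triangulation_edge[OF assms] by (auto simp: Prn_def edges_def)

lemma cluster_chart_in_cell:
  fixes z :: "nat \<times> nat \<Rightarrow> 'k::field"
  assumes T: "interval_triangulation 1 n \<Gamma>" and z: "z \<in> points (torus (Prn n \<Gamma>))"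
  shows "cluster_chart n \<Gamma> z \<in> cluster_cell n \<Gamma>"
  using cluster_chart[OF T z] torus_Prn_nonzero[OF z, of _ 1]
  by (fastforce simp: cluster_cell_def nplucker_def simp del: fun_upd_apply)

lemma edge_coords_cluster_chart:
  fixes z :: "nat \<times> nat \<Rightarrow> 'k::field"
  assumes T: "interval_triangulation 1 n \<Gamma>" and z: "z \<in> points (torus (Prn n \<Gamma>))"
  shows "edge_coords n \<Gamma> (cluster_chart n \<Gamma> z) = z"
proof (rule extensionalityI)
  show "edge_coords n \<Gamma> (cluster_chart n \<Gamma> z) \<in> extensional (Prn n \<Gamma>)" by (simp add: edge_coords_def)
  show "z \<in> extensional (Prn n \<Gamma>)" using z by (auto simp: torus_def PiE_def)
  show "edge_coords n \<Gamma> (cluster_chart n \<Gamma> z) e = z e" if "e \<in> Prn n \<Gamma>" for e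
    using that cluster_chart(3)[OF T z, of "fst e" "snd e"]
    by (cases e) (auto simp: edge_coords_def Prn_def)
qed

lemma edge_coords_in_torus:
  assumes T: "interval_triangulation 1 n \<Gamma>" and V: "V \<in> cluster_cell n \<Gamma>"
  shows "edge_coords n \<Gamma> V \<in> points (torus (Prn n \<Gamma>))"
  using V interval_triangulation_base[OF T]
  by (auto simp: edge_coords_def torus_def cluster_cell_def nplucker_def Prn_def)

lemma cluster_chart_edge_coords:
  fixes V :: "(nat \<Rightarrow> 'k::field) set"
  assumes T: "interval_triangulation 1 n \<Gamma>" and V: "V \<in> cluster_cell n \<Gamma>"
  shows "cluster_chart n \<Gamma> (edge_coords n \<Gamma> V) = V"
proof (rule Gr2_eqI_edges[OF T])
  note z = edge_coords_in_torus[OF T V]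
  show V1: "V \<in> Gr2 n" "plucker V 1 n \<noteq> 0"
    using V interval_triangulation_base[OF T] by (auto simp: cluster_cell_def)
  show "cluster_chart n \<Gamma> (edge_coords n \<Gamma> V) \<in> Gr2 n"
    "plucker (cluster_chart n \<Gamma> (edge_coords n \<Gamma> V)) 1 n \<noteq> 0"
    by (rule cluster_chart[OF T z])+
  show "nplucker n V i j \<noteq> 0" if "(i, j) \<in> \<Gamma>" for i j
    using V that V1 by (auto simp: cluster_cell_def nplucker_def)
  show "nplucker n (cluster_chart n \<Gamma> (edge_coords n \<Gamma> V)) i j = nplucker n V i j" if "(i, j) \<in> \<Gamma>" for i j
    using cluster_chart(3)[OF T z that] that V1 by (auto simp: edge_coords_def Prn_def nplucker_def)
qed

lemma cluster_chart_morphism: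
  fixes \<Gamma> :: "(nat \<times> nat) set"
  assumes T: "interval_triangulation 1 n \<Gamma>"
  shows "morphism (torus (Prn n \<Gamma>)) (cluster_cell n \<Gamma> :: (nat \<Rightarrow> 'k::field) set set, snd (grassmannian n))
    (cluster_chart n \<Gamma>)"
  by (rule torus_to_Gr_morphism)
    (rule cluster_chart_in_cell[OF T] cluster_chart(2)[OF T] cluster_chart_regular[OF T]; assumption)+

lemma edge_coords_morphism:
  fixes \<Gamma> :: "(nat \<times> nat) set"
  assumes T: "interval_triangulation 1 n \<Gamma>"
  shows "morphism (cluster_cell n \<Gamma> :: (nat \<Rightarrow> 'k::field) set set, snd (grassmannian n)) (torus (Prn n \<Gamma>))
    (edge_coords n \<Gamma>)"
  unfolding edge_coords_def[abs_def]
proof (rule Gr_to_torus_morphism)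
  show "Prn n \<Gamma> \<subseteq> edges n" by (rule Prn_subset_edges[OF T])
  show "1 < n" by (rule interval_triangulation_less[OF T])
  show "plucker V 1 n \<noteq> 0" if "V \<in> cluster_cell n \<Gamma>" for V :: "(nat \<Rightarrow> 'k) set"
    using that interval_triangulation_base[OF T] by (auto simp: cluster_cell_def)
  show "plucker V i j \<noteq> 0" if "V \<in> cluster_cell n \<Gamma>" "(i, j) \<in> Prn n \<Gamma>" for V :: "(nat \<Rightarrow> 'k) set" and i j
    using that by (auto simp: cluster_cell_def Prn_def)
qed

lemma vertex_simps:
  assumes "1 \<le> i" "i \<le> n"
  shows "vertex n i = i" "vertex n (n + i) = i"
proof -
  have "n + i - 1 = i - 1 + n" using assms by simp
  then have "(n + i - 1) mod n = (i - 1) mod n" by (simp only: mod_add_self2)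
  then show "vertex n i = i" "vertex n (n + i) = i"
    unfolding vertex_def using assms by simp_all
qed

lemma points_mirror:
  assumes n: "2 < n"
  shows "points (mirror n) = {V \<in> Gr2 n. plucker V 1 n \<noteq> 0 \<and> (\<forall>i\<in>{1..<n}. plucker V i (Suc i) \<noteq> 0)}"
proof -
  have 1: "plucker_mod n V i (i + 1) = plucker V i (Suc i)" if "i \<in> {1..<n}" for i and V :: "(nat \<Rightarrow> 'a) set"
    using that vertex_simps(1)[of i n] vertex_simps(1)[of "Suc i" n] by (simp add: plucker_mod_def)
  have 2: "plucker_mod n V n (n + 1) = plucker V 1 n" for V :: "(nat \<Rightarrow> 'a) set"
    using n vertex_simps(1)[of n n] vertex_simps(2)[of 1 n] by (simp add: plucker_mod_def)
  have "{1..n} = insert n {1..<n}" using n by auto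
  then show ?thesis
    unfolding mirror_def subvariety_def grassmannian_def using 1 2 by auto
qed

lemma cluster_cell_in_mirror:
  assumes n: "2 < n" and T: "interval_triangulation 1 n \<Gamma>"
  shows "cluster_cell n \<Gamma> \<subseteq> points (mirror n)"
  unfolding points_mirror[OF n]
  using interval_triangulation_base[OF T] interval_triangulation_side[OF T]
  by (fastforce simp: cluster_cell_def)

lemma snd_mirror: "snd (mirror n) = snd (grassmannian n)"
  by (simp add: mirror_def subvariety_def)

lemma openin_cluster_cell:
  fixes \<Gamma> :: "(nat \<times> nat) set"
  assumes n: "2 < n" and T: "interval_triangulation 1 n \<Gamma>"
  shows "openin (zariski (mirror n)) (cluster_cell n \<Gamma> :: (nat \<Rightarrow> 'k::field) set set)"
proof -
  let ?B = "\<lambda>(i, j). {V \<in> points (mirror n). plucker V i j \<noteq> (0::'k)}"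
  have "openin (zariski (mirror n)) (\<Inter>(?B ` \<Gamma>))"
  proof (rule openin_Inter)
    show "finite (?B ` \<Gamma>)" using interval_triangulation_finite[OF T] by simp
    show "?B ` \<Gamma> \<noteq> {}" using interval_triangulation_base[OF T] by blast
    fix X assume "X \<in> ?B ` \<Gamma>"
    then obtain i j where X: "X = {V \<in> points (mirror n). plucker V i j \<noteq> 0}" and ij: "(i, j) \<in> edges n"
      using Prn_subset_edges(1)[OF T] by auto
    have "homogeneous_in (\<lambda>(i, j) (V :: (nat \<Rightarrow> 'k) set). plucker V i j) (edges n) 1 (\<lambda>V. plucker V i j)"
      using homogeneous_in.var[OF ij, of "\<lambda>(i, j) V. plucker V i j"] by simp
    then have "(\<lambda>V. plucker V i j, \<lambda>V. plucker V i j) \<in> snd (mirror n :: (_, 'k) variety)"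
      unfolding snd_mirror grassmannian_def by auto
    from openin_basic[OF this] show "openin (zariski (mirror n)) X" unfolding X .
  qed
  also have "\<Inter>(?B ` \<Gamma>) = cluster_cell n \<Gamma>"
    using cluster_cell_in_mirror[OF n T, where 'a = 'k] interval_triangulation_base[OF T]
    unfolding points_mirror[OF n] by (fastforce simp: cluster_cell_def)
  finally show ?thesis .
qed

section \<open>The monomial substitution between edge and torus coordinates\<close>

text \<open>
  These are the weights \<open>c\<^sub>j\<close>: the normalised side coordinate \<open>p(j,j+1)\<close>, where for \<open>j = n\<close> the side is
  \<open>(1,n)\<close>, with coordinate \<open>1\<close> and weight \<open>q\<close> in the Landau-Ginzburg potential.
\<close>

definition side_coord :: "nat \<Rightarrow> 'k \<Rightarrow> (nat \<times> nat \<Rightarrow> 'k::field) \<Rightarrow> nat \<Rightarrow> 'k" where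
  "side_coord n q z j = (if j < n then z (j, Suc j) else q)"

text \<open>
  Solving \<open>y\<^sub>i\<^sub>j = c\<^sub>j / z(i,j)\<close> for \<open>z\<close>.  On the sides it reads \<open>y\<^bsub>j,j+1\<^esub> = c\<^bsub>j+1\<^esub> / c\<^sub>j\<close>, so \<open>q / c\<^sub>j\<close>
  is the product of the \<open>y\<^bsub>k,k+1\<^esub>\<close> with \<open>j \<le> k < n\<close>.
\<close>

definition z_of_y :: "nat \<Rightarrow> 'k \<Rightarrow> (nat \<times> nat) set \<Rightarrow> (nat \<times> nat \<Rightarrow> 'k::field) \<Rightarrow> nat \<times> nat \<Rightarrow> 'k" where
  "z_of_y n q \<Gamma> y = restrict (\<lambda>(i, j). q / (y (i, j) * (\<Prod>k\<in>{j..<n}. y (k, Suc k)))) (Prn n \<Gamma>)"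

definition y_of_z :: "nat \<Rightarrow> 'k \<Rightarrow> (nat \<times> nat) set \<Rightarrow> (nat \<times> nat \<Rightarrow> 'k::field) \<Rightarrow> nat \<times> nat \<Rightarrow> 'k" where
  "y_of_z n q \<Gamma> z = restrict (\<lambda>(i, j). side_coord n q z j / z (i, j)) (Prn n \<Gamma>)"

lemma torus_nonzero: "y \<in> points (torus I) \<Longrightarrow> e \<in> I \<Longrightarrow> y e \<noteq> 0"
  by (auto simp: torus_def)

lemma torus_eqI:
  assumes "y \<in> points (torus I)" "y' \<in> points (torus I)" "\<And>e. e \<in> I \<Longrightarrow> y e = y' e"
  shows "y = y'"
  using assms by (auto simp: torus_def intro: PiE_ext)

locale triangulated_polygon =
  fixes n :: nat and \<Gamma> :: "(nat \<times> nat) set" and q :: "'k::field"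
  assumes n: "2 < n" and T: "interval_triangulation 1 n \<Gamma>" and q: "q \<noteq> 0"
begin

lemma side_in_Prn: "1 \<le> k \<Longrightarrow> k < n \<Longrightarrow> (k, Suc k) \<in> Prn n \<Gamma>"
  using interval_triangulation_side[OF T] n by (auto simp: Prn_def)

lemma edge_bounds: "(i, j) \<in> \<Gamma> \<Longrightarrow> 1 \<le> i \<and> i < j \<and> j \<le> n"
  by (rule interval_triangulation_edge[OF T])

lemma Prn_edge: "e \<in> Prn n \<Gamma> \<Longrightarrow> e \<in> \<Gamma>"
  by (simp add: Prn_def)

lemma prod_sides_nonzero:
  assumes "y \<in> points (torus (Prn n \<Gamma>))" "1 \<le> j"
  shows "(\<Prod>k\<in>{j..<n}. y (k, Suc k)) \<noteq> (0::'k)"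
  using torus_nonzero[OF assms(1) side_in_Prn] assms(2) by (auto simp: prod_zero_iff)

lemma z_of_y_in_torus:
  assumes "y \<in> points (torus (Prn n \<Gamma>))"
  shows "z_of_y n q \<Gamma> y \<in> points (torus (Prn n \<Gamma>))"
proof -
  have "q / (y (i, j) * (\<Prod>k\<in>{j..<n}. y (k, Suc k))) \<noteq> 0" if "(i, j) \<in> Prn n \<Gamma>" for i j
    using torus_nonzero[OF assms that] prod_sides_nonzero[OF assms, of j] q
      edge_bounds[OF Prn_edge[OF that]] by simp
  then show ?thesis by (auto simp: z_of_y_def torus_def)
qed

lemma side_coord_nonzero:
  assumes "z \<in> points (torus (Prn n \<Gamma>))" "1 \<le> j"
  shows "side_coord n q z j \<noteq> (0::'k)"
  using torus_nonzero[OF assms(1) side_in_Prn[of j]] assms(2) q by (simp add: side_coord_def)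

lemma y_of_z_in_torus:
  assumes "z \<in> points (torus (Prn n \<Gamma>))"
  shows "y_of_z n q \<Gamma> z \<in> points (torus (Prn n \<Gamma>))"
proof -
  have "side_coord n q z j / z (i, j) \<noteq> 0" if "(i, j) \<in> Prn n \<Gamma>" for i j
    using torus_nonzero[OF assms that] side_coord_nonzero[OF assms, of j]
      edge_bounds[OF Prn_edge[OF that]] by simp
  then show ?thesis by (auto simp: y_of_z_def torus_def)
qed

lemma side_coord_z_of_y:
  assumes "1 \<le> j" "j \<le> n"
  shows "side_coord n q (z_of_y n q \<Gamma> y) j = q / (\<Prod>k\<in>{j..<n}. y (k, Suc k))"
proof (cases "j < n")
  case True
  have "(\<Prod>k\<in>{j..<n}. y (k, Suc k)) = y (j, Suc j) * (\<Prod>k\<in>{Suc j..<n}. y (k, Suc k))"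
    using True by (rule prod.atLeast_Suc_lessThan)
  then show ?thesis using True side_in_Prn[OF assms(1)] by (simp add: side_coord_def z_of_y_def)
next
  case False
  then show ?thesis using assms by (simp add: side_coord_def)
qed

text \<open>
  With the conventions \<open>y\<^bsub>1n\<^esub> = q\<close> and \<open>z(1,n) = 1\<close> the relation extends to the side \<open>(1,n)\<close>, because
  \<open>c\<^sub>n = q\<close>.
\<close>

lemma y_eq_side_coord:
  assumes y: "y \<in> points (torus (Prn n \<Gamma>))" and e: "(i, j) \<in> \<Gamma>"
  defines "z \<equiv> z_of_y n q \<Gamma> y"
  shows "(y((1, n) := q)) (i, j) = side_coord n q z j / (z((1, n) := 1)) (i, j)"
proof (cases "(i, j) = (1, n)")
  case True
  then show ?thesis by (simp add: side_coord_def)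
next
  case False
  then have e': "(i, j) \<in> Prn n \<Gamma>" using e by (simp add: Prn_def)
  have j: "1 \<le> j" "j \<le> n" using edge_bounds[OF e] by auto
  have "z (i, j) = q / (y (i, j) * (\<Prod>k\<in>{j..<n}. y (k, Suc k)))"
    using e' by (simp add: z_def z_of_y_def)
  then have "y (i, j) = side_coord n q z j / z (i, j)"
    unfolding z_def side_coord_z_of_y[OF j]
    using torus_nonzero[OF y e'] prod_sides_nonzero[OF y j(1)] q by simp
  then show ?thesis using False by auto
qed

lemma prod_y_eq_side_coord:
  assumes y: "y \<in> points (torus (Prn n \<Gamma>))" and ij: "1 \<le> i" "i \<le> j" "j \<le> n"
  defines "z \<equiv> z_of_y n q \<Gamma> y"
  shows "(\<Prod>l\<in>{i..<j}. y (l, Suc l)) = side_coord n q z j / side_coord n q z i"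
proof -
  have "(\<Prod>l\<in>{i..<n}. y (l, Suc l)) = (\<Prod>l\<in>{i..<j}. y (l, Suc l)) * (\<Prod>l\<in>{j..<n}. y (l, Suc l))"
    using ij by (intro prod.atLeastLessThan_concat[symmetric])
  moreover have "side_coord n q z i = q / (\<Prod>l\<in>{i..<n}. y (l, Suc l))"
    "side_coord n q z j = q / (\<Prod>l\<in>{j..<n}. y (l, Suc l))"
    unfolding z_def using ij by (intro side_coord_z_of_y; simp)+
  ultimately show ?thesis
    using prod_sides_nonzero[OF y, of i] prod_sides_nonzero[OF y, of j] ij q by auto
qed

lemma y_of_z_of_y:
  assumes y: "y \<in> points (torus (Prn n \<Gamma>))"
  shows "y_of_z n q \<Gamma> (z_of_y n q \<Gamma> y) = y"
proof (rule torus_eqI)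
  show "y_of_z n q \<Gamma> (z_of_y n q \<Gamma> y) \<in> points (torus (Prn n \<Gamma>))"
    by (intro y_of_z_in_torus z_of_y_in_torus y)
  fix e assume e: "e \<in> Prn n \<Gamma>"
  then show "y_of_z n q \<Gamma> (z_of_y n q \<Gamma> y) e = y e"
    using y_eq_side_coord[OF y, of "fst e" "snd e"]
    by (cases e) (auto simp: y_of_z_def Prn_def)
qed (rule y)

lemma z_of_y_of_z:
  assumes z: "z \<in> points (torus (Prn n \<Gamma>))"
  shows "z_of_y n q \<Gamma> (y_of_z n q \<Gamma> z) = z"
proof (rule torus_eqI)
  let ?y = "y_of_z n q \<Gamma> z" and ?c = "side_coord n q z"
  note y = y_of_z_in_torus[OF z]
  show "z_of_y n q \<Gamma> ?y \<in> points (torus (Prn n \<Gamma>))" by (rule z_of_y_in_torus[OF y])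
  (* telescoping of the quotients c(k+1) / c(k) up to c(n) = q *)
  have tele: "?c j * (\<Prod>k\<in>{j..<n}. ?y (k, Suc k)) = q" if "1 \<le> j" "j \<le> n" for j
    using that(2,1)
  proof (induction rule: inc_induct)
    case base
    show ?case by (simp add: side_coord_def)
  next
    case (step k)
    have "?y (k, Suc k) = ?c (Suc k) / ?c k"
      using step side_in_Prn[of k] by (simp add: y_of_z_def side_coord_def[of n q z k])
    then have "?c k * ?y (k, Suc k) = ?c (Suc k)" using side_coord_nonzero[OF z step.prems] by simp
    then show ?case using step by (simp add: prod.atLeast_Suc_lessThan mult.assoc[symmetric])
  qed
  fix e assume e: "e \<in> Prn n \<Gamma>"
  obtain i j where ij: "e = (i, j)" by (cases e)
  have j: "1 \<le> j" "j \<le> n" using edge_bounds[OF Prn_edge[OF e[unfolded ij]]] by auto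
  have "?y e * (\<Prod>k\<in>{j..<n}. ?y (k, Suc k)) = q / z e"
    using tele[OF j] e by (simp add: ij y_of_z_def)
  then show "z_of_y n q \<Gamma> ?y e = z e" using e q by (simp add: ij z_of_y_def)
qed (rule z)

lemma z_of_y_morphism: "morphism (torus (Prn n \<Gamma>)) (torus (Prn n \<Gamma>)) (z_of_y n q \<Gamma>)"
proof (rule torus_morphism[OF z_of_y_in_torus])
  let ?I = "Prn n \<Gamma>"
  fix e assume e: "e \<in> ?I"
  obtain i j where ij: "e = (i, j)" by (cases e)
  have j: "1 \<le> j" using edge_bounds[OF Prn_edge[OF e[unfolded ij]]] by auto
  have "regular_on_torus ?I (\<lambda>y. q / (y (i, j) * (\<Prod>k\<in>{j..<n}. y (k, Suc k))))"
  proof (intro regular_on_torus_divide regular_on_torus_mult regular_on_torus_prod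
      regular_on_torus_const regular_on_torus_var)
    show "(i, j) \<in> ?I" using e ij by simp
    show "(k, Suc k) \<in> ?I" if "k \<in> {j..<n}" for k using that j by (intro side_in_Prn) auto
    show "y (i, j) * (\<Prod>k\<in>{j..<n}. y (k, Suc k)) \<noteq> 0" if "y \<in> points (torus ?I)" for y :: "_ \<Rightarrow> 'k"
      using torus_nonzero[OF that e] prod_sides_nonzero[OF that j] ij by simp
  qed
  then show "regular_on_torus ?I (\<lambda>y. z_of_y n q \<Gamma> y e)"
    using e by (simp add: ij z_of_y_def)
qed

lemma y_of_z_morphism: "morphism (torus (Prn n \<Gamma>)) (torus (Prn n \<Gamma>)) (y_of_z n q \<Gamma>)"
proof (rule torus_morphism[OF y_of_z_in_torus])
  let ?I = "Prn n \<Gamma>"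
  fix e assume e: "e \<in> ?I"
  obtain i j where ij: "e = (i, j)" by (cases e)
  have j: "1 \<le> j" using edge_bounds[OF Prn_edge[OF e[unfolded ij]]] by auto
  have "regular_on_torus ?I (\<lambda>z. side_coord n q z j)"
    unfolding side_coord_def using j side_in_Prn
    by (cases "j < n") (auto simp: regular_on_torus_const intro: regular_on_torus_var)
  then have "regular_on_torus ?I (\<lambda>z. side_coord n q z j / z e)"
    using e by (intro regular_on_torus_divide regular_on_torus_var) (auto simp: torus_nonzero[OF _ e])
  then show "regular_on_torus ?I (\<lambda>z. y_of_z n q \<Gamma> z e)"
    using e by (simp add: ij y_of_z_def)
qed

lemma z_of_y_isomorphism: "isomorphism (torus (Prn n \<Gamma>)) (torus (Prn n \<Gamma>)) (z_of_y n q \<Gamma>)"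
  unfolding isomorphism_def
  using z_of_y_morphism y_of_z_morphism y_of_z_of_y z_of_y_of_z by blast

section \<open>The open embedding\<close>

text \<open>The embedding \<open>\<iota>\<close> of the theorem.\<close>

definition chart :: "(nat \<times> nat \<Rightarrow> 'k) \<Rightarrow> (nat \<Rightarrow> 'k) set" where
  "chart y = cluster_chart n \<Gamma> (z_of_y n q \<Gamma> y)"

lemma chart_in_cell: "y \<in> points (torus (Prn n \<Gamma>)) \<Longrightarrow> chart y \<in> cluster_cell n \<Gamma>"
  unfolding chart_def by (intro cluster_chart_in_cell[OF T] z_of_y_in_torus)

lemma chart_Gr2:
  assumes "y \<in> points (torus (Prn n \<Gamma>))"
  shows "chart y \<in> Gr2 n" "plucker (chart y) 1 n \<noteq> 0"
  unfolding chart_def by (rule cluster_chart[OF T z_of_y_in_torus[OF assms]])+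

lemma nplucker_chart:
  assumes "y \<in> points (torus (Prn n \<Gamma>))" "(i, j) \<in> \<Gamma>"
  shows "nplucker n (chart y) i j = ((z_of_y n q \<Gamma> y)((1, n) := 1)) (i, j)"
  unfolding chart_def by (rule cluster_chart(3)[OF T z_of_y_in_torus[OF assms(1)] assms(2)])

lemma chart_image: "chart ` points (torus (Prn n \<Gamma>)) = cluster_cell n \<Gamma>"
proof (intro equalityI subsetI)
  fix V :: "(nat \<Rightarrow> 'k) set" assume V: "V \<in> cluster_cell n \<Gamma>"
  note z = edge_coords_in_torus[OF T V]
  have "V = chart (y_of_z n q \<Gamma> (edge_coords n \<Gamma> V))"
    by (simp add: chart_def z_of_y_of_z[OF z] cluster_chart_edge_coords[OF T V])
  then show "V \<in> chart ` points (torus (Prn n \<Gamma>))" using y_of_z_in_torus[OF z] by blast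
qed (auto intro: chart_in_cell)

text \<open>
  Both factors of \<open>chart\<close> have morphisms as inverses: \<open>y_of_z\<close> for the substitution and
  \<open>edge_coords\<close> for the chart in edge coordinates.
\<close>

lemma chart_open_embedding: "open_embedding (torus (Prn n \<Gamma>)) (mirror n) chart"
proof -
  let ?I = "Prn n \<Gamma>" and ?U = "cluster_cell n \<Gamma> :: (nat \<Rightarrow> 'k) set set"
  have sub: "subvariety (mirror n) ?U = (?U, snd (grassmannian n))"
    using cluster_cell_in_mirror[OF n T, where 'a = 'k]
    by (auto simp: subvariety_def snd_mirror)
  have top: "topspace (zariski (?U, snd (grassmannian n))) = ?U"
    using topspace_Gr_part[of ?U n] by simp
  have "isomorphism (torus ?I) (?U, snd (grassmannian n)) chart"
    unfolding isomorphism_def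
  proof (intro conjI exI[of _ "\<lambda>V. y_of_z n q \<Gamma> (edge_coords n \<Gamma> V)"] ballI)
    show "morphism (torus ?I) (?U, snd (grassmannian n)) chart"
      unfolding chart_def[abs_def]
      by (rule morphism_comp[OF _ cluster_chart_morphism[OF T] z_of_y_in_torus topspace_torus])
        (use z_of_y_isomorphism in \<open>auto simp: isomorphism_def\<close>)
    have "morphism (torus ?I) (torus ?I) (y_of_z n q \<Gamma>)"
      by (rule y_of_z_morphism)
    then show "morphism (?U, snd (grassmannian n)) (torus ?I) (\<lambda>V. y_of_z n q \<Gamma> (edge_coords n \<Gamma> V))"
      by (rule morphism_comp[OF edge_coords_morphism[OF T] _ _ topspace_torus])
        (simp add: edge_coords_in_torus[OF T])
    show "y_of_z n q \<Gamma> (edge_coords n \<Gamma> (chart y)) = y" if "y \<in> points (torus ?I)" for y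
      unfolding chart_def edge_coords_cluster_chart[OF T z_of_y_in_torus[OF that]]
      by (rule y_of_z_of_y[OF that])
    show "chart (y_of_z n q \<Gamma> (edge_coords n \<Gamma> V)) = V" if "V \<in> points (?U, snd (grassmannian n))" for V
      using that
      by (simp add: chart_def z_of_y_of_z[OF edge_coords_in_torus[OF T]] cluster_chart_edge_coords[OF T])
  qed
  then show ?thesis
    unfolding open_embedding_def chart_image sub using openin_cluster_cell[OF n T] by blast
qed

end

section \<open>The two potentials\<close>

lemma LG_potential_nplucker:
  fixes V :: "(nat \<Rightarrow> 'k::field) set"
  assumes n: "2 < n" and V: "V \<in> Gr2 n" and p: "plucker V 1 n \<noteq> 0"
  defines "D \<equiv> nplucker n V"
  shows "LG_potential n q V = (\<Sum>m\<in>{1<..<n}. D (m - 1) (Suc m) / D (m - 1) m) +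
    q * D 1 (n - 1) / D (n - 1) n + D 2 n"
proof -
  let ?f = "\<lambda>i. plucker_mod n V i (i + 2) / plucker_mod n V i (i + 1) * q ^ (if i = n - 1 then 1 else 0)"
  have v: "vertex n i = i" "vertex n (n + i) = i" if "1 \<le> i" "i \<le> n" for i
    using that by (rule vertex_simps)+
  have ratio: "plucker V i j / plucker V k l = D i j / D k l" for i j k l
    using p by (simp add: D_def nplucker_def)
  have 1: "?f i = D i (i + 2) / D i (i + 1)" if "i \<in> {1..<n - 1}" for i
  proof -
    have "vertex n i = i" "vertex n (i + 1) = i + 1" "vertex n (i + 2) = i + 2"
      using that by (auto intro!: v(1))
    then show ?thesis using that by (simp add: plucker_mod_def ratio)
  qed
  have 2: "?f (n - 1) = q * D 1 (n - 1) / D (n - 1) n"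
    using n v(1)[of "n - 1"] v(1)[of n] v(2)[of 1] by (simp add: plucker_mod_def ratio)
  have "D 1 n = 1" using p by (simp add: D_def nplucker_def)
  then have 3: "?f n = D 2 n"
    using n v(1)[of n] v(2)[of 1] v(2)[of 2] by (simp add: plucker_mod_def ratio)
  have "{1..n} = insert n (insert (n - 1) {1..<n - 1})" using n by auto
  then have "LG_potential n q V = ?f n + (?f (n - 1) + (\<Sum>i\<in>{1..<n - 1}. ?f i))"
    unfolding LG_potential_def using n by simp
  also have "(\<Sum>i\<in>{1..<n - 1}. ?f i) = (\<Sum>i\<in>{1..<n - 1}. D i (i + 2) / D i (i + 1))"
    using 1 by (rule sum.cong[OF refl])
  also have "\<dots> = (\<Sum>m\<in>{1<..<n}. D (m - 1) (Suc m) / D (m - 1) m)"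
    by (rule sum.reindex_bij_witness[where i = "\<lambda>m. m - 1" and j = Suc]) auto
  finally show ?thesis unfolding 2 3 by simp
qed

text \<open>
  For the whole polygon, the end terms of \<open>sum_triangles_telescope\<close> at \<open>1\<close> and \<open>n\<close> are the summands of
  the potential with indices \<open>n\<close> and \<open>n - 1\<close>.
\<close>

lemma LG_potential_triangles:
  fixes V :: "(nat \<Rightarrow> 'k::field) set" and c :: "nat \<Rightarrow> 'k"
  assumes n: "2 < n" and T: "interval_triangulation 1 n \<Gamma>" and V: "V \<in> cluster_cell n \<Gamma>"
  defines "D \<equiv> nplucker n V"
  assumes c: "\<And>m. 1 \<le> m \<Longrightarrow> m < n \<Longrightarrow> c m = D m (Suc m)" and cn: "c n = q"
  shows "LG_potential n q V = (\<Sum>(i, j, k)\<in>triangles \<Gamma>. c j * D i k / (D i j * D j k) +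
    c i * D j k / (D i j * D i k) + c k * D i j / (D i k * D j k))"
proof -
  have V': "V \<in> Gr2 n" "plucker V 1 n \<noteq> 0"
    using V interval_triangulation_base[OF T] by (auto simp: cluster_cell_def)
  define u where "u = (\<lambda>m. nplucker n V m n)"
  define v where "v = (\<lambda>m. nplucker n V 1 m)"
  have D: "D = minor u v" unfolding D_def u_def v_def using nplucker_frame(1)[OF V'] by (intro ext)
  have nz: "D i j \<noteq> 0" if "(i, j) \<in> \<Gamma>" for i j
    using V V' that by (auto simp: cluster_cell_def D_def nplucker_def)
  have side: "D m (Suc m) \<noteq> 0" if "1 \<le> m" "m < n" for m
    using nz interval_triangulation_side[OF T that] by blast
  have D1n: "D 1 n = 1" using V' by (simp add: D_def nplucker_def)
  have "(\<Sum>(i, j, k)\<in>triangles \<Gamma>. c j * D i k / (D i j * D j k) +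
    c i * D j k / (D i j * D i k) + c k * D i j / (D i k * D j k)) =
    c 1 * D (Suc 1) n / (D 1 (Suc 1) * D 1 n) + c n * D 1 (n - 1) / (D (n - 1) n * D 1 n) +
    (\<Sum>m\<in>{1<..<n}. c m * D (m - 1) (Suc m) / (D (m - 1) m * D m (Suc m)))"
    unfolding D by (rule sum_triangles_telescope[OF T]) (use nz D in auto)
  also have "(\<Sum>m\<in>{1<..<n}. c m * D (m - 1) (Suc m) / (D (m - 1) m * D m (Suc m))) =
      (\<Sum>m\<in>{1<..<n}. D (m - 1) (Suc m) / D (m - 1) m)"
    using side c by (intro sum.cong refl) simp
  also have "c 1 * D (Suc 1) n / (D 1 (Suc 1) * D 1 n) = D 2 n"
    using side[of 1] n c[of 1] D1n by (simp add: numeral_2_eq_2)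
  also have "c n * D 1 (n - 1) / (D (n - 1) n * D 1 n) = q * D 1 (n - 1) / D (n - 1) n"
    using D1n cn by simp
  finally show ?thesis
    unfolding LG_potential_nplucker[OF n V', folded D_def] by (simp only: ac_simps)
qed

context triangulated_polygon begin

text \<open>
  Each of the three Laurent monomials of a triangle becomes the corner term \<open>c * D / (D * D)\<close> at one of
  its vertices after the substitution \<open>Y(i,j) = c\<^sub>j / D(i,j)\<close>.
\<close>

lemma LG_potential_chart:
  assumes y: "y \<in> points (torus (Prn n \<Gamma>))"
  defines "c \<equiv> side_coord n q (z_of_y n q \<Gamma> y)" and "Y \<equiv> y((1, n) := q)"
  shows "LG_potential n q (chart y) = (\<Sum>(i, j, k)\<in>triangles \<Gamma>.
      Y (i, j) * Y (j, k) / Y (i, k) +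
      Y (i, j) * Y (i, k) / (Y (j, k) * (\<Prod>l\<in>{i..<j}. y (l, l + 1))) +
      Y (i, k) * Y (j, k) / (Y (i, j) * (\<Prod>l\<in>{j..<k}. y (l, l + 1))))"
proof -
  let ?Z = "(z_of_y n q \<Gamma> y)((1, n) := 1)"
  define D where "D = nplucker n (chart y)"
  note z = z_of_y_in_torus[OF y]
  have D: "D i j = ?Z (i, j)" if "(i, j) \<in> \<Gamma>" for i j
    unfolding D_def by (rule nplucker_chart[OF y that])
  have D0: "D i j \<noteq> 0" if "(i, j) \<in> \<Gamma>" for i j
    using torus_Prn_nonzero[OF z that, of 1] D[OF that] by simp
  have Y: "Y (i, j) = c j / D i j" if "(i, j) \<in> \<Gamma>" for i j
    unfolding Y_def c_def D[OF that] by (rule y_eq_side_coord[OF y that])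
  have "LG_potential n q (chart y) = (\<Sum>(i, j, k)\<in>triangles \<Gamma>. c j * D i k / (D i j * D j k) +
    c i * D j k / (D i j * D i k) + c k * D i j / (D i k * D j k))"
    unfolding D_def
  proof (rule LG_potential_triangles[OF n T chart_in_cell[OF y]])
    show "c m = nplucker n (chart y) m (Suc m)" if "1 \<le> m" "m < n" for m
      using nplucker_chart[OF y interval_triangulation_side[OF T that]] that n
      by (auto simp: c_def side_coord_def)
  qed (simp add: c_def side_coord_def)
  also have "\<dots> = (\<Sum>(i, j, k)\<in>triangles \<Gamma>.
      Y (i, j) * Y (j, k) / Y (i, k) +
      Y (i, j) * Y (i, k) / (Y (j, k) * (\<Prod>l\<in>{i..<j}. y (l, l + 1))) +
      Y (i, k) * Y (j, k) / (Y (i, j) * (\<Prod>l\<in>{j..<k}. y (l, l + 1))))"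
  proof (rule sum.cong[OF refl], unfold split_paired_all prod.case)
    fix i j k assume "(i, j, k) \<in> triangles \<Gamma>"
    then have e: "(i, j) \<in> \<Gamma>" "(j, k) \<in> \<Gamma>" "(i, k) \<in> \<Gamma>" by (auto simp: triangles_def)
    have b: "1 \<le> i" "i < j" "j < k" "k \<le> n" using edge_bounds[OF e(1)] edge_bounds[OF e(2)] by auto
    have P: "(\<Prod>l\<in>{i..<j}. y (l, l + 1)) = c j / c i" "(\<Prod>l\<in>{j..<k}. y (l, l + 1)) = c k / c j"
      using prod_y_eq_side_coord[OF y, of i j] prod_y_eq_side_coord[OF y, of j k] b by (simp_all add: c_def)
    have c: "c i \<noteq> 0" "c j \<noteq> 0" "c k \<noteq> 0"
      unfolding c_def using b by (auto intro!: side_coord_nonzero[OF z])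
    show "c j * D i k / (D i j * D j k) + c i * D j k / (D i j * D i k) + c k * D i j / (D i k * D j k) =
      Y (i, j) * Y (j, k) / Y (i, k) +
      Y (i, j) * Y (i, k) / (Y (j, k) * (\<Prod>l\<in>{i..<j}. y (l, l + 1))) +
      Y (i, k) * Y (j, k) / (Y (i, j) * (\<Prod>l\<in>{j..<k}. y (l, l + 1)))"
      unfolding P Y[OF e(1)] Y[OF e(2)] Y[OF e(3)] using c D0[OF e(1)] D0[OF e(2)] D0[OF e(3)] by simp
  qed
  finally show ?thesis .
qed

end

section \<open>Whitehead moves\<close>

text \<open>
  Here \<open>l * f\<^sub>i * f\<^sub>j / z(i,j)\<close> is the function \<open>y(i,j)\<close>.  Both sides of the change of variables have weight
  \<open>l * f\<^sub>b * f\<^sub>d\<close>, and what remains is \<open>1 / z(b,d) = z(a,c) / S\<close>, where \<open>S\<close> is the right hand side of the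
  Pluecker relation.  For \<open>S = 0\<close> both statements are false, since the coordinates do not vanish.
\<close>

lemma whitehead_algebra:
  fixes l :: "'k::field"
  assumes "l \<noteq> 0" "fa \<noteq> 0" "fb \<noteq> 0" "fc \<noteq> 0" "fd \<noteq> 0"
    and "zac \<noteq> 0" "zbd \<noteq> 0" "zab \<noteq> 0" "zbc \<noteq> 0" "zcd \<noteq> 0" "zad \<noteq> 0"
  defines "y1 \<equiv> l * fa * fb / zab" and "y2 \<equiv> l * fb * fc / zbc"
    and "y3 \<equiv> l * fc * fd / zcd" and "y4 \<equiv> l * fa * fd / zad"
  shows "l * fb * fd / zbd = 1 / (l * fa * fc / zac) * (y1 * y2 * y3 * y4 / (y1 * y3 + y2 * y4)) \<longleftrightarrow>
    zac * zbd = zab * zcd + zad * zbc"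
proof -
  define S where "S = zab * zcd + zad * zbc"
  define K where "K = l * l * fa * fb * fc * fd"
  define M where "M = zab * zbc * zcd * zad"
  have K: "K \<noteq> 0" and M: "M \<noteq> 0" using assms by (simp_all add: K_def M_def)
  have "y1 * y3 = K * (zad * zbc) / M" "y2 * y4 = K * (zab * zcd) / M"
    using assms(1-11) unfolding y1_def y2_def y3_def y4_def K_def M_def by (simp_all add: field_simps)
  then have sum: "y1 * y3 + y2 * y4 = K * S / M"
    by (simp add: S_def add_divide_distrib distrib_left)
  have prod: "y1 * y2 * y3 * y4 = K * K / M"
    unfolding y1_def y2_def y3_def y4_def K_def M_def by simp
  have "1 / (l * fa * fc / zac) * (y1 * y2 * y3 * y4 / (y1 * y3 + y2 * y4)) =
      zac / (l * fa * fc) * (K / S)"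
    unfolding sum prod using K M by simp
  also have "\<dots> = l * fb * fd * (zac / S)"
    using assms(1-5) by (simp add: K_def)
  finally have "l * fb * fd / zbd = 1 / (l * fa * fc / zac) * (y1 * y2 * y3 * y4 / (y1 * y3 + y2 * y4)) \<longleftrightarrow>
      l * fb * fd * (1 / zbd) = l * fb * fd * (zac / S)" by simp
  also have "\<dots> \<longleftrightarrow> 1 / zbd = zac / S"
    using assms(1-5) by (subst mult_left_cancel) simp_all
  also have "\<dots> \<longleftrightarrow> zac * zbd = S"
    using assms(6,7) by (cases "S = 0") (auto simp: field_simps)
  finally show ?thesis unfolding S_def .
qed

locale whitehead_flip =
  G: triangulated_polygon n \<Gamma> q + G': triangulated_polygon n \<Gamma>' q for n \<Gamma> \<Gamma>' and q :: "'k::field" +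
  fixes a b c d :: nat
  assumes move: "whitehead_move \<Gamma> \<Gamma>' a b c d"
begin

definition common :: "(nat \<times> nat) set" where
  "common = Prn n \<Gamma> - {(a, c)}"

lemma move_facts:
  "a < b" "b < c" "c < d" "(a, b) \<in> \<Gamma>" "(b, c) \<in> \<Gamma>" "(c, d) \<in> \<Gamma>" "(a, d) \<in> \<Gamma>" "(a, c) \<in> \<Gamma>"
  "(b, d) \<in> \<Gamma>'" "\<Gamma> - {(a, c)} = \<Gamma>' - {(b, d)}"
  using move unfolding whitehead_move_def by (simp_all only: Int_iff insert_subset simp_thms)

lemma order: "1 \<le> a" "a < b" "b < c" "c < d" "d \<le> n"
  using move_facts(1-3) G.edge_bounds[OF move_facts(4)] G.edge_bounds[OF move_facts(6)] by simp_all

lemma quadrilateral: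
  "(a, b) \<in> insert (1, n) common" "(b, c) \<in> insert (1, n) common"
  "(c, d) \<in> insert (1, n) common" "(a, d) \<in> insert (1, n) common"
  using move_facts(1-7) unfolding common_def Prn_def by simp_all

lemma diagonal_not_base: "(a, c) \<noteq> (1, n)" "(b, d) \<noteq> (1, n)"
  using order by simp_all

text \<open>
  Stated as membership rules: \<open>common\<close> itself depends on \<open>\<Gamma>\<close>, so an equation for \<open>\<Gamma>\<close> would be circular
  as a rewrite rule.
\<close>

lemma in_\<Gamma>: "e \<in> \<Gamma> \<longleftrightarrow> e = (a, c) \<or> e = (1, n) \<or> e \<in> common"
  unfolding common_def Prn_def
  using move_facts(8) interval_triangulation_base[OF G.T] by blast

lemma in_\<Gamma>': "e \<in> \<Gamma>' \<longleftrightarrow> e = (b, d) \<or> e = (1, n) \<or> e \<in> common"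
proof -
  have "e \<in> \<Gamma>' \<longleftrightarrow> e = (b, d) \<or> e \<in> \<Gamma> - {(a, c)}"
    unfolding move_facts(10) using move_facts(9) by blast
  also have "e \<in> \<Gamma> - {(a, c)} \<longleftrightarrow> e = (1, n) \<or> e \<in> common"
    unfolding common_def Prn_def
    using diagonal_not_base(1) interval_triangulation_base[OF G.T] by blast
  finally show ?thesis .
qed

lemma Prn_eq: "Prn n \<Gamma> = insert (a, c) common" "Prn n \<Gamma>' = insert (b, d) common"
proof -
  have 1: "(1, n) \<notin> common" unfolding common_def Prn_def by blast
  show "Prn n \<Gamma> = insert (a, c) common"
    using move_facts(8) diagonal_not_base(1) unfolding common_def Prn_def by blast
  show "Prn n \<Gamma>' = insert (b, d) common"
    using 1 diagonal_not_base(2) in_\<Gamma>' unfolding Prn_def by blast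
qed

lemma common_bounds: "(i, j) \<in> common \<Longrightarrow> 1 \<le> i \<and> i < j \<and> j \<le> n"
  by (rule G.edge_bounds) (simp add: common_def Prn_def)

lemma side_common: "1 \<le> k \<Longrightarrow> k < n \<Longrightarrow> (k, Suc k) \<in> common"
  using G.side_in_Prn[of k] order by (auto simp: common_def)

lemma z_agree:
  assumes "\<forall>e\<in>common. y' e = (y e :: 'k)"
  shows "\<forall>e\<in>common. z_of_y n q \<Gamma>' y' e = z_of_y n q \<Gamma> y e"
proof
  fix e assume e: "e \<in> common"
  obtain i j where ij: "e = (i, j)" by (cases e)
  have j: "1 \<le> j" using common_bounds e unfolding ij by force
  have "(\<Prod>k\<in>{j..<n}. y' (k, Suc k)) = (\<Prod>k\<in>{j..<n}. y (k, Suc k))"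
    by (rule prod.cong[OF refl], rule assms[rule_format], rule side_common) (use j in auto)
  then show "z_of_y n q \<Gamma>' y' e = z_of_y n q \<Gamma> y e"
    using assms[rule_format, OF e] e unfolding z_of_y_def Prn_eq ij by simp
qed

lemma y_agree:
  assumes "\<forall>e\<in>common. z' e = (z e :: 'k)"
  shows "\<forall>e\<in>common. y_of_z n q \<Gamma>' z' e = y_of_z n q \<Gamma> z e"
proof
  fix e assume e: "e \<in> common"
  obtain i j where ij: "e = (i, j)" by (cases e)
  have j: "1 \<le> j" using common_bounds e unfolding ij by force
  have "side_coord n q z' j = side_coord n q z j"
    unfolding side_coord_def using assms[rule_format, OF side_common[OF j]] by (rule if_cong[OF refl _ refl])
  then show "y_of_z n q \<Gamma>' z' e = y_of_z n q \<Gamma> z e"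
    using assms[rule_format, OF e] e unfolding y_of_z_def Prn_eq ij by simp
qed

text \<open>
  All sides belong to both triangulations, and the substitution at an edge involves only that edge
  and the sides.
\<close>

lemma agree_iff:
  assumes y: "y \<in> points (torus (Prn n \<Gamma>))" and y': "y' \<in> points (torus (Prn n \<Gamma>'))"
  shows "(\<forall>e\<in>common. y' e = y e) \<longleftrightarrow> (\<forall>e\<in>common. z_of_y n q \<Gamma>' y' e = z_of_y n q \<Gamma> y e)"
  using z_agree[of y' y] y_agree[of "z_of_y n q \<Gamma>' y'" "z_of_y n q \<Gamma> y"]
  unfolding G.y_of_z_of_y[OF y] G'.y_of_z_of_y[OF y'] by (rule iffI)

text \<open>
  A common image satisfies the Pluecker relation.  Conversely, if the common coordinates agree and the
  relation holds, then \<open>p(b,d) \<noteq> 0\<close> allows solving it for \<open>p(a,c)\<close>, so both images have the same coordinates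
  along \<open>\<Gamma>\<close> and coincide.
\<close>

lemma charts_meet_iff:
  assumes y: "y \<in> points (torus (Prn n \<Gamma>))" and y': "y' \<in> points (torus (Prn n \<Gamma>'))"
  shows "G.chart y = G'.chart y' \<longleftrightarrow> plucker_relation n \<Gamma> a b c d (z_of_y n q \<Gamma> y) (z_of_y n q \<Gamma>' y')"
proof -
  let ?V = "G.chart y" and ?V' = "G'.chart y'"
  define Z where "Z = (z_of_y n q \<Gamma> y)((1, n) := 1)"
  define Z' where "Z' = (z_of_y n q \<Gamma>' y')((1, n) := 1)"
  have V: "?V \<in> Gr2 n" "plucker ?V 1 n \<noteq> 0" and V': "?V' \<in> Gr2 n" "plucker ?V' 1 n \<noteq> 0"
    by (rule G.chart_Gr2[OF y] G'.chart_Gr2[OF y'])+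
  have N: "nplucker n ?V i j = Z (i, j)" if "(i, j) \<in> \<Gamma>" for i j
    unfolding Z_def by (rule G.nplucker_chart[OF y that])
  have N': "nplucker n ?V' i j = Z' (i, j)" if "(i, j) \<in> \<Gamma>'" for i j
    unfolding Z'_def by (rule G'.nplucker_chart[OF y' that])
  have Z0: "Z e \<noteq> 0" if "e \<in> \<Gamma>" for e
    unfolding Z_def by (rule torus_Prn_nonzero[OF G.z_of_y_in_torus[OF y] that]) simp
  have Z0': "Z' e \<noteq> 0" if "e \<in> \<Gamma>'" for e
    unfolding Z'_def by (rule torus_Prn_nonzero[OF G'.z_of_y_in_torus[OF y'] that]) simp
  have P: "nplucker n W a c * nplucker n W b d =
      nplucker n W a b * nplucker n W c d + nplucker n W a d * nplucker n W b c"
    if "W \<in> Gr2 n" "plucker W 1 n \<noteq> 0" for W :: "(nat \<Rightarrow> 'k) set"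
    using plucker_identity[of "\<lambda>m. nplucker n W m n" "\<lambda>m. nplucker n W 1 m" a c b d]
    unfolding nplucker_frame(1)[OF that, symmetric] .
  have "(1, n) \<notin> common" by (simp add: common_def Prn_def)
  then have agree: "(\<forall>e\<in>common. z_of_y n q \<Gamma>' y' e = z_of_y n q \<Gamma> y e) \<longleftrightarrow>
      (\<forall>e\<in>insert (1, n) common. Z' e = Z e)"
    unfolding Z_def Z'_def by (metis fun_upd_other fun_upd_same insert_iff)
  have rel: "plucker_relation n \<Gamma> a b c d (z_of_y n q \<Gamma> y) (z_of_y n q \<Gamma>' y') \<longleftrightarrow>
      (\<forall>e\<in>insert (1, n) common. Z' e = Z e) \<and> Z (a, c) * Z' (b, d) = Z (a, b) * Z (c, d) + Z (a, d) * Z (b, c)"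
    unfolding plucker_relation_def Let_def Z_def[symmetric] Z'_def[symmetric] common_def[symmetric] agree
    by (rule refl)
  show ?thesis
    unfolding rel
  proof (intro iffI conjI ballI; (elim conjE)?)
    fix e assume eq: "?V = ?V'" and e: "e \<in> insert (1, n) common"
    obtain i j where ij: "e = (i, j)" by (cases e)
    have "(i, j) \<in> \<Gamma>" "(i, j) \<in> \<Gamma>'" using e ij in_\<Gamma> in_\<Gamma>' by auto
    then show "Z' e = Z e" using N N' eq ij by metis
  next
    assume eq: "?V = ?V'"
    have "nplucker n ?V b d = Z' (b, d)" using N' eq in_\<Gamma>' by simp
    moreover have "nplucker n ?V i j = Z (i, j)" if "(i, j) \<in> insert (a, c) (insert (1, n) common)" for i j
      using N that in_\<Gamma> by blast
    ultimately show "Z (a, c) * Z' (b, d) = Z (a, b) * Z (c, d) + Z (a, d) * Z (b, c)"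
      using P[OF V] quadrilateral by simp
  next
    assume eq: "\<forall>e\<in>insert (1, n) common. Z' e = Z e"
      and rel: "Z (a, c) * Z' (b, d) = Z (a, b) * Z (c, d) + Z (a, d) * Z (b, c)"
    have common: "nplucker n ?V' i j = Z (i, j)" if "(i, j) \<in> insert (1, n) common" for i j
      using N'[of i j] eq that in_\<Gamma>' by auto
    have "nplucker n ?V' a c * Z' (b, d) = Z (a, c) * Z' (b, d)"
      using P[OF V'] N'[of b d] quadrilateral common rel in_\<Gamma>' by simp
    then have "nplucker n ?V' a c = Z (a, c)" using Z0'[of "(b, d)"] in_\<Gamma>' by simp
    then have "nplucker n ?V' i j = nplucker n ?V i j" if "(i, j) \<in> \<Gamma>" for i j
      using that N[OF that] common unfolding in_\<Gamma> by auto
    moreover have "nplucker n ?V i j \<noteq> 0" if "(i, j) \<in> \<Gamma>" for i j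
      using N[OF that] Z0[OF that] by simp
    ultimately have "?V' = ?V" by (intro Gr2_eqI_edges[OF G.T V V'])
    then show "?V = ?V'" by (rule sym)
  qed
qed

end

text \<open>
  The product \<open>F i\<close> of the chosen square roots is a square root of \<open>c\<^sub>i / c\<^sub>1\<close>, so the formula is
  \<open>y(i,j) = (c\<^sub>i c\<^sub>j)\<^bsup>1/2\<^esup> / z(i,j)\<close> with signs of the roots that are consistent for all edges.
\<close>

lemma yfun_in_edge_coords:
  fixes q :: novikov
  assumes "triangulated_polygon n \<Gamma> q" and y: "y \<in> points (torus (Prn n \<Gamma>))" and e: "(i, j) \<in> \<Gamma>"
  defines "z \<equiv> z_of_y n q \<Gamma> y" and "F \<equiv> \<lambda>i. \<Prod>k\<in>{1..<i}. novikov_sqrt (y (k, k + 1))"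
  shows "yfun n q y i j = side_coord n q z 1 * F i * F j / (z((1, n) := 1)) (i, j)"
    and "F i \<noteq> 0" "F j \<noteq> 0"
proof -
  interpret triangulated_polygon n \<Gamma> q by fact
  have b: "1 \<le> i" "i < j" "j \<le> n" using edge_bounds[OF e] by auto
  have y0: "y (k, k + 1) \<noteq> 0" if "1 \<le> k" "k < n" for k
    using torus_nonzero[OF y side_in_Prn[OF that]] by simp
  have s: "novikov_sqrt x * novikov_sqrt x = x" for x
    using novikov_sqrt_squared[of x] by (simp only: power2_eq_square)
  have s0: "novikov_sqrt (y (k, k + 1)) \<noteq> 0" if "1 \<le> k" "k < n" for k
    using s[of "y (k, k + 1)"] y0[OF that] by auto
  have F0: "F m \<noteq> 0" if "m \<le> n" for m
    unfolding F_def using s0 that by (auto simp: prod_zero_iff simp del: Suc_eq_plus1 add_Suc_right)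
  then show "F i \<noteq> 0" "F j \<noteq> 0" using b by auto
  have "F j * F j = (\<Prod>k\<in>{1..<j}. y (k, Suc k))"
    unfolding F_def prod.distrib[symmetric] s by simp
  also have "\<dots> = side_coord n q z j / side_coord n q z 1"
    unfolding z_def by (rule prod_y_eq_side_coord[OF y]) (use b in auto)
  finally have c: "side_coord n q z j = side_coord n q z 1 * (F j * F j)"
    using side_coord_nonzero[OF z_of_y_in_torus[OF y], of 1] by (simp add: z_def)
  have F: "F j = F i * (\<Prod>k\<in>{i..<j}. novikov_sqrt (y (k, k + 1)))"
    unfolding F_def using b by (intro prod.atLeastLessThan_concat[symmetric]) auto
  have "yfun n q y i j = (y((1, n) := q)) (i, j) / (\<Prod>k\<in>{i..<j}. novikov_sqrt (y (k, k + 1)))"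
    using b n y0 by (intro yfun_eq) auto
  also have "(y((1, n) := q)) (i, j) = side_coord n q z j / (z((1, n) := 1)) (i, j)"
    unfolding z_def by (rule y_eq_side_coord[OF y e])
  also have "(\<Prod>k\<in>{i..<j}. novikov_sqrt (y (k, k + 1))) = F j / F i"
    using F F0[of i] b by simp
  finally show "yfun n q y i j = side_coord n q z 1 * F i * F j / (z((1, n) := 1)) (i, j)"
    unfolding c using F0[of j] b by simp
qed

text \<open>
  Both relations contain the agreement of the common coordinates.  Under it the square roots and the
  weight at \<open>1\<close> are the same for both points, so that \<open>whitehead_algebra\<close> compares the remaining equations.
\<close>

lemma change_of_variables_iff_plucker_relation:
  fixes q :: novikov
  assumes "whitehead_flip n \<Gamma> \<Gamma>' q a b c d"
    and y: "y \<in> points (torus (Prn n \<Gamma>))" and y': "y' \<in> points (torus (Prn n \<Gamma>'))"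
  shows "change_of_variables n q \<Gamma> a b c d y y' \<longleftrightarrow>
    plucker_relation n \<Gamma> a b c d (z_of_y n q \<Gamma> y) (z_of_y n q \<Gamma>' y')"
proof -
  interpret whitehead_flip n \<Gamma> \<Gamma>' q a b c d by fact
  define z where "z = z_of_y n q \<Gamma> y"
  define z' where "z' = z_of_y n q \<Gamma>' y'"
  define Z where "Z = z((1, n) := 1)"
  define Z' where "Z' = z'((1, n) := 1)"
  define F where "F i = (\<Prod>k\<in>{1..<i}. novikov_sqrt (y (k, k + 1)))" for i
  define l where "l = side_coord n q z 1"
  have tp: "triangulated_polygon n \<Gamma> q" "triangulated_polygon n \<Gamma>' q"
    by unfold_locales
  have yf: "yfun n q y i j = l * F i * F j / Z (i, j)" "F i \<noteq> 0" "F j \<noteq> 0" if "(i, j) \<in> \<Gamma>" for i j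
    using yfun_in_edge_coords[OF tp(1) y that] by (simp_all add: z_def Z_def F_def l_def)
  have Z0: "Z e \<noteq> 0" if "e \<in> \<Gamma>" for e
    unfolding Z_def z_def by (rule torus_Prn_nonzero[OF G.z_of_y_in_torus[OF y] that]) simp
  have Z0': "Z' e \<noteq> 0" if "e \<in> \<Gamma>'" for e
    unfolding Z'_def z'_def by (rule torus_Prn_nonzero[OF G'.z_of_y_in_torus[OF y'] that]) simp
  have quad: "(a, b) \<in> \<Gamma>" "(b, c) \<in> \<Gamma>" "(c, d) \<in> \<Gamma>" "(a, d) \<in> \<Gamma>" "(a, c) \<in> \<Gamma>" "(b, d) \<in> \<Gamma>'"
    by (rule move_facts)+
  have l0: "l \<noteq> 0"
    unfolding l_def z_def by (rule G.side_coord_nonzero[OF G.z_of_y_in_torus[OF y]]) simp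
  have flip: "yfun n q y' b d = 1 / yfun n q y a c * (yfun n q y a b * yfun n q y b c * yfun n q y c d *
      yfun n q y a d / (yfun n q y a b * yfun n q y c d + yfun n q y b c * yfun n q y a d)) \<longleftrightarrow>
      Z (a, c) * Z' (b, d) = Z (a, b) * Z (c, d) + Z (a, d) * Z (b, c)"
    if agree: "\<forall>e\<in>common. y' e = y e"
  proof -
    have "side_coord n q z' 1 = l"
      using z_agree[OF agree] side_common[of 1] G.n by (simp add: l_def z_def z'_def side_coord_def)
    moreover have "(\<Prod>k\<in>{1..<i}. novikov_sqrt (y' (k, k + 1))) = F i" if "i \<le> n" for i
      unfolding F_def using agree side_common that by (intro prod.cong) auto
    ultimately have "yfun n q y' b d = l * F b * F d / Z' (b, d)"
      using yfun_in_edge_coords(1)[OF tp(2) y' quad(6)] order by (simp add: z'_def Z'_def)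
    then show ?thesis
      unfolding yf(1)[OF quad(1)] yf(1)[OF quad(2)] yf(1)[OF quad(3)] yf(1)[OF quad(4)] yf(1)[OF quad(5)]
      using whitehead_algebra[OF l0 yf(2)[OF quad(1)] yf(3)[OF quad(1)] yf(2)[OF quad(3)] yf(3)[OF quad(3)]
        Z0[OF quad(5)] Z0'[OF quad(6)] Z0[OF quad(1)] Z0[OF quad(2)] Z0[OF quad(3)] Z0[OF quad(4)]]
      by simp
  qed
  have "change_of_variables n q \<Gamma> a b c d y y' \<longleftrightarrow> (\<forall>e\<in>common. y' e = y e) \<and>
      Z (a, c) * Z' (b, d) = Z (a, b) * Z (c, d) + Z (a, d) * Z (b, c)"
    unfolding change_of_variables_def Let_def common_def[symmetric] using flip by blast
  also have "\<dots> \<longleftrightarrow> (\<forall>e\<in>common. z' e = z e) \<and>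
      Z (a, c) * Z' (b, d) = Z (a, b) * Z (c, d) + Z (a, d) * Z (b, c)"
    unfolding agree_iff[OF y y'] z_def z'_def by (rule refl)
  also have "\<dots> \<longleftrightarrow> plucker_relation n \<Gamma> a b c d z z'"
    unfolding plucker_relation_def Let_def common_def Z_def Z'_def by (rule refl)
  finally show ?thesis unfolding z_def z'_def .
qed

lemma novikov_T_nonzero: "0 \<le> l \<Longrightarrow> novikov_T l \<noteq> 0"
proof
  assume l: "0 \<le> l" and "novikov_T l = 0"
  then have "nov_monom 1 l = 0" by (simp add: novikov_T_def Zero_fract_def eq_fract)
  moreover have "nov_coeff (nov_monom 1 l) l = 1" using l by (simp add: nov_monom.rep_eq)
  ultimately show False by (simp add: nov_coeff_0)
qed

theorem theorem1p1:
  fixes n :: nat and lam :: real and q :: novikov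
  assumes "n > 2" and "lam > 0" and "q = novikov_T lam"
  shows "\<exists>(\<iota> :: (nat \<times> nat) set \<Rightarrow> (nat \<times> nat \<Rightarrow> novikov) \<Rightarrow> (nat \<Rightarrow> novikov) set)
      (z :: (nat \<times> nat) set \<Rightarrow> (nat \<times> nat \<Rightarrow> novikov) \<Rightarrow> (nat \<times> nat \<Rightarrow> novikov)).
    (\<forall>\<Gamma>. polygon_triangulation n \<Gamma> \<longrightarrow>
      open_embedding (torus (Prn n \<Gamma>)) (mirror n) (\<iota> \<Gamma>) \<and>
      (\<forall>y\<in>points (torus (Prn n \<Gamma>)). LG_potential n q (\<iota> \<Gamma> y) = torus_potential n q \<Gamma> y) \<and>
      isomorphism (torus (Prn n \<Gamma>)) (torus (Prn n \<Gamma>)) (z \<Gamma>) \<and>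
      (\<forall>y\<in>points (torus (Prn n \<Gamma>)). \<forall>(i, j)\<in>Prn n \<Gamma>.
        z \<Gamma> y (i, j) = plucker (\<iota> \<Gamma> y) i j / plucker (\<iota> \<Gamma> y) 1 n)) \<and>
    (\<forall>\<Gamma> \<Gamma>' a b c d. polygon_triangulation n \<Gamma> \<and> polygon_triangulation n \<Gamma>' \<and> whitehead_move \<Gamma> \<Gamma>' a b c d \<longrightarrow>
      (\<forall>y\<in>points (torus (Prn n \<Gamma>)). \<forall>y'\<in>points (torus (Prn n \<Gamma>')).
        (\<iota> \<Gamma> y = \<iota> \<Gamma>' y' \<longleftrightarrow> change_of_variables n q \<Gamma> a b c d y y') \<and>
        (change_of_variables n q \<Gamma> a b c d y y' \<longleftrightarrow>
          plucker_relation n \<Gamma> a b c d (z \<Gamma> y) (z \<Gamma>' y'))))"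
proof (rule exI[of _ "\<lambda>\<Gamma>. triangulated_polygon.chart n \<Gamma> q"], rule exI[of _ "\<lambda>\<Gamma>. z_of_y n q \<Gamma>"],
    intro conjI allI impI ballI)
  have tp: "triangulated_polygon n \<Gamma> q" if "polygon_triangulation n \<Gamma>" for \<Gamma>
    using polygon_triangulation_interval[OF assms(1) that] assms novikov_T_nonzero[of lam]
    by unfold_locales simp_all
  {
    fix \<Gamma> assume "polygon_triangulation n \<Gamma>"
    then interpret triangulated_polygon n \<Gamma> q by (rule tp)
    show "open_embedding (torus (Prn n \<Gamma>)) (mirror n) chart" by (rule chart_open_embedding)
    show "isomorphism (torus (Prn n \<Gamma>)) (torus (Prn n \<Gamma>)) (z_of_y n q \<Gamma>)" by (rule z_of_y_isomorphism)
    fix y :: "nat \<times> nat \<Rightarrow> novikov" assume y: "y \<in> points (torus (Prn n \<Gamma>))"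
    have "y (k, k + 1) \<noteq> 0" if "1 \<le> k" "k < n" for k
      using torus_nonzero[OF y side_in_Prn[OF that]] by simp
    then show "LG_potential n q (chart y) = torus_potential n q \<Gamma> y"
      using LG_potential_chart[OF y] torus_potential_laurent[OF n Prn_subset_edges(1)[OF T] _ refl, of y q]
      by simp
    fix e assume "e \<in> Prn n \<Gamma>"
    then show "case e of (i, j) \<Rightarrow> z_of_y n q \<Gamma> y (i, j) = plucker (chart y) i j / plucker (chart y) 1 n"
      using nplucker_chart[OF y, of "fst e" "snd e"] by (cases e) (auto simp: nplucker_def Prn_def)
  }
  fix \<Gamma> \<Gamma>' a b c d and y y' :: "nat \<times> nat \<Rightarrow> novikov"
  assume "polygon_triangulation n \<Gamma> \<and> polygon_triangulation n \<Gamma>' \<and> whitehead_move \<Gamma> \<Gamma>' a b c d"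
  then have flip: "whitehead_flip n \<Gamma> \<Gamma>' q a b c d"
    using tp by (intro whitehead_flip.intro whitehead_flip_axioms.intro) blast+
  assume y: "y \<in> points (torus (Prn n \<Gamma>))" "y' \<in> points (torus (Prn n \<Gamma>'))"
  show "change_of_variables n q \<Gamma> a b c d y y' \<longleftrightarrow>
      plucker_relation n \<Gamma> a b c d (z_of_y n q \<Gamma> y) (z_of_y n q \<Gamma>' y')"
    by (rule change_of_variables_iff_plucker_relation[OF flip y])
  then show "triangulated_polygon.chart n \<Gamma> q y = triangulated_polygon.chart n \<Gamma>' q y' \<longleftrightarrow>
      change_of_variables n q \<Gamma> a b c d y y'"
    using whitehead_flip.charts_meet_iff[OF flip y] by simp
qed

end
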